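(* Over $\mathsf{RCA}_0$ the following are equivalent: (1) $\mathsf{RT}(!\omega)$; (2) $\forall X\,\exists Y\,(Y=X^{(\omega)})$.
   Context: A finite set $X\subseteq\mathbb{N}$ is exactly large if $|X|=\min(X)+1$; $[X]^{!\omega}$ is the set of exactly large subsets of $X$. $\mathsf{RT}(!\omega)$: for every infinite $M\subseteq\mathbb{N}$ and every $C:[\mathbb{N}]^{!\omega}\to 2$ there is an infinite $L\subseteq M$ with $C$ constant on $[L]^{!\omega}$. $X'=\{e:\{e\}^X(0)\downarrow\}$ is the Turing jump, $X^{(n)}$ the $n$-th iterated jump, and $X^{(\omega)}=\{(i,j): j\in X^{(i)}\}$. In second order arithmetic, "$Y=X^{(\omega)}$" is formalized as: for every $n$, the $n$-th projection $\{j:(n,j)\in Y\}$ equals $X^{(n)}$, where $X^{(n)}$ existing means there is a set coding a sequence $X_0=X,X_1,\dots,X_n$ with each $X_{i+1}$ the jump of $X_i$. $\mathsf{RCA}_0$ is the standard base system of reverse mathematics. *)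

theory Defs
  imports Main
begin

section \<open>The two-sorted language of second order arithmetic\<close>

text \<open>
  Variables are de Bruijn indices, counted separately for the number sort and the set sort:
  a number quantifier leaves the indices of set variables unchanged, and conversely.
\<close>

datatype tm =
    Var nat
  | Zero
  | One
  | Add tm tm
  | Mul tm tm

datatype fm =
    Eq tm tm  (infix "\<^bold>=" 50)
  | Less tm tm  (infix "\<^bold><" 50)
  | Mem tm nat  (infix "\<^bold>\<in>" 50)
  | Neg fm  ("\<^bold>\<not> _" [40] 40)
  | Conj fm fm  (infixr "\<^bold>\<and>" 35)
  | Disj fm fm  (infixr "\<^bold>\<or>" 30)
  | Impl fm fm  (infixr "\<^bold>\<longrightarrow>" 25)
  | AllN fm
  | ExN fm
  | AllS fm
  | ExS fm

abbreviation Iff :: "fm \<Rightarrow> fm \<Rightarrow> fm"  (infixr "\<^bold>\<longleftrightarrow>" 25)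
  where "\<phi> \<^bold>\<longleftrightarrow> \<psi> \<equiv> (\<phi> \<^bold>\<longrightarrow> \<psi>) \<^bold>\<and> (\<psi> \<^bold>\<longrightarrow> \<phi>)"

text \<open>\<open>shift k t\<close> is \<open>t\<close> moved under \<open>k\<close> number quantifiers.\<close>

primrec shift :: "nat \<Rightarrow> tm \<Rightarrow> tm" where
  "shift k (Var i) = Var (i + k)"
| "shift k Zero = Zero"
| "shift k One = One"
| "shift k (Add s t) = Add (shift k s) (shift k t)"
| "shift k (Mul s t) = Mul (shift k s) (shift k t)"

primrec subst_tm :: "(nat \<Rightarrow> tm) \<Rightarrow> tm \<Rightarrow> tm" where
  "subst_tm \<sigma> (Var i) = \<sigma> i"
| "subst_tm \<sigma> Zero = Zero"
| "subst_tm \<sigma> One = One"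
| "subst_tm \<sigma> (Add s t) = Add (subst_tm \<sigma> s) (subst_tm \<sigma> t)"
| "subst_tm \<sigma> (Mul s t) = Mul (subst_tm \<sigma> s) (subst_tm \<sigma> t)"

text \<open>
  Capture-avoiding simultaneous substitution of the terms \<open>\<sigma>\<close> for the number variables and
  renaming \<open>\<rho>\<close> of the set variables; see \<open>sat_subst\<close> below.
\<close>

primrec subst :: "(nat \<Rightarrow> tm) \<Rightarrow> (nat \<Rightarrow> nat) \<Rightarrow> fm \<Rightarrow> fm" where
  "subst \<sigma> \<rho> (s \<^bold>= t) = (subst_tm \<sigma> s \<^bold>= subst_tm \<sigma> t)"
| "subst \<sigma> \<rho> (s \<^bold>< t) = (subst_tm \<sigma> s \<^bold>< subst_tm \<sigma> t)"
| "subst \<sigma> \<rho> (t \<^bold>\<in> X) = (subst_tm \<sigma> t \<^bold>\<in> \<rho> X)"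
| "subst \<sigma> \<rho> (\<^bold>\<not> \<phi>) = (\<^bold>\<not> subst \<sigma> \<rho> \<phi>)"
| "subst \<sigma> \<rho> (\<phi> \<^bold>\<and> \<psi>) = (subst \<sigma> \<rho> \<phi> \<^bold>\<and> subst \<sigma> \<rho> \<psi>)"
| "subst \<sigma> \<rho> (\<phi> \<^bold>\<or> \<psi>) = (subst \<sigma> \<rho> \<phi> \<^bold>\<or> subst \<sigma> \<rho> \<psi>)"
| "subst \<sigma> \<rho> (\<phi> \<^bold>\<longrightarrow> \<psi>) = (subst \<sigma> \<rho> \<phi> \<^bold>\<longrightarrow> subst \<sigma> \<rho> \<psi>)"
| "subst \<sigma> \<rho> (AllN \<phi>) = AllN (subst (case_nat (Var 0) (\<lambda>i. shift 1 (\<sigma> i))) \<rho> \<phi>)"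
| "subst \<sigma> \<rho> (ExN \<phi>) = ExN (subst (case_nat (Var 0) (\<lambda>i. shift 1 (\<sigma> i))) \<rho> \<phi>)"
| "subst \<sigma> \<rho> (AllS \<phi>) = AllS (subst \<sigma> (case_nat 0 (\<lambda>i. Suc (\<rho> i))) \<phi>)"
| "subst \<sigma> \<rho> (ExS \<phi>) = ExS (subst \<sigma> (case_nat 0 (\<lambda>i. Suc (\<rho> i))) \<phi>)"

section \<open>Structures and satisfaction\<close>

text \<open>
  The number domain is the whole type \<open>'n\<close>; the set variables range over \<open>sets_of M\<close>, an
  arbitrary nonempty family of subsets of \<open>'n\<close>.
\<close>

record 'n l2_structure =
  zero_of :: 'n
  one_of :: 'n
  add_of :: "'n \<Rightarrow> 'n \<Rightarrow> 'n"
  mul_of :: "'n \<Rightarrow> 'n \<Rightarrow> 'n"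
  less_of :: "'n \<Rightarrow> 'n \<Rightarrow> bool"
  sets_of :: "'n set set"

primrec tm_val :: "'n l2_structure \<Rightarrow> (nat \<Rightarrow> 'n) \<Rightarrow> tm \<Rightarrow> 'n" where
  "tm_val M e (Var i) = e i"
| "tm_val M e Zero = zero_of M"
| "tm_val M e One = one_of M"
| "tm_val M e (Add s t) = add_of M (tm_val M e s) (tm_val M e t)"
| "tm_val M e (Mul s t) = mul_of M (tm_val M e s) (tm_val M e t)"

primrec sat :: "'n l2_structure \<Rightarrow> (nat \<Rightarrow> 'n) \<Rightarrow> (nat \<Rightarrow> 'n set) \<Rightarrow> fm \<Rightarrow> bool" where
  "sat M e v (s \<^bold>= t) \<longleftrightarrow> tm_val M e s = tm_val M e t"
| "sat M e v (s \<^bold>< t) \<longleftrightarrow> less_of M (tm_val M e s) (tm_val M e t)"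
| "sat M e v (t \<^bold>\<in> X) \<longleftrightarrow> tm_val M e t \<in> v X"
| "sat M e v (\<^bold>\<not> \<phi>) \<longleftrightarrow> \<not> sat M e v \<phi>"
| "sat M e v (\<phi> \<^bold>\<and> \<psi>) \<longleftrightarrow> sat M e v \<phi> \<and> sat M e v \<psi>"
| "sat M e v (\<phi> \<^bold>\<or> \<psi>) \<longleftrightarrow> sat M e v \<phi> \<or> sat M e v \<psi>"
| "sat M e v (\<phi> \<^bold>\<longrightarrow> \<psi>) \<longleftrightarrow> (sat M e v \<phi> \<longrightarrow> sat M e v \<psi>)"
| "sat M e v (AllN \<phi>) \<longleftrightarrow> (\<forall>a. sat M (case_nat a e) v \<phi>)"
| "sat M e v (ExN \<phi>) \<longleftrightarrow> (\<exists>a. sat M (case_nat a e) v \<phi>)"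
| "sat M e v (AllS \<phi>) \<longleftrightarrow> (\<forall>A\<in>sets_of M. sat M e (case_nat A v) \<phi>)"
| "sat M e v (ExS \<phi>) \<longleftrightarrow> (\<exists>A\<in>sets_of M. sat M e (case_nat A v) \<phi>)"

text \<open>Free variables are universally quantified.\<close>

definition models :: "'n l2_structure \<Rightarrow> fm \<Rightarrow> bool"  (infix "\<Turnstile>" 50)
  where "M \<Turnstile> \<phi> \<longleftrightarrow> (\<forall>e v. (\<forall>i. v i \<in> sets_of M) \<longrightarrow> sat M e v \<phi>)"

lemma tm_val_shift [simp]: "tm_val M e (shift k t) = tm_val M (\<lambda>i. e (i + k)) t"
  by (induction t) auto

lemma tm_val_subst [simp]: "tm_val M e (subst_tm \<sigma> t) = tm_val M (\<lambda>i. tm_val M e (\<sigma> i)) t"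
  by (induction t) auto

lemma sat_subst:
  "sat M e v (subst \<sigma> \<rho> \<phi>) \<longleftrightarrow> sat M (\<lambda>i. tm_val M e (\<sigma> i)) (\<lambda>i. v (\<rho> i)) \<phi>"
proof (induction \<phi> arbitrary: e v \<sigma> \<rho>)
  case (AllN \<phi>)
  have "(\<lambda>i. tm_val M (case_nat a e) (case_nat (Var 0) (\<lambda>i. shift 1 (\<sigma> i)) i)) =
      case_nat a (\<lambda>i. tm_val M e (\<sigma> i))" for a
    by (auto simp: fun_eq_iff split: nat.split)
  then show ?case by (simp only: subst.simps sat.simps AllN)
next
  case (ExN \<phi>)
  have "(\<lambda>i. tm_val M (case_nat a e) (case_nat (Var 0) (\<lambda>i. shift 1 (\<sigma> i)) i)) =
      case_nat a (\<lambda>i. tm_val M e (\<sigma> i))" for a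
    by (auto simp: fun_eq_iff split: nat.split)
  then show ?case by (simp only: subst.simps sat.simps ExN)
next
  case (AllS \<phi>)
  have "(\<lambda>i. case_nat A v (case_nat 0 (\<lambda>i. Suc (\<rho> i)) i)) = case_nat A (\<lambda>i. v (\<rho> i))" for A
    by (auto simp: fun_eq_iff split: nat.split)
  then show ?case by (simp only: subst.simps sat.simps AllS)
next
  case (ExS \<phi>)
  have "(\<lambda>i. case_nat A v (case_nat 0 (\<lambda>i. Suc (\<rho> i)) i)) = case_nat A (\<lambda>i. v (\<rho> i))" for A
    by (auto simp: fun_eq_iff split: nat.split)
  then show ?case by (simp only: subst.simps sat.simps ExS)
qed auto

section \<open>The axioms of $\mathsf{RCA}_0$\<close>

definition basic_axioms :: "fm set" where
  "basic_axioms =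
    {\<^bold>\<not> Add (Var 0) One \<^bold>= Zero,
     Add (Var 0) One \<^bold>= Add (Var 1) One \<^bold>\<longrightarrow> Var 0 \<^bold>= Var 1,
     Add (Var 0) Zero \<^bold>= Var 0,
     Add (Var 0) (Add (Var 1) One) \<^bold>= Add (Add (Var 0) (Var 1)) One,
     Mul (Var 0) Zero \<^bold>= Zero,
     Mul (Var 0) (Add (Var 1) One) \<^bold>= Add (Mul (Var 0) (Var 1)) (Var 0),
     \<^bold>\<not> Var 0 \<^bold>< Zero,
     Var 0 \<^bold>< Add (Var 1) One \<^bold>\<longleftrightarrow> (Var 0 \<^bold>< Var 1 \<^bold>\<or> Var 0 \<^bold>= Var 1)}"

text \<open>The formulas with bounded number quantifiers and no set quantifiers.\<close>

inductive bounded_fm :: "fm \<Rightarrow> bool" where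
  "bounded_fm (s \<^bold>= t)"
| "bounded_fm (s \<^bold>< t)"
| "bounded_fm (t \<^bold>\<in> X)"
| "bounded_fm \<phi> \<Longrightarrow> bounded_fm (\<^bold>\<not> \<phi>)"
| "bounded_fm \<phi> \<Longrightarrow> bounded_fm \<psi> \<Longrightarrow> bounded_fm (\<phi> \<^bold>\<and> \<psi>)"
| "bounded_fm \<phi> \<Longrightarrow> bounded_fm \<psi> \<Longrightarrow> bounded_fm (\<phi> \<^bold>\<or> \<psi>)"
| "bounded_fm \<phi> \<Longrightarrow> bounded_fm \<psi> \<Longrightarrow> bounded_fm (\<phi> \<^bold>\<longrightarrow> \<psi>)"
| "bounded_fm \<phi> \<Longrightarrow> bounded_fm (AllN (Var 0 \<^bold>< shift 1 t \<^bold>\<longrightarrow> \<phi>))"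
| "bounded_fm \<phi> \<Longrightarrow> bounded_fm (ExN (Var 0 \<^bold>< shift 1 t \<^bold>\<and> \<phi>))"

definition Sigma01 :: "fm set" where "Sigma01 = {ExN \<theta> |\<theta>. bounded_fm \<theta>}"

definition Pi01 :: "fm set" where "Pi01 = {AllN \<theta> |\<theta>. bounded_fm \<theta>}"

text \<open>
  In both schemes number variable 0 of \<open>\<phi>\<close> is the variable of induction or comprehension and all
  other free variables are parameters.
\<close>

definition induction_axiom :: "fm \<Rightarrow> fm" where
  "induction_axiom \<phi> =
    (subst (case_nat Zero Var) id \<phi> \<^bold>\<and>
      AllN (\<phi> \<^bold>\<longrightarrow> subst (case_nat (Add (Var 0) One) (\<lambda>i. Var (Suc i))) id \<phi>) \<^bold>\<longrightarrow>
     AllN \<phi>)"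

text \<open>Renaming by \<open>Suc\<close> keeps \<open>\<phi>\<close> from mentioning the set being introduced.\<close>

definition comprehension_axiom :: "fm \<Rightarrow> fm \<Rightarrow> fm" where
  "comprehension_axiom \<phi> \<psi> =
    (AllN (\<phi> \<^bold>\<longleftrightarrow> \<psi>) \<^bold>\<longrightarrow> ExS (AllN (Var 0 \<^bold>\<in> 0 \<^bold>\<longleftrightarrow> subst Var Suc \<phi>)))"

definition RCA0 :: "fm set" where
  "RCA0 = basic_axioms \<union> {induction_axiom \<phi> |\<phi>. \<phi> \<in> Sigma01} \<union>
     {comprehension_axiom \<phi> \<psi> |\<phi> \<psi>. \<phi> \<in> Sigma01 \<and> \<psi> \<in> Pi01}"

section \<open>Codes of pairs and of finite sets\<close>

primrec num :: "nat \<Rightarrow> tm" where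
  "num 0 = Zero"
| "num (Suc k) = Add (num k) One"

text \<open>The injective (not surjective) pairing \<open>(i, j) = (i + j)\<^sup>2 + i\<close>.\<close>

definition pair :: "tm \<Rightarrow> tm \<Rightarrow> tm" where
  "pair s t = Add (Mul (Add s t) (Add s t)) s"

text \<open>
  \<open>s\<close> is an element of the finite set coded by \<open>t\<close>:
  \<open>t = (k, (m, n))\<close>, \<open>s < k\<close> and \<open>m (s + 1) + 1\<close> divides \<open>n\<close>, for some \<open>k m n\<close>.
\<close>

definition MemF :: "tm \<Rightarrow> tm \<Rightarrow> fm"  (infix "\<^bold>\<in>\<^sub>F" 50) where
  "s \<^bold>\<in>\<^sub>F t =
    ExN (ExN (ExN
      (shift 3 t \<^bold>= pair (Var 2) (pair (Var 1) (Var 0)) \<^bold>\<and>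
       shift 3 s \<^bold>< Var 2 \<^bold>\<and>
       ExN (Var 1 \<^bold>= Mul (Add (Mul (Var 2) (Add (shift 4 s) One)) One) (Var 0)))))"

text \<open>
  A finite set is identified with its least code. Numbers not of the form \<open>(k, (m, n))\<close> have no
  elements; they are excluded here because \<open>0 = (0, (0, 0))\<close> codes the empty set.
\<close>

definition FinSet :: "tm \<Rightarrow> fm" where
  "FinSet t =
    AllN (Var 0 \<^bold>< shift 1 t \<^bold>\<longrightarrow> \<^bold>\<not> AllN (Var 0 \<^bold>\<in>\<^sub>F Var 1 \<^bold>\<longleftrightarrow> Var 0 \<^bold>\<in>\<^sub>F shift 2 t))"

text \<open>\<open>s\<close> is the least element of the finite set \<open>t\<close>.\<close>

definition IsMin :: "tm \<Rightarrow> tm \<Rightarrow> fm" where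
  "IsMin s t = (s \<^bold>\<in>\<^sub>F t \<^bold>\<and> AllN (Var 0 \<^bold>\<in>\<^sub>F shift 1 t \<^bold>\<longrightarrow> \<^bold>\<not> Var 0 \<^bold>< shift 1 s))"

text \<open>
  The finite set \<open>t\<close> has \<open>s\<close> elements: some finite set \<open>f\<close> of pairs is the graph of a bijection
  from the numbers below \<open>s\<close> onto \<open>t\<close>.
\<close>

definition IsCard :: "tm \<Rightarrow> tm \<Rightarrow> fm" where
  "IsCard s t =
    ExN
     (AllN (Var 0 \<^bold>< shift 2 s \<^bold>\<longrightarrow>
        ExN (Var 0 \<^bold>\<in>\<^sub>F shift 3 t \<^bold>\<and> pair (Var 1) (Var 0) \<^bold>\<in>\<^sub>F Var 2)) \<^bold>\<and>
      AllN (Var 0 \<^bold>\<in>\<^sub>F shift 2 t \<^bold>\<longrightarrow>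
        ExN (Var 0 \<^bold>< shift 3 s \<^bold>\<and> pair (Var 0) (Var 1) \<^bold>\<in>\<^sub>F Var 2)) \<^bold>\<and>
      AllN (AllN (AllN (AllN
        (pair (Var 3) (Var 2) \<^bold>\<in>\<^sub>F Var 4 \<^bold>\<and> pair (Var 1) (Var 0) \<^bold>\<in>\<^sub>F Var 4 \<^bold>\<longrightarrow>
          (Var 3 \<^bold>= Var 1 \<^bold>\<longleftrightarrow> Var 2 \<^bold>= Var 0))))))"

section \<open>Ramsey's theorem for exactly large sets\<close>

definition ExactlyLarge :: "tm \<Rightarrow> fm" where
  "ExactlyLarge t =
    (FinSet t \<^bold>\<and> ExN (IsMin (Var 0) (shift 1 t) \<^bold>\<and> IsCard (Add (Var 0) One) (shift 1 t)))"

definition Infinite :: "nat \<Rightarrow> fm" where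
  "Infinite X = AllN (ExN (Var 1 \<^bold>< Var 0 \<^bold>\<and> Var 0 \<^bold>\<in> X))"

definition Subset :: "nat \<Rightarrow> nat \<Rightarrow> fm" where
  "Subset X Y = AllN (Var 0 \<^bold>\<in> X \<^bold>\<longrightarrow> Var 0 \<^bold>\<in> Y)"

definition SubsetF :: "tm \<Rightarrow> nat \<Rightarrow> fm" where
  "SubsetF t X = AllN (Var 0 \<^bold>\<in>\<^sub>F shift 1 t \<^bold>\<longrightarrow> Var 0 \<^bold>\<in> X)"

text \<open>
  \<open>C\<close> is (the graph of) a function from the exactly large sets to \<open>{0, 1}\<close>: every element of \<open>C\<close>
  is a pair \<open>(x, i)\<close> with \<open>x\<close> exactly large and \<open>i < 2\<close>, and every exactly large \<open>x\<close> has exactly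
  one \<open>i\<close>.
\<close>

definition Colouring :: "nat \<Rightarrow> fm" where
  "Colouring C =
    (AllN (Var 0 \<^bold>\<in> C \<^bold>\<longrightarrow>
       ExN (ExN (ExactlyLarge (Var 1) \<^bold>\<and> Var 0 \<^bold>< num 2 \<^bold>\<and>
         Var 2 \<^bold>= pair (Var 1) (Var 0)))) \<^bold>\<and>
     AllN (ExactlyLarge (Var 0) \<^bold>\<longrightarrow>
       ExN (pair (Var 1) (Var 0) \<^bold>\<in> C \<^bold>\<and>
         AllN (pair (Var 2) (Var 0) \<^bold>\<in> C \<^bold>\<longrightarrow> Var 0 \<^bold>= Var 1))))"

text \<open>\<open>C\<close> is constant on the exactly large subsets of \<open>L\<close>.\<close>

definition Homogeneous :: "nat \<Rightarrow> nat \<Rightarrow> fm" where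
  "Homogeneous C L =
    ExN (AllN (ExactlyLarge (Var 0) \<^bold>\<and> SubsetF (Var 0) L \<^bold>\<longrightarrow> pair (Var 0) (Var 1) \<^bold>\<in> C))"

definition RT_exactly_large :: fm where
  "RT_exactly_large =
    AllS (AllS (Infinite 1 \<^bold>\<and> Colouring 0 \<^bold>\<longrightarrow>
      ExS (Infinite 0 \<^bold>\<and> Subset 0 2 \<^bold>\<and> Homogeneous 1 0)))"

section \<open>Partial recursive functionals and iterated jumps\<close>

text \<open>
  Indices of the unary partial \<open>X\<close>-recursive functions; functions of several arguments act on
  pairs, and an index of none of the following forms denotes the empty function.
    \<^item> \<open>{(0, k)}(x) = k\<close>, \<open>{(1, 0)}(x) = x\<close>, \<open>{(2, 0)}((i, j)) = i\<close>, \<open>{(3, 0)}((i, j)) = j\<close>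
    \<^item> \<open>{(4, 0)}((i, j)) = i + j\<close>, \<open>{(5, 0)}((i, j)) = i j\<close>
    \<^item> \<open>{(6, 0)}((i, j)) = 1\<close> if \<open>i < j\<close>, and \<open>0\<close> otherwise
    \<^item> \<open>{(7, 0)}(x) = 1\<close> if \<open>x \<in> X\<close>, and \<open>0\<close> otherwise
    \<^item> \<open>{(8, (f, g))}(x) = {f}({g}(x))\<close>
    \<^item> \<open>{(9, (f, g))}(x) = ({f}(x), {g}(x))\<close>
    \<^item> \<open>{(10, f)}(x)\<close> is the least \<open>y\<close> with \<open>{f}((x, y)) = 0\<close>, where \<open>{f}((x, z))\<close> has to converge
      for all \<open>z < y\<close>

  Primitive recursion is not needed as a separate clause, since addition, multiplication and the
  characteristic function of the order are available as initial functions.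

  \<open>Step X d e x y\<close> says that the value \<open>{e}(x) = y\<close> with oracle \<open>X\<close> follows by one of these clauses
  from values recorded in \<open>d\<close>, a finite set of triples \<open>(e, (x, y))\<close>.
\<close>

definition triple :: "tm \<Rightarrow> tm \<Rightarrow> tm \<Rightarrow> tm" where
  "triple s t u = pair s (pair t u)"

definition Step :: "nat \<Rightarrow> tm \<Rightarrow> tm \<Rightarrow> tm \<Rightarrow> tm \<Rightarrow> fm" where
  "Step X d e x y =
    (e \<^bold>= pair (num 0) y
   \<^bold>\<or> e \<^bold>= pair (num 1) Zero \<^bold>\<and> y \<^bold>= x
   \<^bold>\<or> e \<^bold>= pair (num 2) Zero \<^bold>\<and> ExN (shift 1 x \<^bold>= pair (shift 1 y) (Var 0))
   \<^bold>\<or> e \<^bold>= pair (num 3) Zero \<^bold>\<and> ExN (shift 1 x \<^bold>= pair (Var 0) (shift 1 y))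
   \<^bold>\<or> e \<^bold>= pair (num 4) Zero \<^bold>\<and>
       ExN (ExN (shift 2 x \<^bold>= pair (Var 1) (Var 0) \<^bold>\<and> shift 2 y \<^bold>= Add (Var 1) (Var 0)))
   \<^bold>\<or> e \<^bold>= pair (num 5) Zero \<^bold>\<and>
       ExN (ExN (shift 2 x \<^bold>= pair (Var 1) (Var 0) \<^bold>\<and> shift 2 y \<^bold>= Mul (Var 1) (Var 0)))
   \<^bold>\<or> e \<^bold>= pair (num 6) Zero \<^bold>\<and>
       ExN (ExN (shift 2 x \<^bold>= pair (Var 1) (Var 0) \<^bold>\<and>
         (Var 1 \<^bold>< Var 0 \<^bold>\<and> shift 2 y \<^bold>= One \<^bold>\<or> \<^bold>\<not> Var 1 \<^bold>< Var 0 \<^bold>\<and> shift 2 y \<^bold>= Zero)))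
   \<^bold>\<or> e \<^bold>= pair (num 7) Zero \<^bold>\<and> (x \<^bold>\<in> X \<^bold>\<and> y \<^bold>= One \<^bold>\<or> \<^bold>\<not> x \<^bold>\<in> X \<^bold>\<and> y \<^bold>= Zero)
   \<^bold>\<or> ExN (ExN (ExN
       (shift 3 e \<^bold>= pair (num 8) (pair (Var 2) (Var 1)) \<^bold>\<and>
        triple (Var 1) (shift 3 x) (Var 0) \<^bold>\<in>\<^sub>F shift 3 d \<^bold>\<and>
        triple (Var 2) (Var 0) (shift 3 y) \<^bold>\<in>\<^sub>F shift 3 d)))
   \<^bold>\<or> ExN (ExN (ExN (ExN
       (shift 4 e \<^bold>= pair (num 9) (pair (Var 3) (Var 2)) \<^bold>\<and>
        triple (Var 3) (shift 4 x) (Var 1) \<^bold>\<in>\<^sub>F shift 4 d \<^bold>\<and>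
        triple (Var 2) (shift 4 x) (Var 0) \<^bold>\<in>\<^sub>F shift 4 d \<^bold>\<and>
        shift 4 y \<^bold>= pair (Var 1) (Var 0)))))
   \<^bold>\<or> ExN
       (shift 1 e \<^bold>= pair (num 10) (Var 0) \<^bold>\<and>
        triple (Var 0) (pair (shift 1 x) (shift 1 y)) Zero \<^bold>\<in>\<^sub>F shift 1 d \<^bold>\<and>
        AllN (Var 0 \<^bold>< shift 2 y \<^bold>\<longrightarrow>
          ExN (Zero \<^bold>< Var 0 \<^bold>\<and>
            triple (Var 2) (pair (shift 3 x) (Var 1)) (Var 0) \<^bold>\<in>\<^sub>F shift 3 d))))"

text \<open>
  Every triple in \<open>d\<close> is justified within \<open>d\<close>. This cannot be circular, because the clauses only
  refer to indices below \<open>e\<close>.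
\<close>

definition Computation :: "nat \<Rightarrow> tm \<Rightarrow> fm" where
  "Computation X d =
    AllN (AllN (AllN
      (triple (Var 2) (Var 1) (Var 0) \<^bold>\<in>\<^sub>F shift 3 d \<^bold>\<longrightarrow>
        Step X (shift 3 d) (Var 2) (Var 1) (Var 0))))"

text \<open>\<open>{e}(x)\<close> converges with oracle \<open>X\<close>.\<close>

definition Converges :: "nat \<Rightarrow> tm \<Rightarrow> tm \<Rightarrow> fm" where
  "Converges X e x =
    ExN (ExN (Computation X (Var 1) \<^bold>\<and>
      triple (shift 2 e) (shift 2 x) (Var 0) \<^bold>\<in>\<^sub>F Var 1))"

text \<open>\<open>B\<close> is the jump of \<open>A\<close>.\<close>

definition IsJump :: "nat \<Rightarrow> nat \<Rightarrow> fm" where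
  "IsJump B A = AllN (Var 0 \<^bold>\<in> B \<^bold>\<longleftrightarrow> Converges A (Var 0) Zero)"

text \<open>\<open>A = {j. (t, j) \<in> Z}\<close>.\<close>

definition IsSection :: "nat \<Rightarrow> tm \<Rightarrow> nat \<Rightarrow> fm" where
  "IsSection A t Z = AllN (Var 0 \<^bold>\<in> A \<^bold>\<longleftrightarrow> pair (shift 1 t) (Var 0) \<^bold>\<in> Z)"

text \<open>
  \<open>W\<close> is the \<open>t\<close>-th jump of \<open>X\<close>: there is a set whose sections \<open>X\<^sub>0, \<dots>, X\<^sub>t\<close> satisfy
  \<open>X\<^sub>0 = X\<close> and \<open>X\<^sub>t = W\<close>, each \<open>X\<^bsub>i+1\<^esub>\<close> with \<open>i < t\<close> being the jump of \<open>X\<^sub>i\<close>.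
\<close>

definition IsIteratedJump :: "nat \<Rightarrow> tm \<Rightarrow> nat \<Rightarrow> fm" where
  "IsIteratedJump W t X =
    ExS (IsSection (Suc X) Zero 0 \<^bold>\<and>
      AllN (Var 0 \<^bold>< shift 1 t \<^bold>\<longrightarrow>
        ExS (ExS (IsSection 1 (Var 0) 2 \<^bold>\<and> IsSection 0 (Add (Var 0) One) 2 \<^bold>\<and> IsJump 0 1))) \<^bold>\<and>
      IsSection (Suc W) t 0)"

text \<open>For every \<open>n\<close>, the \<open>n\<close>-th section of \<open>Y\<close> is the \<open>n\<close>-th jump of \<open>X\<close>.\<close>

definition IsOmegaJump :: "nat \<Rightarrow> nat \<Rightarrow> fm" where
  "IsOmegaJump Y X = AllN (ExS (IsSection 0 (Var 0) (Suc Y) \<^bold>\<and> IsIteratedJump 0 (Var 0) (Suc X)))"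

definition Omega_jumps_exist :: fm where
  "Omega_jumps_exist = AllS (ExS (IsOmegaJump 0 1))"

end

theory Submission
  imports Defs
begin

text \<open>
  From (1) to (2): colour an exactly large set \<open>{a < b\<^sub>1 < b\<^sub>2 < \<dots>}\<close> by comparing two approximations to
  the first \<open>a / 2\<close> jumps of \<open>X\<close>, one searching for computations below the elements of an initial block
  of the \<open>b\<^sub>i\<close>, the other below those of a later block. Infinitely many blocks give only finitely many
  approximations up to \<open>a\<close>, so by the pigeonhole principle some exactly large subset of any infinite set
  has two agreeing blocks. On a homogeneous set \<open>L\<close> all blocks therefore agree, and \<open>L\<close> computes
  \<open>X\<^sup>(\<^sup>n\<^sup>)\<close> uniformly in \<open>n\<close>. No arithmetical comprehension is needed for this, only induction for
  recursively enumerable predicates.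

  From (2) to (1): let \<open>Y\<close> be the omega jump of a set coding the colouring \<open>c\<^sub>0\<close> and the given infinite set
  \<open>B\<^sub>0\<close>. Among the sets arithmetical in some section of \<open>Y\<close> choose infinite sets \<open>B\<^sub>0 \<supseteq> B\<^sub>1 \<supseteq> \<dots>\<close> along which the limits
  \<open>c\<^bsub>k+1\<^esub>(s) = lim c\<^sub>k(s \<union> {x})\<close>, for \<open>x\<close> in \<open>B\<^bsub>k+1\<^esub>\<close>, exist for all finite sets \<open>s\<close>. If the elements of
  \<open>L\<close> are chosen one after the other such that the limits are already attained, then the colour of an exactly
  large subset of \<open>L\<close> with least element \<open>a\<close> is \<open>c\<^sub>a({a})\<close>, and it remains to thin out \<open>L\<close> according to this colour.
\<close>

section \<open>Arithmetic\<close>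

text \<open>Everything takes place inside an arbitrary model: numbers, finite sets, cardinalities
  and iterations may be nonstandard, and at the outset only \<open>S1\<close> predicates admit
  induction. Hence each construction comes with a proof that it is definable, bounds are explicit or
  obtained by collection, and recursion produces numbers, never sets.

  Why half of \<open>a\<close>: above its least element \<open>a\<close> an exactly large set has
  \<open>a\<close> further elements, and level \<open>n\<close> of an approximation uses up
  \<open>n\<close> of them. A block of \<open>m = a / 2\<close> elements serves all levels up to
  \<open>m\<close> and leaves at least \<open>m\<close> for a second block. Agreement of blocks is
  enough although no approximation need be correct by itself: a value that does not depend on the
  starting point may be computed from a starting point beyond any given halting computation, and
  there it is correct.

  In the converse direction every limit costs a fixed number of jumps, so the sets become more
  complex with \<open>k\<close>; the sections of one \<open>Y\<close> provide for all
  \<open>k\<close> at once. The recursion that finds their indices is arithmetical in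
  \<open>Y\<close>, and arithmetical comprehension is at hand because (2) applies to every
  set.\<close>

locale rca0_model =
  fixes M :: "'n l2_structure"
  assumes sets_nonempty: "sets_of M \<noteq> {}"
    and rca0: "\<forall>\<phi>\<in>RCA0. M \<Turnstile> \<phi>"
begin

abbreviation z where "z \<equiv> zero_of M"
abbreviation u where "u \<equiv> one_of M"
abbreviation add (infixl "\<oplus>" 65) where "a \<oplus> b \<equiv> add_of M a b"
abbreviation mul (infixl "\<otimes>" 70) where "a \<otimes> b \<equiv> mul_of M a b"
abbreviation lt (infix "\<prec>" 50) where "a \<prec> b \<equiv> less_of M a b"

lemma sigma_induct:
  assumes "bounded_fm \<theta>" and "\<And>x. P x \<longleftrightarrow> (\<exists>y. sat M (case_nat y (case_nat x e)) v \<theta>)"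
    and "\<And>i. v i \<in> sets_of M"
    and "P z" and "\<And>x. P x \<Longrightarrow> P (x \<oplus> u)"
  shows "P x"
proof -
  have "induction_axiom (ExN \<theta>) \<in> RCA0"
    using assms(1) by (auto simp: RCA0_def Sigma01_def)
  then have "sat M e v (induction_axiom (ExN \<theta>))"
    using rca0 assms(3) by (auto simp: models_def)
  then have ax: "sat M e v (subst (case_nat Zero Var) id (ExN \<theta>)) \<and>
      (\<forall>a. sat M (case_nat a e) v (ExN \<theta>) \<longrightarrow>
        sat M (case_nat a e) v (subst (case_nat (Add (Var 0) One) (\<lambda>i. Var (Suc i))) id (ExN \<theta>))) \<longrightarrow>
      (\<forall>a. sat M (case_nat a e) v (ExN \<theta>))"
    by (simp only: induction_axiom_def sat.simps(5,7,8))
  have env: "(\<lambda>i. tm_val M e (case_nat Zero Var i)) = case_nat z e"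
    "(\<lambda>i. tm_val M (case_nat a e) (case_nat (Add (Var 0) One) (\<lambda>i. Var (Suc i)) i)) = case_nat (a \<oplus> u) e" for a
    by (auto simp: fun_eq_iff split: nat.split)
  have P: "sat M (case_nat a e) v (ExN \<theta>) \<longleftrightarrow> P a" for a
    by (simp add: assms(2))
  show ?thesis
    using ax assms(4,5) unfolding sat_subst env id_apply P by blast
qed

text \<open>Number variable 0 is the existential witness, 1 the induction variable, 2 and 3 stand
  for the parameters \<open>a\<close> and \<open>b\<close>. The formulas \<open>\<theta>\<close> in
  the arithmetic below are numbered accordingly.\<close>

lemma induct_open:
  assumes "bounded_fm \<theta>" and "\<And>x. P x \<longleftrightarrow> (\<exists>w. sat M (case_nat w (case_nat x (case_nat a (\<lambda>_. b)))) (\<lambda>_. SOME A. A \<in> sets_of M) \<theta>)"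
    and "P z" and "\<And>x. P x \<Longrightarrow> P (x \<oplus> u)"
  shows "P x"
  using sigma_induct[OF assms(1) assms(2) _ assms(3,4)] sets_nonempty some_in_eq by fastforce

lemma basic:
  shows "x \<oplus> u \<noteq> z" "x \<oplus> u = y \<oplus> u \<longleftrightarrow> x = y" "x \<oplus> z = x" "x \<oplus> (y \<oplus> u) = x \<oplus> y \<oplus> u"
    "x \<otimes> z = z" "x \<otimes> (y \<oplus> u) = x \<otimes> y \<oplus> x" "\<not> x \<prec> z" "x \<prec> y \<oplus> u \<longleftrightarrow> x \<prec> y \<or> x = y"
proof -
  have "\<forall>\<phi>\<in>basic_axioms. sat M (case_nat x (\<lambda>_. y)) (\<lambda>_. SOME A. A \<in> sets_of M) \<phi>"
    using rca0 sets_nonempty by (auto simp: RCA0_def models_def some_in_eq)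
  then show "x \<oplus> u \<noteq> z" "x \<oplus> u = y \<oplus> u \<longleftrightarrow> x = y" "x \<oplus> z = x" "x \<oplus> (y \<oplus> u) = x \<oplus> y \<oplus> u"
    "x \<otimes> z = z" "x \<otimes> (y \<oplus> u) = x \<otimes> y \<oplus> x" "\<not> x \<prec> z" "x \<prec> y \<oplus> u \<longleftrightarrow> x \<prec> y \<or> x = y"
    by (simp_all add: basic_axioms_def) blast+
qed

lemma zero_add: "z \<oplus> x = x"
  by (rule induct_open[where x = x and \<theta> = "Add Zero (Var 1) \<^bold>= Var 1"]) (auto simp: basic intro: bounded_fm.intros)

lemma succ_add: "y \<oplus> u \<oplus> x = y \<oplus> x \<oplus> u"
  by (rule induct_open[where x = x and a = y and \<theta> = "Add (Add (Var 2) One) (Var 1) \<^bold>= Add (Add (Var 2) (Var 1)) One"])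
    (auto simp: basic numeral_2_eq_2 intro: bounded_fm.intros)

lemma add_commute: "x \<oplus> y = y \<oplus> x"
  by (rule induct_open[where x = x and a = y and \<theta> = "Add (Var 1) (Var 2) \<^bold>= Add (Var 2) (Var 1)"])
    (auto simp: basic zero_add succ_add numeral_2_eq_2 intro: bounded_fm.intros)

lemma add_assoc: "a \<oplus> b \<oplus> x = a \<oplus> (b \<oplus> x)"
  by (rule induct_open[where x = x and a = a and b = b and
      \<theta> = "Add (Add (Var 2) (Var 3)) (Var 1) \<^bold>= Add (Var 2) (Add (Var 3) (Var 1))"])
    (auto simp: basic numeral_2_eq_2 numeral_3_eq_3 intro: bounded_fm.intros)

lemma add_left_commute: "a \<oplus> (b \<oplus> c) = b \<oplus> (a \<oplus> c)"
  by (metis add_assoc add_commute)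

lemmas add_ac = add_assoc add_commute add_left_commute

lemma zero_mul: "z \<otimes> x = z"
  by (rule induct_open[where x = x and \<theta> = "Mul Zero (Var 1) \<^bold>= Zero"]) (auto simp: basic intro: bounded_fm.intros)

lemma succ_mul: "(y \<oplus> u) \<otimes> x = y \<otimes> x \<oplus> x"
proof (rule induct_open[where x = x and a = y and \<theta> = "Mul (Add (Var 2) One) (Var 1) \<^bold>= Add (Mul (Var 2) (Var 1)) (Var 1)"])
  show "(y \<oplus> u) \<otimes> x = y \<otimes> x \<oplus> x \<Longrightarrow> (y \<oplus> u) \<otimes> (x \<oplus> u) = y \<otimes> (x \<oplus> u) \<oplus> (x \<oplus> u)" for x
    by (simp add: basic(6)) (metis add_ac)
qed (auto simp: basic numeral_2_eq_2 intro: bounded_fm.intros)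

lemma mul_commute: "x \<otimes> y = y \<otimes> x"
  by (rule induct_open[where x = x and a = y and \<theta> = "Mul (Var 1) (Var 2) \<^bold>= Mul (Var 2) (Var 1)"])
    (auto simp: basic zero_mul succ_mul numeral_2_eq_2 intro: bounded_fm.intros)

lemma distrib: "a \<otimes> (b \<oplus> x) = a \<otimes> b \<oplus> a \<otimes> x"
  by (rule induct_open[where x = x and a = a and b = b and
      \<theta> = "Mul (Var 2) (Add (Var 3) (Var 1)) \<^bold>= Add (Mul (Var 2) (Var 3)) (Mul (Var 2) (Var 1))"])
    (simp_all add: bounded_fm.intros basic(3-6) add_assoc[symmetric] numeral_2_eq_2 numeral_3_eq_3)

lemma mul_one: "x \<otimes> u = x"
  using basic(6)[of x z] by (simp add: basic(3,5) zero_add)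

lemma mul_assoc: "a \<otimes> b \<otimes> x = a \<otimes> (b \<otimes> x)"
  by (rule induct_open[where x = x and a = a and b = b and
      \<theta> = "Mul (Mul (Var 2) (Var 3)) (Var 1) \<^bold>= Mul (Var 2) (Mul (Var 3) (Var 1))"])
    (auto simp: basic distrib mul_one numeral_2_eq_2 numeral_3_eq_3 intro: bounded_fm.intros)

lemma add_cancel: "a \<oplus> x = b \<oplus> x \<longleftrightarrow> a = b"
  by (rule induct_open[where x = x and a = a and b = b and
      \<theta> = "(Add (Var 2) (Var 1) \<^bold>= Add (Var 3) (Var 1)) \<^bold>\<longleftrightarrow> Var 2 \<^bold>= Var 3"])
    (auto simp: basic numeral_2_eq_2 numeral_3_eq_3 intro!: bounded_fm.intros)

lemma cases: "x = z \<or> (\<exists>y. x = y \<oplus> u)"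
  by (rule induct_open[where x = x and \<theta> = "Var 1 \<^bold>= Zero \<^bold>\<or> Var 1 \<^bold>= Add (Var 0) One"])
    (auto simp: basic intro!: bounded_fm.intros)

text \<open>Once \<open>x \<prec> y\<close> means that \<open>y\<close> is \<open>x\<close> plus a
  successor, most order laws reduce to identities for addition.\<close>

lemma less_imp_add: "x \<prec> y \<longrightarrow> (\<exists>w. y = x \<oplus> (w \<oplus> u))"
proof (rule induct_open[where x = y and a = x and \<theta> = "Var 2 \<^bold>< Var 1 \<^bold>\<longrightarrow> Var 1 \<^bold>= Add (Var 2) (Add (Var 0) One)"])
  fix y assume IH: "x \<prec> y \<longrightarrow> (\<exists>w. y = x \<oplus> (w \<oplus> u))"
  show "x \<prec> y \<oplus> u \<longrightarrow> (\<exists>w. y \<oplus> u = x \<oplus> (w \<oplus> u))"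
  proof
    assume "x \<prec> y \<oplus> u"
    then have "x \<prec> y \<or> x = y" by (simp add: basic)
    then show "\<exists>w. y \<oplus> u = x \<oplus> (w \<oplus> u)"
    proof
      assume "x = y"
      then show ?thesis by (intro exI[of _ z]) (simp add: zero_add)
    next
      assume "x \<prec> y"
      then show ?thesis using IH by (metis add_assoc)
    qed
  qed
qed (auto simp: basic numeral_2_eq_2 intro!: bounded_fm.intros)

lemma less_add: "x \<prec> x \<oplus> (w \<oplus> u)"
  by (rule induct_open[where x = w and a = x and \<theta> = "Var 2 \<^bold>< Add (Var 2) (Add (Var 1) One)"])
    (auto simp: basic zero_add add_assoc[symmetric] numeral_2_eq_2 intro!: bounded_fm.intros)

lemma less_iff: "x \<prec> y \<longleftrightarrow> (\<exists>w. y = x \<oplus> (w \<oplus> u))"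
  using less_imp_add less_add by blast

lemma not_less_self: "\<not> x \<prec> x"
  unfolding less_iff by (metis add_cancel add_commute basic(1) zero_add)

lemma less_trans: "x \<prec> y \<Longrightarrow> y \<prec> w \<Longrightarrow> x \<prec> w"
  unfolding less_iff by (metis add_assoc)

lemma less_cases: "x \<prec> y \<or> x = y \<or> y \<prec> x"
proof (rule induct_open[where x = x and a = y and \<theta> = "Var 1 \<^bold>< Var 2 \<^bold>\<or> Var 1 \<^bold>= Var 2 \<^bold>\<or> Var 2 \<^bold>< Var 1"])
  show "z \<prec> y \<or> z = y \<or> y \<prec> z"
    using cases[of y] by (metis less_add zero_add)
  fix x assume "x \<prec> y \<or> x = y \<or> y \<prec> x"
  then show "x \<oplus> u \<prec> y \<or> x \<oplus> u = y \<or> y \<prec> x \<oplus> u"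
  proof (elim disjE)
    assume "x \<prec> y"
    then obtain w where w: "y = x \<oplus> (w \<oplus> u)" using less_iff by blast
    then show ?thesis using cases[of w]
      by (metis zero_add less_iff add_assoc add_commute)
  qed (auto simp: basic)
qed (auto simp: numeral_2_eq_2 intro!: bounded_fm.intros)

lemma add_less_mono: "a \<prec> b \<Longrightarrow> c \<oplus> a \<prec> c \<oplus> b"
  unfolding less_iff by (elim exE) (simp add: add_assoc, blast)

lemma mul_less_mono: "a \<prec> b \<Longrightarrow> z \<prec> c \<Longrightarrow> c \<otimes> a \<prec> c \<otimes> b"
proof -
  assume "a \<prec> b" "z \<prec> c"
  then obtain d k where "b = a \<oplus> (d \<oplus> u)" "c = k \<oplus> u"
    by (metis less_iff cases not_less_self)
  then have "c \<otimes> b = c \<otimes> a \<oplus> (c \<otimes> d \<oplus> k \<oplus> u)"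
    by (simp add: distrib mul_one add_assoc)
  then show ?thesis using less_add by metis
qed

definition le where "le a b \<longleftrightarrow> a \<prec> b \<or> a = b"

text \<open>The language has no subtraction. Truncated subtraction is added because the ordered
  semiring classes, which bring in the simplifier, ask for such an operation.\<close>

definition sub where "sub a b = (if \<exists>c. a = b \<oplus> c then THE c. a = b \<oplus> c else z)"

lemma le_iff: "le a b \<longleftrightarrow> (\<exists>c. b = a \<oplus> c)"
  unfolding le_def less_iff by (metis basic(3) cases)

lemma sub_add: "sub (b \<oplus> c) b = c"
  unfolding sub_def by (auto intro!: the_equality) (metis add_cancel add_commute)

lemma sub_zero: "a \<prec> b \<Longrightarrow> sub a b = z"
  unfolding sub_def using less_trans not_less_self le_def le_iff by (metis (no_types))

lemma zero_sub: "sub z c = z"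
  using less_cases[of z c] basic(7)[of c] sub_zero[of z c] sub_add[of z z] by (auto simp: basic)

lemma sub_sub: "sub (sub a b) c = sub a (b \<oplus> c)"
proof (cases "\<exists>d. a = b \<oplus> d")
  case True
  then obtain d where d: "a = b \<oplus> d" by blast
  show ?thesis
  proof (cases "\<exists>k. d = c \<oplus> k")
    case True
    then obtain k where "d = c \<oplus> k" by blast
    then have "a = b \<oplus> c \<oplus> k" "a = b \<oplus> (c \<oplus> k)" "d = c \<oplus> k" by (simp_all add: d add_assoc)
    then show ?thesis by (metis sub_add)
  next
    case False
    then have "d \<prec> c" by (metis less_cases less_iff basic(3))
    then show ?thesis unfolding d sub_add by (simp add: sub_zero add_less_mono)
  qed
next
  case False
  then have "a \<prec> b" by (metis less_cases less_iff basic(3))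
  moreover have "a \<prec> b \<oplus> c"
    using \<open>a \<prec> b\<close> le_iff[of b "b \<oplus> c"] less_trans[of a b "b \<oplus> c"] by (auto simp: le_def)
  ultimately show ?thesis by (simp add: sub_zero zero_sub)
qed

lemma mul_sub: "a \<otimes> sub b c = sub (a \<otimes> b) (a \<otimes> c)"
proof (cases "\<exists>d. b = c \<oplus> d")
  case True
  then show ?thesis by (auto simp: distrib sub_add)
next
  case False
  then have "b \<prec> c" by (metis less_cases less_iff basic(3))
  moreover have "sub z z = z" by (metis basic(3) sub_add)
  ultimately show ?thesis
    using less_cases[of z a] mul_less_mono[of b c a] by (auto simp: sub_zero basic zero_mul)
qed

lemma mul_eq_zero: "a \<noteq> z \<Longrightarrow> b \<noteq> z \<Longrightarrow> a \<otimes> b \<noteq> z"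
  by (metis basic(5,7) less_cases mul_less_mono not_less_self)

lemma u_neq_z: "u \<noteq> z"
  by (metis basic(1) zero_add)

lemma zero_less_u: "z \<prec> u"
  by (metis basic(7) less_cases u_neq_z)


end

section \<open>Models as a type class, and the passage to an arbitrary model\<close>

class rca0 = linordered_semidom + canonically_ordered_monoid_add +
  fixes fam :: "'a set set"
  assumes rca0_model: "rca0_model \<lparr>zero_of = 0, one_of = 1, add_of = (+), mul_of = (*), less_of = (<), sets_of = fam\<rparr>"

definition std :: "'a::rca0 l2_structure" where
  "std = \<lparr>zero_of = 0, one_of = 1, add_of = (+), mul_of = (*), less_of = (<), sets_of = fam\<rparr>"

text \<open>
  The class \<open>rca0\<close> makes the arithmetic of a model available to the simplifier. To reach an arbitrary
  model on \<open>'n\<close>, a counterexample to a given sentence is put on the type \<open>'n num\<close> below; if there is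
  none, \<open>'n num\<close> carries the standard model instead.
\<close>

definition transport :: "('n \<Rightarrow> 'm) \<Rightarrow> 'n l2_structure \<Rightarrow> 'm l2_structure" where
  "transport f M =
    \<lparr>zero_of = f (zero_of M), one_of = f (one_of M),
     add_of = (\<lambda>x y. f (add_of M (inv f x) (inv f y))), mul_of = (\<lambda>x y. f (mul_of M (inv f x) (inv f y))),
     less_of = (\<lambda>x y. less_of M (inv f x) (inv f y)), sets_of = (`) f ` sets_of M\<rparr>"

lemma transport_simps [simp]:
  "zero_of (transport f M) = f (zero_of M)" "one_of (transport f M) = f (one_of M)"
  "sets_of (transport f M) = (`) f ` sets_of M"
  by (simp_all add: transport_def)

lemma transport_ops [simp]:
  assumes "bij f"
  shows "add_of (transport f M) (f x) (f y) = f (add_of M x y)"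
    "mul_of (transport f M) (f x) (f y) = f (mul_of M x y)"
    "less_of (transport f M) (f x) (f y) = less_of M x y"
  using assms by (simp_all add: transport_def inv_f_f bij_is_inj)

lemma tm_val_transport:
  assumes "bij f"
  shows "tm_val (transport f M) (\<lambda>i::nat. f (e i)) t = f (tm_val M e t)"
  by (induction t) (auto simp: assms)

lemma sat_transport:
  assumes "bij f"
  shows "sat (transport f M) (\<lambda>i::nat. f (e i)) (\<lambda>i::nat. f ` v i) \<phi> \<longleftrightarrow> sat M e v \<phi>"
proof (induction \<phi> arbitrary: e v)
  case (AllN \<phi> e v)
  have "(\<forall>a. sat (transport f M) (case_nat a (\<lambda>i::nat. f (e i))) (\<lambda>i::nat. f ` v i) \<phi>) \<longleftrightarrow>
      (\<forall>a. sat (transport f M) (case_nat (f a) (\<lambda>i::nat. f (e i))) (\<lambda>i::nat. f ` v i) \<phi>)"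
    using assms by (metis bij_pointE)
  moreover have "case_nat (f a) (\<lambda>i::nat. f (e i)) = (\<lambda>i. f (case_nat a e i))" for a
    by (auto simp: fun_eq_iff split: nat.split)
  ultimately show ?case by (simp add: AllN)
next
  case (ExN \<phi> e v)
  have "(\<exists>a. sat (transport f M) (case_nat a (\<lambda>i::nat. f (e i))) (\<lambda>i::nat. f ` v i) \<phi>) \<longleftrightarrow>
      (\<exists>a. sat (transport f M) (case_nat (f a) (\<lambda>i::nat. f (e i))) (\<lambda>i::nat. f ` v i) \<phi>)"
    using assms by (metis bij_pointE)
  moreover have "case_nat (f a) (\<lambda>i::nat. f (e i)) = (\<lambda>i. f (case_nat a e i))" for a
    by (auto simp: fun_eq_iff split: nat.split)
  ultimately show ?case by (simp add: ExN)
next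
  case (AllS \<phi> e v)
  have "case_nat (f ` A) (\<lambda>i::nat. f ` v i) = (\<lambda>i. f ` case_nat A v i)" for A
    by (auto simp: fun_eq_iff split: nat.split)
  then show ?case by (simp add: AllS)
next
  case (ExS \<phi> e v)
  have "case_nat (f ` A) (\<lambda>i::nat. f ` v i) = (\<lambda>i. f ` case_nat A v i)" for A
    by (auto simp: fun_eq_iff split: nat.split)
  then show ?case by (simp add: ExS)
qed (auto simp: tm_val_transport assms inj_image_mem_iff bij_is_inj inj_eq)

lemma models_transport:
  assumes "bij f"
  shows "transport f M \<Turnstile> \<phi> \<longleftrightarrow> M \<Turnstile> \<phi>"
proof
  assume *: "transport f M \<Turnstile> \<phi>"
  show "M \<Turnstile> \<phi>"
    unfolding models_def
  proof (intro allI impI)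
    fix e :: "nat \<Rightarrow> _" and v :: "nat \<Rightarrow> _" assume "\<forall>i. v i \<in> sets_of M"
    then have "sat (transport f M) (\<lambda>i::nat. f (e i)) (\<lambda>i::nat. f ` v i) \<phi>"
      using * by (simp add: models_def)
    then show "sat M e v \<phi>" by (simp add: sat_transport assms)
  qed
next
  assume *: "M \<Turnstile> \<phi>"
  show "transport f M \<Turnstile> \<phi>"
    unfolding models_def
  proof (intro allI impI)
    fix e :: "nat \<Rightarrow> _" and v :: "nat \<Rightarrow> _" assume v: "\<forall>i. v i \<in> sets_of (transport f M)"
    have "inv f ` v i \<in> sets_of M" for i
    proof -
      have "v i \<in> (`) f ` sets_of M" using v by simp
      then obtain A where "A \<in> sets_of M" "v i = f ` A" by blast
      then show ?thesis using assms by (simp add: image_image inv_f_f bij_is_inj)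
    qed
    then have "sat M (\<lambda>i. inv f (e i)) (\<lambda>i. inv f ` v i) \<phi>"
      using * by (simp add: models_def)
    then show "sat (transport f M) e v \<phi>"
      using sat_transport[OF assms, of M "\<lambda>i. inv f (e i)" "\<lambda>i. inv f ` v i" \<phi>]
      by (simp add: image_image surj_f_inv_f bij_is_surj assms)
  qed
qed

lemma rca0_model_transport:
  assumes "bij f"
  shows "rca0_model (transport f M) \<longleftrightarrow> rca0_model M"
  by (simp add: rca0_model_def models_transport assms)

text \<open>The fallback for a type without counterexample. Every subset of the natural numbers is
  present, so the two schemes follow from ordinary induction and set formation.\<close>

lemma rca0_model_nat:
  "rca0_model \<lparr>zero_of = 0, one_of = 1, add_of = (+), mul_of = (*), less_of = (<), sets_of = UNIV :: nat set set\<rparr>"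
  (is "rca0_model ?N")
proof
  show "\<forall>\<phi>\<in>RCA0. ?N \<Turnstile> \<phi>"
  proof
    fix \<phi> assume "\<phi> \<in> RCA0"
    then consider "\<phi> \<in> basic_axioms" | \<theta> where "\<phi> = induction_axiom \<theta>" | \<theta> \<psi> where "\<phi> = comprehension_axiom \<theta> \<psi>"
      by (auto simp: RCA0_def)
    then show "?N \<Turnstile> \<phi>"
    proof cases
      case 1
      then show ?thesis by (auto simp: basic_axioms_def models_def)
    next
      case 2
      have env: "(\<lambda>i. tm_val ?N e (case_nat Zero Var i)) = case_nat 0 e"
        "(\<lambda>i. tm_val ?N (case_nat a e) (case_nat (Add (Var 0) One) (\<lambda>i. Var (Suc i)) i)) = case_nat (Suc a) e" for a e
        by (auto simp: fun_eq_iff split: nat.split)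
      show ?thesis
        unfolding 2 models_def induction_axiom_def sat.simps sat_subst env id_apply
        by (auto intro: nat_induct)
    next
      case 3
      show ?thesis
        unfolding 3 models_def comprehension_axiom_def sat.simps sat_subst tm_val.simps nat.case
        by (auto intro!: exI[of _ "{a. _ a}"])
    qed
  qed
qed simp

definition counter_model :: "'n l2_structure \<Rightarrow> bool" where
  "counter_model M \<longleftrightarrow> rca0_model M \<and> \<not> M \<Turnstile> (RT_exactly_large \<^bold>\<longleftrightarrow> Omega_jumps_exist)"

text \<open>A class instance has to be unconditional, whereas \<open>'n\<close> itself may carry no
  model at all, for instance if it is finite. The choice is therefore built into the type: copies of
  \<open>'n\<close> if a counterexample lives there, copies of \<open>nat\<close> otherwise.\<close>

typedef 'n num = "{x :: 'n + nat. isl x \<longleftrightarrow> (\<exists>M :: 'n l2_structure. counter_model M)}"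
  by (cases "\<exists>M :: 'n l2_structure. counter_model M") (auto intro: exI[of _ "Inl undefined"] exI[of _ "Inr 0"])

lemma ex_num_model:
  "\<exists>N :: 'n num l2_structure. rca0_model N \<and> ((\<exists>M :: 'n l2_structure. counter_model M) \<longrightarrow> counter_model N)"
proof (cases "\<exists>M :: 'n l2_structure. counter_model M")
  case True
  then obtain M :: "'n l2_structure" where M: "counter_model M" by blast
  have "bij (\<lambda>x. Abs_num (Inl x) :: 'n num)"
  proof (rule bijI)
    show "inj (\<lambda>x. Abs_num (Inl x) :: 'n num)" using True by (auto simp: inj_def Abs_num_inject)
    show "surj (\<lambda>x. Abs_num (Inl x) :: 'n num)"
      unfolding surj_def
    proof
      fix y :: "'n num"
      show "\<exists>x. y = Abs_num (Inl x)"
        using True by (cases y) (auto simp: isl_def)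
    qed
  qed
  then show ?thesis
    using M by (metis counter_model_def models_transport rca0_model_transport)
next
  case False
  have "bij (\<lambda>x. Abs_num (Inr x) :: 'n num)"
  proof (rule bijI)
    show "inj (\<lambda>x. Abs_num (Inr x) :: 'n num)" using False by (auto simp: inj_def Abs_num_inject)
    show "surj (\<lambda>x. Abs_num (Inr x) :: 'n num)"
      unfolding surj_def
    proof
      fix y :: "'n num"
      show "\<exists>x. y = Abs_num (Inr x)"
      proof (cases y)
        case (Abs_num r)
        then show ?thesis using False by (cases r) auto
      qed
    qed
  qed
  then show ?thesis
    using False rca0_model_transport rca0_model_nat by blast
qed

definition num_model :: "'n num l2_structure" where
  "num_model = (SOME N. rca0_model N \<and> ((\<exists>M :: 'n l2_structure. counter_model M) \<longrightarrow> counter_model N))"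

lemma num_model:
  shows "rca0_model (num_model :: 'n num l2_structure)"
    and "\<exists>M :: 'n l2_structure. counter_model M \<Longrightarrow> counter_model (num_model :: 'n num l2_structure)"
  using someI_ex[OF ex_num_model[where 'n = 'n]] unfolding num_model_def by blast+

interpretation num: rca0_model num_model
  by (rule num_model)

instantiation num :: (type) rca0
begin

definition "0 = zero_of num_model"
definition "1 = one_of num_model"
definition "x + y = add_of num_model x y"
definition "x * y = mul_of num_model x y"
definition "x < y \<longleftrightarrow> less_of num_model x y"
definition "x \<le> y \<longleftrightarrow> num.le x y"
definition "x - y = num.sub x y"
definition "fam = sets_of num_model"

lemmas num_ops = zero_num_def one_num_def plus_num_def times_num_def less_num_def less_eq_num_def minus_num_def

instance
proof
  fix a b c :: "'a num"
  show "a + b + c = a + (b + c)" unfolding num_ops by (rule num.add_assoc)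
  show "a + b = b + a" unfolding num_ops by (rule num.add_commute)
  show "0 + a = a" unfolding num_ops by (rule num.zero_add)
  show "a * b * c = a * (b * c)" unfolding num_ops by (rule num.mul_assoc)
  show "a * b = b * a" unfolding num_ops by (rule num.mul_commute)
  show "1 * a = a" unfolding num_ops using num.mul_one num.mul_commute by metis
  show "(a + b) * c = a * c + b * c" unfolding num_ops using num.distrib num.mul_commute by metis
  show "a * (b + c) = a * b + a * c" unfolding num_ops by (rule num.distrib)
  show "0 * a = 0" unfolding num_ops by (rule num.zero_mul)
  show "a * 0 = 0" unfolding num_ops by (rule num.basic)
  show "(0::'a num) \<noteq> 1" unfolding num_ops by (metis num.u_neq_z)
  show "a + b - a = b" unfolding num_ops by (rule num.sub_add)
  show "a - b - c = a - (b + c)" unfolding num_ops by (rule num.sub_sub)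
  show "a * (b - c) = a * b - a * c" unfolding num_ops by (rule num.mul_sub)
  show "a \<noteq> 0 \<Longrightarrow> b \<noteq> 0 \<Longrightarrow> a * b \<noteq> 0" unfolding num_ops by (rule num.mul_eq_zero)
  show "(a < b) = (a \<le> b \<and> \<not> b \<le> a)"
    unfolding num_ops num.le_def by (metis num.less_trans num.not_less_self)
  show "a \<le> a" unfolding num_ops num.le_def by blast
  show "a \<le> b \<Longrightarrow> b \<le> c \<Longrightarrow> a \<le> c" unfolding num_ops num.le_def by (metis num.less_trans)
  show "a \<le> b \<Longrightarrow> b \<le> a \<Longrightarrow> a = b" unfolding num_ops num.le_def by (metis num.less_trans num.not_less_self)
  show "a \<le> b \<or> b \<le> a" unfolding num_ops num.le_def by (metis num.less_cases)
  show "a \<le> b \<Longrightarrow> c + a \<le> c + b" unfolding num_ops num.le_def by (metis num.add_less_mono)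
  show "a < b \<Longrightarrow> 0 < c \<Longrightarrow> c * a < c * b" unfolding num_ops by (rule num.mul_less_mono)
  show "a \<le> b \<longleftrightarrow> (\<exists>c. b = a + c)" unfolding num_ops by (rule num.le_iff)
  show "(0::'a num) < 1" unfolding num_ops by (rule num.zero_less_u)
  show "b \<le> a \<Longrightarrow> a - b + b = a"
    unfolding num_ops num.le_iff by (metis num.sub_add num.add_commute)
  have "\<lparr>zero_of = 0, one_of = 1, add_of = (+), mul_of = (*), less_of = (<), sets_of = fam\<rparr>
      = (num_model :: 'a num l2_structure)"
    by (rule l2_structure.equality) (simp_all add: num_ops fam_num_def fun_eq_iff)
  then show "rca0_model \<lparr>zero_of = 0, one_of = 1, add_of = (+), mul_of = (*), less_of = (<), sets_of = fam :: 'a num set set\<rparr>"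
    using num_model(1) by simp
qed

end

lemma std_num: "std = num_model"
  by (rule l2_structure.equality) (simp_all add: std_def num_ops fam_num_def fun_eq_iff)

lemma std_simps [simp]:
  "zero_of std = 0" "one_of std = 1" "add_of std = (+)" "mul_of std = (*)" "less_of std = (<)" "sets_of std = fam"
  by (simp_all add: std_def)

interpretation std: rca0_model "std :: 'a::rca0 l2_structure"
  using rca0_model by (simp add: std_def)

lemma less_add_one_iff [simp]: "(x::'a::rca0) < y + 1 \<longleftrightarrow> x \<le> y"
  using std.basic(8)[of x y] by auto

lemma add_one_le_iff [simp]: "(x::'a::rca0) + 1 \<le> y \<longleftrightarrow> x < y"
  using less_add_one_iff[of y x] by (metis not_le)

lemma less_one_iff [simp]: "(x::'a::rca0) < 1 \<longleftrightarrow> x = 0"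
  using less_add_one_iff[of x 0] by simp

subsection \<open>Definable relations\<close>

text \<open>
  A relation between numbers is represented as a predicate on assignments \<open>nat \<Rightarrow> 'a\<close>, of which it
  uses finitely many values. \<open>\<A>\<close> is the family of sets that may occur as parameters; number
  parameters are always allowed.
\<close>

inductive TM :: "((nat \<Rightarrow> 'a::rca0) \<Rightarrow> 'a) \<Rightarrow> bool" where
  TM_var: "TM (\<lambda>e. e i)"
| TM_const: "TM (\<lambda>e. c)"
| TM_add: "TM s \<Longrightarrow> TM t \<Longrightarrow> TM (\<lambda>e. s e + t e)"
| TM_mul: "TM s \<Longrightarrow> TM t \<Longrightarrow> TM (\<lambda>e. s e * t e)"

inductive D0 :: "'a::rca0 set set \<Rightarrow> ((nat \<Rightarrow> 'a) \<Rightarrow> bool) \<Rightarrow> bool" for \<A> where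
  D0_eq: "TM s \<Longrightarrow> TM t \<Longrightarrow> D0 \<A> (\<lambda>e. s e = t e)"
| D0_less: "TM s \<Longrightarrow> TM t \<Longrightarrow> D0 \<A> (\<lambda>e. s e < t e)"
| D0_mem: "A \<in> \<A> \<Longrightarrow> A \<in> fam \<Longrightarrow> TM t \<Longrightarrow> D0 \<A> (\<lambda>e. t e \<in> A)"
| D0_not: "D0 \<A> P \<Longrightarrow> D0 \<A> (\<lambda>e. \<not> P e)"
| D0_conj: "D0 \<A> P \<Longrightarrow> D0 \<A> Q \<Longrightarrow> D0 \<A> (\<lambda>e. P e \<and> Q e)"
| D0_ex_raw: "D0 \<A> P \<Longrightarrow> TM t \<Longrightarrow> D0 \<A> (\<lambda>e. \<exists>x<t e. P (case_nat x e))"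

lemma TM_subst: "TM t \<Longrightarrow> (\<And>i. TM (s i)) \<Longrightarrow> TM (\<lambda>e. t (\<lambda>i. s i e))"
  by (induction rule: TM.induct) (auto intro: TM.intros)

lemma TM_shift: "TM t \<Longrightarrow> TM (\<lambda>e. t (\<lambda>i. e (Suc i)))"
  by (rule TM_subst[where s = "\<lambda>i e. e (Suc i)"]) (auto intro: TM_var)

lemma TM_case_nat: "TM t \<Longrightarrow> (\<And>i. TM (s i)) \<Longrightarrow> TM (case_nat t s i)"
  by (cases i) auto

lemma D0_subst: "D0 \<A> P \<Longrightarrow> (\<And>i. TM (s i)) \<Longrightarrow> D0 \<A> (\<lambda>e. P (\<lambda>i. s i e))"
proof (induction arbitrary: s rule: D0.induct)
  case (D0_ex_raw P t)
  let ?s = "case_nat (\<lambda>e. e 0) (\<lambda>i e. s i (\<lambda>i. e (Suc i)))"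
  have "D0 \<A> (\<lambda>e. P (\<lambda>i. ?s i e))"
    by (intro D0_ex_raw.IH TM_case_nat TM_var TM_shift D0_ex_raw.prems)
  moreover have "TM (\<lambda>e. t (\<lambda>i. s i e))"
    by (intro TM_subst[of t s] D0_ex_raw)
  ultimately have "D0 \<A> (\<lambda>e. \<exists>x<t (\<lambda>i. s i e). P (\<lambda>i. ?s i (case_nat x e)))"
    by (rule D0.D0_ex_raw)
  moreover have "(\<lambda>i. ?s i (case_nat x e)) = case_nat x (\<lambda>i. s i e)" for x e
    by (auto simp: fun_eq_iff split: nat.split)
  ultimately show ?case by simp
next
  case (D0_eq u w)
  show ?case by (intro D0.D0_eq TM_subst[of u s] TM_subst[of w s] D0_eq)
next
  case (D0_less u w)
  show ?case by (intro D0.D0_less TM_subst[of u s] TM_subst[of w s] D0_less)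
next
  case (D0_mem A t)
  show ?case by (intro D0.D0_mem TM_subst[of t s] D0_mem)
qed (intro D0.D0_not D0.D0_conj; simp)+

lemma D0_shift: "D0 \<A> P \<Longrightarrow> D0 \<A> (\<lambda>e. P (\<lambda>i. e (Suc i)))"
  by (rule D0_subst[where s = "\<lambda>i e. e (Suc i)"]) (auto intro: TM_var)

text \<open>The format of all later quantifier rules: \<open>P\<close> takes the outer assignment
  and the bound value separately, and definability is stated with the bound value at position 0 and
  the outer assignment shifted by one. Higher-order unification then lets \<open>intro\<close> walk
  through a relation.\<close>

lemma D0_ex: "D0 \<A> (\<lambda>e. P (\<lambda>i. e (Suc i)) (e 0)) \<Longrightarrow> TM t \<Longrightarrow> D0 \<A> (\<lambda>e. \<exists>x<t e. P e x)"
  using D0_ex_raw[of \<A> "\<lambda>e. P (\<lambda>i. e (Suc i)) (e 0)" t] by simp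

lemma D0_disj:
  assumes "D0 \<A> P" "D0 \<A> Q"
  shows "D0 \<A> (\<lambda>e. P e \<or> Q e)"
proof -
  have "D0 \<A> (\<lambda>e. \<not> (\<not> P e \<and> \<not> Q e))" by (intro D0_not D0_conj assms)
  then show ?thesis by simp
qed

lemma D0_imp:
  assumes "D0 \<A> P" "D0 \<A> Q"
  shows "D0 \<A> (\<lambda>e. P e \<longrightarrow> Q e)"
  unfolding imp_conv_disj by (intro D0_not D0_disj assms)

lemma D0_iff:
  assumes "D0 \<A> P" "D0 \<A> Q"
  shows "D0 \<A> (\<lambda>e. P e \<longleftrightarrow> Q e)"
  unfolding iff_conv_conj_imp by (intro D0_conj D0_imp assms)

lemma D0_all:
  assumes "D0 \<A> (\<lambda>e. P (\<lambda>i. e (Suc i)) (e 0))" "TM t"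
  shows "D0 \<A> (\<lambda>e. \<forall>x<t e. P e x)"
proof -
  have "D0 \<A> (\<lambda>e. \<not> (\<exists>x<t e. \<not> P e x))" by (intro D0_not D0_ex assms)
  then show ?thesis by simp
qed

lemma D0_le: "TM s \<Longrightarrow> TM t \<Longrightarrow> D0 \<A> (\<lambda>e. s e \<le> t e)"
  unfolding not_less[symmetric] by (intro D0_not D0_less)

lemma D0_bool: "D0 \<A> (\<lambda>e. c)"
proof -
  have "D0 \<A> (\<lambda>e. (0::'a) = (if c then 0 else 1))" by (intro D0_eq TM_const)
  then show ?thesis by (cases c) simp_all
qed

lemmas D0_intros = D0_eq D0_less D0_mem D0_not D0_conj D0_disj D0_imp D0_iff D0_ex D0_all D0_le D0_bool
  TM_var TM_const TM_add TM_mul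

section \<open>From semantic relations back to formulas\<close>

definition mix :: "nat \<Rightarrow> (nat \<Rightarrow> 'a) \<Rightarrow> (nat \<Rightarrow> 'a) \<Rightarrow> nat \<Rightarrow> 'a" where
  "mix k e p i = (if i < k then e i else p (i - k))"

lemma mix_case_nat: "mix (Suc k) (case_nat x e) p = case_nat x (mix k e p)"
  by (auto simp: mix_def fun_eq_iff split: nat.split)

text \<open>Elements of a model have no names in the language. Number parameters are therefore kept
  as the values \<open>p\<close> of the variables from \<open>k\<close> on.\<close>

definition represents :: "nat \<Rightarrow> (nat \<Rightarrow> 'a) \<Rightarrow> (nat \<Rightarrow> 'a set) \<Rightarrow> fm \<Rightarrow> ((nat \<Rightarrow> 'a::rca0) \<Rightarrow> bool) \<Rightarrow> bool" where
  "represents k p v \<phi> P \<longleftrightarrow> bounded_fm \<phi> \<and> (\<forall>e. P e \<longleftrightarrow> sat std (mix k e p) v \<phi>)"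

definition represents_tm :: "nat \<Rightarrow> (nat \<Rightarrow> 'a) \<Rightarrow> tm \<Rightarrow> ((nat \<Rightarrow> 'a::rca0) \<Rightarrow> 'a) \<Rightarrow> bool" where
  "represents_tm k p t f \<longleftrightarrow> (\<forall>e. f e = tm_val std (mix k e p) t)"

text \<open>Two formulas to be combined need a common list of parameters: one list goes to the even
  positions, the other to the odd ones, and the variables are renamed to match.\<close>

definition interleave :: "(nat \<Rightarrow> 'b) \<Rightarrow> (nat \<Rightarrow> 'b) \<Rightarrow> nat \<Rightarrow> 'b" where
  "interleave f g i = (if even i then f (i div 2) else g (i div 2))"

lemma interleave_simps [simp]:
  "interleave f g (2 * i) = f i" "interleave f g (Suc (2 * i)) = g i"
  by (auto simp: interleave_def)

lemma subst_tm_shift: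
  "subst_tm (case_nat (Var 0) (\<lambda>i. shift 1 (\<sigma> i))) (shift 1 t) = shift 1 (subst_tm \<sigma> t)"
  by (induction t) auto

lemma bounded_fm_subst: "bounded_fm \<phi> \<Longrightarrow> bounded_fm (subst \<sigma> \<rho> \<phi>)"
  by (induction arbitrary: \<sigma> rule: bounded_fm.induct)
    (auto simp: subst_tm_shift[simplified] intro: bounded_fm.intros[simplified])

lemma represents_tm_raise:
  assumes "represents_tm k p t f" "k \<le> l"
  shows "\<exists>t'. represents_tm l (interleave p q) t' f" "\<exists>t'. represents_tm l (interleave q p) t' f"
proof -
  have *: "(\<lambda>i. tm_val std (mix l e (interleave p q)) (Var (if i < k then i else l + 2 * (i - k)))) = mix k e p"
    "(\<lambda>i. tm_val std (mix l e (interleave q p)) (Var (if i < k then i else l + Suc (2 * (i - k))))) = mix k e p"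
    for e using assms(2) by (auto simp: mix_def fun_eq_iff)
  have "represents_tm l (interleave p q) (subst_tm (\<lambda>i. Var (if i < k then i else l + 2 * (i - k))) t) f"
    using assms(1) by (simp only: represents_tm_def tm_val_subst *) simp
  moreover have "represents_tm l (interleave q p) (subst_tm (\<lambda>i. Var (if i < k then i else l + Suc (2 * (i - k)))) t) f"
    using assms(1) by (simp only: represents_tm_def tm_val_subst *) simp
  ultimately show "\<exists>t'. represents_tm l (interleave p q) t' f" "\<exists>t'. represents_tm l (interleave q p) t' f"
    by blast+
qed

lemma represents_raise:
  assumes "represents k p v \<phi> P" "k \<le> l"
  shows "\<exists>\<phi>'. represents l (interleave p q) (interleave v w) \<phi>' P"
    "\<exists>\<phi>'. represents l (interleave q p) (interleave w v) \<phi>' P"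
proof -
  have *: "(\<lambda>i. tm_val std (mix l e (interleave p q)) (Var (if i < k then i else l + 2 * (i - k)))) = mix k e p"
    "(\<lambda>i. tm_val std (mix l e (interleave q p)) (Var (if i < k then i else l + Suc (2 * (i - k))))) = mix k e p"
    "(\<lambda>i. interleave v w (2 * i)) = v" "(\<lambda>i. interleave w v (Suc (2 * i))) = v"
    for e using assms(2) by (auto simp: mix_def fun_eq_iff)
  have "represents l (interleave p q) (interleave v w)
      (subst (\<lambda>i. Var (if i < k then i else l + 2 * (i - k))) (\<lambda>i. 2 * i) \<phi>) P"
    using assms(1) by (simp only: represents_def bounded_fm_subst sat_subst *) simp
  moreover have "represents l (interleave q p) (interleave w v)
      (subst (\<lambda>i. Var (if i < k then i else l + Suc (2 * (i - k)))) (\<lambda>i. Suc (2 * i)) \<phi>) P"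
    using assms(1) by (simp only: represents_def bounded_fm_subst sat_subst *) simp
  ultimately show "\<exists>\<phi>'. represents l (interleave p q) (interleave v w) \<phi>' P"
    "\<exists>\<phi>'. represents l (interleave q p) (interleave w v) \<phi>' P" by blast+
qed

lemma represents_tm_pair:
  assumes "represents_tm k p s f" "represents_tm l q t g"
  shows "\<exists>m r s' t'. represents_tm m r s' f \<and> represents_tm m r t' g"
  using represents_tm_raise(1)[OF assms(1) max.cobounded1[of k l], of q]
    represents_tm_raise(2)[OF assms(2) max.cobounded2[of l k], of p] by blast

lemma TM_represents: "TM f \<Longrightarrow> \<exists>k p t. represents_tm k p t f"
proof (induction rule: TM.induct)
  case (TM_var i)
  have "represents_tm (Suc i) p (Var i) (\<lambda>e. e i)" for p by (simp add: represents_tm_def mix_def)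
  then show ?case by blast
next
  case (TM_const c)
  have "represents_tm 0 (\<lambda>_. c) (Var 0) (\<lambda>e. c)" by (simp add: represents_tm_def mix_def)
  then show ?case by blast
next
  case (TM_add s t)
  then obtain k p s' l q t' where "represents_tm k p s' s" "represents_tm l q t' t" by blast
  from represents_tm_pair[OF this] obtain m r s' t' where "represents_tm m r s' s" "represents_tm m r t' t"
    by blast
  then have "represents_tm m r (Add s' t') (\<lambda>e. s e + t e)" by (simp add: represents_tm_def)
  then show ?case by blast
next
  case (TM_mul s t)
  then obtain k p s' l q t' where "represents_tm k p s' s" "represents_tm l q t' t" by blast
  from represents_tm_pair[OF this] obtain m r s' t' where "represents_tm m r s' s" "represents_tm m r t' t"
    by blast
  then have "represents_tm m r (Mul s' t') (\<lambda>e. s e * t e)" by (simp add: represents_tm_def)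
  then show ?case by blast
qed

text \<open>\<open>Suc (Suc n)\<close> keeps the two front variables free of parameters: they become
  the witness and the variable of induction or comprehension.\<close>

lemma represents_pair:
  assumes "represents k p v \<phi> P" "represents l q w \<psi> Q" "\<And>i. v i \<in> A" "\<And>i. w i \<in> A"
  shows "\<exists>n r x \<phi>' \<psi>'. represents (Suc (Suc n)) r x \<phi>' P \<and> represents (Suc (Suc n)) r x \<psi>' Q \<and> (\<forall>i. x i \<in> A)"
proof -
  have "\<forall>i. interleave v w i \<in> A" using assms(3,4) by (simp add: interleave_def)
  moreover have "k \<le> Suc (Suc (max k l))" "l \<le> Suc (Suc (max k l))" by linarith+
  ultimately show ?thesis
    using represents_raise(1)[OF assms(1), of _ q w] represents_raise(2)[OF assms(2), of _ p v] by blast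
qed

lemma D0_represents: "D0 \<A> P \<Longrightarrow> \<exists>k p v \<phi>. represents k p v \<phi> P \<and> (\<forall>i. v i \<in> fam)"
proof (induction rule: D0.induct)
  case (D0_eq s t)
  from TM_represents[OF D0_eq(1)] TM_represents[OF D0_eq(2)]
  obtain k p s' l q t' where "represents_tm k p s' s" "represents_tm l q t' t" by blast
  from represents_tm_pair[OF this] obtain m r s' t' where "represents_tm m r s' s" "represents_tm m r t' t"
    by blast
  then have "represents m r v (s' \<^bold>= t') (\<lambda>e. s e = t e)" for v
    by (simp add: represents_def represents_tm_def bounded_fm.intros)
  then show ?case using std.sets_nonempty by (intro exI[of _ m] exI[of _ r] exI[of _ "\<lambda>_. SOME A. A \<in> fam"]) (auto simp: some_in_eq)
next
  case (D0_less s t)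
  from TM_represents[OF D0_less(1)] TM_represents[OF D0_less(2)]
  obtain k p s' l q t' where "represents_tm k p s' s" "represents_tm l q t' t" by blast
  from represents_tm_pair[OF this] obtain m r s' t' where "represents_tm m r s' s" "represents_tm m r t' t"
    by blast
  then have "represents m r v (s' \<^bold>< t') (\<lambda>e. s e < t e)" for v
    by (simp add: represents_def represents_tm_def bounded_fm.intros)
  then show ?case using std.sets_nonempty by (intro exI[of _ m] exI[of _ r] exI[of _ "\<lambda>_. SOME A. A \<in> fam"]) (auto simp: some_in_eq)
next
  case (D0_mem A t)
  then obtain m r t' where "represents_tm m r t' t"
    using TM_represents by blast
  then have "represents m r (\<lambda>_. A) (t' \<^bold>\<in> 0) (\<lambda>e. t e \<in> A)" for v
    by (simp add: represents_def represents_tm_def bounded_fm.intros)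
  then show ?case using D0_mem(2) by (intro exI[of _ m] exI[of _ r] exI[of _ "\<lambda>_. A"]) auto
next
  case (D0_not P)
  then obtain k p v \<phi> where "represents k p v \<phi> P" "\<forall>i. v i \<in> fam" by blast
  then have "represents k p v (\<^bold>\<not> \<phi>) (\<lambda>e. \<not> P e)" by (simp add: represents_def bounded_fm.intros)
  then show ?case using \<open>\<forall>i. v i \<in> fam\<close> by blast
next
  case (D0_conj P Q)
  then obtain k p v \<phi> l q w \<psi> where "represents k p v \<phi> P" "represents l q w \<psi> Q" "\<And>i. v i \<in> fam" "\<And>i. w i \<in> fam"
    by blast
  from represents_pair[OF this] obtain m r x \<phi> \<psi>
    where "represents (Suc (Suc m)) r x \<phi> P" "represents (Suc (Suc m)) r x \<psi> Q" "\<forall>i. x i \<in> fam" by blast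
  then have "represents (Suc (Suc m)) r x (\<phi> \<^bold>\<and> \<psi>) (\<lambda>e. P e \<and> Q e)" by (simp add: represents_def bounded_fm.intros)
  then show ?case using \<open>\<forall>i. x i \<in> fam\<close> by blast
next
  case (D0_ex_raw P t)
  then obtain k p v \<phi> where P: "represents k p v \<phi> P" "\<forall>i. v i \<in> fam" by blast
  obtain l q t' where t: "represents_tm l q t' t" using TM_represents D0_ex_raw by blast
  let ?m = "max k l"
  obtain \<psi> where \<psi>: "represents (Suc ?m) (interleave p q) (interleave v v) \<psi> P"
    using represents_raise(1)[OF P(1), of "Suc ?m" q v] le_SucI[OF max.cobounded1[of k l]] by blast
  obtain u where u: "represents_tm ?m (interleave p q) u t"
    using represents_tm_raise(2)[OF t max.cobounded2[of l k], of p] by blast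
  have "represents ?m (interleave p q) (interleave v v) (ExN (Var 0 \<^bold>< shift 1 u \<^bold>\<and> \<psi>))
      (\<lambda>e. \<exists>x<t e. P (case_nat x e))"
    using \<psi> u by (simp add: represents_def represents_tm_def bounded_fm.intros[simplified] mix_case_nat)
  moreover have "\<forall>i. interleave v v i \<in> fam" using P(2) by (simp add: interleave_def)
  ultimately show ?case by blast
qed

subsection \<open>The schemes of induction and comprehension\<close>

text \<open>\<open>S1\<close>, \<open>D1\<close> and \<open>F1\<close> are the recursively
  enumerable relations, the recursive relations and the total recursive functions, relative to
  parameters from \<open>\<A>\<close>.\<close>

definition S1 :: "'a::rca0 set set \<Rightarrow> ((nat \<Rightarrow> 'a) \<Rightarrow> bool) \<Rightarrow> bool" where
  "S1 \<A> R \<longleftrightarrow> (\<exists>P. D0 \<A> (\<lambda>e. P (\<lambda>i. e (Suc i)) (e 0)) \<and> (\<forall>e. R e \<longleftrightarrow> (\<exists>y. P e y)))"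

definition D1 :: "'a::rca0 set set \<Rightarrow> ((nat \<Rightarrow> 'a) \<Rightarrow> bool) \<Rightarrow> bool" where
  "D1 \<A> R \<longleftrightarrow> S1 \<A> R \<and> S1 \<A> (\<lambda>e. \<not> R e)"

text \<open>For a total function a recursively enumerable graph suffices, since a value is refuted
  by finding a different one. Substitution of \<open>f\<close> thus preserves \<open>S1\<close> and,
  applied to the negation as well, \<open>D1\<close>.\<close>

definition F1 :: "'a::rca0 set set \<Rightarrow> ((nat \<Rightarrow> 'a) \<Rightarrow> 'a) \<Rightarrow> bool" where
  "F1 \<A> f \<longleftrightarrow> S1 \<A> (\<lambda>e. e 0 = f (\<lambda>i. e (Suc i)))"

lemma S1I: "D0 \<A> (\<lambda>e. P (\<lambda>i. e (Suc i)) (e 0)) \<Longrightarrow> (\<And>e. R e \<longleftrightarrow> (\<exists>y. P e y)) \<Longrightarrow> S1 \<A> R"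
  unfolding S1_def by blast

lemma S1E:
  assumes "S1 \<A> R"
  obtains P where "D0 \<A> (\<lambda>e. P (\<lambda>i. e (Suc i)) (e 0))" "\<And>e. R e \<longleftrightarrow> (\<exists>y. P e y)"
  using assms unfolding S1_def by blast

lemma represents_ex:
  assumes "represents (Suc (Suc n)) r v \<phi> (\<lambda>e. Q (\<lambda>i. e (Suc i)) (e 0))"
  shows "(\<exists>y. sat std (case_nat y (case_nat a (mix n (\<lambda>_. 0) r))) v \<phi>) \<longleftrightarrow> (\<exists>y. Q (case_nat a (\<lambda>_. 0)) y)"
proof -
  have "Q (case_nat a (\<lambda>_. 0)) y \<longleftrightarrow> sat std (case_nat y (case_nat a (mix n (\<lambda>_. 0) r))) v \<phi>" for y
    using assms[unfolded represents_def, THEN conjunct2, rule_format, of "case_nat y (case_nat a (\<lambda>_. 0))"]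
    by (simp add: mix_case_nat)
  then show ?thesis by simp
qed

lemma S1_induct:
  assumes "S1 \<A> (\<lambda>e. P (e 0))" "P 0" "\<And>x. P x \<Longrightarrow> P (x + 1)"
  shows "P x"
proof -
  obtain Q where Q: "D0 \<A> (\<lambda>e. Q (\<lambda>i. e (Suc i)) (e 0))" "\<And>e. P (e 0) \<longleftrightarrow> (\<exists>y. Q e y)"
    using assms(1) by (rule S1E) blast
  obtain k p v \<phi> where v: "represents k p v \<phi> (\<lambda>e. Q (\<lambda>i. e (Suc i)) (e 0))" "\<And>i. v i \<in> fam"
    using D0_represents[OF Q(1)] by blast
  obtain n r x \<phi> where \<phi>: "represents (Suc (Suc n)) r x \<phi> (\<lambda>e. Q (\<lambda>i. e (Suc i)) (e 0))" "\<forall>i. x i \<in> fam"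
    using represents_pair[OF v(1) v(1) v(2) v(2)] by blast
  show ?thesis
  proof (rule std.sigma_induct[where P = P and \<theta> = \<phi> and v = x and e = "mix n (\<lambda>_. 0) r"])
    show "P a \<longleftrightarrow> (\<exists>y. sat std (case_nat y (case_nat a (mix n (\<lambda>_. 0) r))) x \<phi>)" for a
      using Q(2)[of "case_nat a (\<lambda>_. 0)"] unfolding represents_ex[OF \<phi>(1)] by simp
  qed (use \<phi> assms in \<open>auto simp: represents_def\<close>)
qed

lemma comprehension:
  assumes "D1 \<A> (\<lambda>e. P (e 0))"
  shows "{x. P x} \<in> fam"
proof -
  obtain Q where Q: "D0 \<A> (\<lambda>e. Q (\<lambda>i. e (Suc i)) (e 0))" "\<And>e. P (e 0) \<longleftrightarrow> (\<exists>y. Q e y)"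
    using assms unfolding D1_def by (auto elim!: S1E)
  obtain R where R: "D0 \<A> (\<lambda>e. R (\<lambda>i. e (Suc i)) (e 0))" "\<And>e. \<not> P (e 0) \<longleftrightarrow> (\<exists>y. R e y)"
    using assms unfolding D1_def by (auto elim!: S1E)
  obtain k p v \<phi> l q w \<psi> where *: "represents k p v \<phi> (\<lambda>e. Q (\<lambda>i. e (Suc i)) (e 0))" "\<And>i. v i \<in> fam"
    "represents l q w \<psi> (\<lambda>e. R (\<lambda>i. e (Suc i)) (e 0))" "\<And>i. w i \<in> fam"
    using D0_represents[OF Q(1)] D0_represents[OF R(1)] by blast
  obtain n r v \<phi> \<psi> where \<phi>: "represents (Suc (Suc n)) r v \<phi> (\<lambda>e. Q (\<lambda>i. e (Suc i)) (e 0))"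
    and \<psi>: "represents (Suc (Suc n)) r v \<psi> (\<lambda>e. R (\<lambda>i. e (Suc i)) (e 0))" and v: "\<forall>i. v i \<in> fam"
    using represents_pair[OF *(1,3,2,4)] by blast
  let ?e = "mix n (\<lambda>_. 0) r"
  have P: "(\<exists>y. sat std (case_nat y (case_nat a ?e)) v \<phi>) \<longleftrightarrow> P a" for a
    using Q(2)[of "case_nat a (\<lambda>_. 0)"] unfolding represents_ex[OF \<phi>] by simp
  have nP: "(\<exists>y. sat std (case_nat y (case_nat a ?e)) v \<psi>) \<longleftrightarrow> \<not> P a" for a
    using R(2)[of "case_nat a (\<lambda>_. 0)"] unfolding represents_ex[OF \<psi>] by simp
  have "bounded_fm \<phi>" "bounded_fm (\<^bold>\<not> \<psi>)"
    using \<phi> \<psi> by (auto simp: represents_def intro: bounded_fm.intros)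
  then have "ExN \<phi> \<in> Sigma01" "AllN (\<^bold>\<not> \<psi>) \<in> Pi01"
    by (auto simp: Sigma01_def Pi01_def)
  then have "comprehension_axiom (ExN \<phi>) (AllN (\<^bold>\<not> \<psi>)) \<in> RCA0"
    unfolding RCA0_def by blast
  from bspec[OF std.rca0 this] have "sat std ?e v (comprehension_axiom (ExN \<phi>) (AllN (\<^bold>\<not> \<psi>)))"
    using v unfolding models_def std_simps by blast
  then have ax: "(\<forall>a. (sat std (case_nat a ?e) v (ExN \<phi>) \<longrightarrow> sat std (case_nat a ?e) v (AllN (\<^bold>\<not> \<psi>))) \<and>
      (sat std (case_nat a ?e) v (AllN (\<^bold>\<not> \<psi>)) \<longrightarrow> sat std (case_nat a ?e) v (ExN \<phi>))) \<longrightarrow>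
      (\<exists>A\<in>fam. \<forall>a. (a \<in> A \<longrightarrow> sat std (case_nat a ?e) v (ExN \<phi>)) \<and> (sat std (case_nat a ?e) v (ExN \<phi>) \<longrightarrow> a \<in> A))"
    unfolding comprehension_axiom_def sat.simps(3,5,7,8,11) sat_subst tm_val.simps nat.case std_simps .
  have "sat std (case_nat a ?e) v (ExN \<phi>) \<longleftrightarrow> P a" "sat std (case_nat a ?e) v (AllN (\<^bold>\<not> \<psi>)) \<longleftrightarrow> P a" for a
    using P[of a] nP[of a] by auto
  with ax obtain A where "A \<in> fam" "\<forall>a. a \<in> A \<longleftrightarrow> P a" by blast
  then show ?thesis by (metis Collect_mem_eq Collect_cong)
qed

subsection \<open>Closure properties of definability\<close>

lemma S1_subst: "S1 \<A> R \<Longrightarrow> (\<And>i. TM (s i)) \<Longrightarrow> S1 \<A> (\<lambda>e. R (\<lambda>i. s i e))"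
proof (elim S1E)
  fix P assume P: "D0 \<A> (\<lambda>e. P (\<lambda>i. e (Suc i)) (e 0))" "\<And>e. R e \<longleftrightarrow> (\<exists>y. P e y)" and s: "\<And>i. TM (s i)"
  have "D0 \<A> (\<lambda>e. P (\<lambda>i. case_nat (\<lambda>e. e 0) (\<lambda>i e. s i (\<lambda>i. e (Suc i))) (Suc i) e)
      (case_nat (\<lambda>e. e 0) (\<lambda>i e. s i (\<lambda>i. e (Suc i))) 0 e))"
    by (rule D0_subst[OF P(1)]) (intro TM_case_nat TM_var TM_shift s)
  then show "S1 \<A> (\<lambda>e. R (\<lambda>i. s i e))"
    by (intro S1I[of _ "\<lambda>e. P (\<lambda>i. s i e)"]) (simp_all add: P(2))
qed

lemma S1_D0: "D0 \<A> R \<Longrightarrow> S1 \<A> R"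
  by (rule S1I[of _ "\<lambda>e y. R e"]) (auto intro: D0_shift)

text \<open>A common bound of two witnesses contracts two unbounded quantifiers into one without a
  pairing function.\<close>

lemma S1_bounds: "(\<exists>x y. P x y) \<longleftrightarrow> (\<exists>w::'a::rca0. \<exists>x<w. \<exists>y<w. P x y)"
proof
  assume "\<exists>x y. P x y"
  then obtain x y where "P x y" by blast
  moreover have "x < max x y + 1" "y < max x y + 1" by simp_all
  ultimately show "\<exists>w::'a. \<exists>x<w. \<exists>y<w. P x y" by blast
qed blast

lemma S1_ex:
  assumes "S1 \<A> (\<lambda>e. R (\<lambda>i. e (Suc i)) (e 0))"
  shows "S1 \<A> (\<lambda>e. \<exists>x. R e x)"
proof -
  obtain P where P: "D0 \<A> (\<lambda>e. P (\<lambda>i. e (Suc i)) (e 0))" "\<And>e. R (\<lambda>i. e (Suc i)) (e 0) \<longleftrightarrow> (\<exists>y. P e y)"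
    using assms by (rule S1E) blast
  let ?s = "case_nat (\<lambda>e. e 0) (case_nat (\<lambda>e. e (Suc 0)) (\<lambda>i e. e (Suc (Suc (Suc i)))))"
  have "D0 \<A> (\<lambda>e. P (\<lambda>i. ?s (Suc i) e) (?s 0 e))"
    by (rule D0_subst[OF P(1)]) (intro TM_case_nat TM_var)
  moreover have "(\<lambda>i. ?s (Suc i) e) = case_nat (e (Suc 0)) (\<lambda>i. e (Suc (Suc (Suc i))))" for e :: "nat \<Rightarrow> 'a"
    by (auto simp: fun_eq_iff split: nat.split)
  ultimately have "D0 \<A> (\<lambda>e. P (case_nat (e (Suc 0)) (\<lambda>i. e (Suc (Suc (Suc i))))) (e 0))"
    by simp
  then have "D0 \<A> (\<lambda>e. \<exists>x<e 0. \<exists>y<e 0. P (case_nat x (\<lambda>i. e (Suc i))) y)"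
    by (intro D0_intros)
  moreover have "(\<exists>x. R e x) \<longleftrightarrow> (\<exists>w. \<exists>x<w. \<exists>y<w. P (case_nat x e) y)" for e
    using P(2)[of "case_nat _ e"] S1_bounds[of "\<lambda>x y. P (case_nat x e) y"] by simp
  ultimately show ?thesis
    by (rule S1I[of _ "\<lambda>e w. \<exists>x<w. \<exists>y<w. P (case_nat x e) y"])
qed

lemma S1_conj:
  assumes "S1 \<A> R" "S1 \<A> Q"
  shows "S1 \<A> (\<lambda>e. R e \<and> Q e)"
proof -
  obtain P where P: "D0 \<A> (\<lambda>e. P (\<lambda>i. e (Suc i)) (e 0))" "\<And>e. R e \<longleftrightarrow> (\<exists>y. P e y)"
    using assms(1) by (rule S1E) blast
  obtain P' where P': "D0 \<A> (\<lambda>e. P' (\<lambda>i. e (Suc i)) (e 0))" "\<And>e. Q e \<longleftrightarrow> (\<exists>y. P' e y)"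
    using assms(2) by (rule S1E) blast
  have *: "D0 \<A> (\<lambda>e. P (\<lambda>i. e (Suc (Suc i))) (e 0))" if P: "D0 \<A> (\<lambda>e. P (\<lambda>i. e (Suc i)) (e 0))" for P
    using D0_subst[OF P, of "case_nat (\<lambda>e. e 0) (\<lambda>i e. e (Suc (Suc i)))"]
    by (simp add: TM_case_nat TM_var)
  show ?thesis
  proof (rule S1I[of _ "\<lambda>e w. (\<exists>x<w. P e x) \<and> (\<exists>y<w. P' e y)"])
    show "D0 \<A> (\<lambda>e. (\<exists>x<e 0. P (\<lambda>i. e (Suc i)) x) \<and> (\<exists>y<e 0. P' (\<lambda>i. e (Suc i)) y))"
      by (intro D0_intros * P P')
    show "R e \<and> Q e \<longleftrightarrow> (\<exists>w. (\<exists>x<w. P e x) \<and> (\<exists>y<w. P' e y))" for e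
      using S1_bounds[of "\<lambda>x y. P e x \<and> P' e y"] P(2)[of e] P'(2)[of e] by blast
  qed
qed

lemma S1_disj:
  assumes "S1 \<A> R" "S1 \<A> Q"
  shows "S1 \<A> (\<lambda>e. R e \<or> Q e)"
proof -
  obtain P where P: "D0 \<A> (\<lambda>e. P (\<lambda>i. e (Suc i)) (e 0))" "\<And>e. R e \<longleftrightarrow> (\<exists>y. P e y)"
    using assms(1) by (rule S1E) blast
  obtain P' where P': "D0 \<A> (\<lambda>e. P' (\<lambda>i. e (Suc i)) (e 0))" "\<And>e. Q e \<longleftrightarrow> (\<exists>y. P' e y)"
    using assms(2) by (rule S1E) blast
  show ?thesis
    by (rule S1I[of _ "\<lambda>e y. P e y \<or> P' e y"]) (auto intro: D0_disj P P' simp: P(2) P'(2))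
qed

text \<open>Induction on the length \<open>n\<close> of the segment already bounded; the claim is
  \<open>S1\<close> because its body is bounded. The guard \<open>x < a\<close> lets
  \<open>n\<close> run through all numbers.\<close>

lemma collection:
  assumes "D0 \<A> (\<lambda>e. P (e (Suc 0)) (e 0))" and "\<forall>x<a. \<exists>y. P x y"
  shows "\<exists>b. \<forall>x<a. \<exists>y<b. P x y"
proof -
  have "\<exists>b. \<forall>x<n. x < a \<longrightarrow> (\<exists>y<b. P x y)" for n
  proof (rule S1_induct[where \<A> = \<A> and x = n])
    have "D0 \<A> (\<lambda>e. \<forall>x<e (Suc 0). x < a \<longrightarrow> (\<exists>y<e 0. P x y))"
      by (intro D0_intros assms)
    then show "S1 \<A> (\<lambda>e. \<exists>b. \<forall>x<e 0. x < a \<longrightarrow> (\<exists>y<b. P x y))"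
      by (intro S1_ex S1_D0)
    fix n assume "\<exists>b. \<forall>x<n. x < a \<longrightarrow> (\<exists>y<b. P x y)"
    then obtain b where b: "\<forall>x<n. x < a \<longrightarrow> (\<exists>y<b. P x y)" by blast
    obtain y where y: "n < a \<longrightarrow> P n y" using assms(2) by blast
    have "\<forall>x<n+1. x < a \<longrightarrow> (\<exists>z<max b (y+1). P x z)"
    proof (intro allI impI)
      fix x assume "x < n + 1" "x < a"
      then consider "x < n" | "x = n" by fastforce
      then show "\<exists>z<max b (y+1). P x z"
        by cases (use b y \<open>x < a\<close> in \<open>auto simp: less_max_iff_disj\<close>)
    qed
    then show "\<exists>b. \<forall>x<n+1. x < a \<longrightarrow> (\<exists>y<b. P x y)" by blast
  qed simp
  then show ?thesis by blast
qed

text \<open>By \<open>collection\<close> the unbounded quantifier can be pulled out in front of the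
  bounded one.\<close>

lemma S1_all_TM:
  assumes "S1 \<A> (\<lambda>e. R (\<lambda>i. e (Suc i)) (e 0))" "TM t"
  shows "S1 \<A> (\<lambda>e. \<forall>x<t e. R e x)"
proof -
  obtain P where P: "D0 \<A> (\<lambda>e. P (\<lambda>i. e (Suc i)) (e 0))" "\<And>e. R (\<lambda>i. e (Suc i)) (e 0) \<longleftrightarrow> (\<exists>y. P e y)"
    using assms(1) by (rule S1E) blast
  let ?s = "\<lambda>i0. case_nat (\<lambda>e. e 0) (case_nat (\<lambda>e. e (Suc 0)) i0)"
  have eq: "(\<lambda>i. ?s i0 (Suc i) e) = case_nat (e (Suc 0)) (\<lambda>i. i0 i e)" for i0 and e :: "nat \<Rightarrow> 'a"
    by (auto simp: fun_eq_iff split: nat.split)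
  have s: "D0 \<A> (\<lambda>e. P (case_nat (e (Suc 0)) (\<lambda>i. i0 i e)) (e 0))" if "\<And>i. TM (i0 i)" for i0
  proof -
    have "D0 \<A> (\<lambda>e. P (\<lambda>i. ?s i0 (Suc i) e) (?s i0 0 e))"
      by (rule D0_subst[OF P(1)]) (intro TM_case_nat TM_var that)
    then show ?thesis unfolding eq by simp
  qed
  have "D0 \<A> (\<lambda>e. P (case_nat (e (Suc 0)) (\<lambda>i. e (Suc (Suc (Suc i))))) (e 0))"
    by (rule s) (rule TM_var)
  then have "D0 \<A> (\<lambda>e. \<forall>x<t (\<lambda>i. e (Suc i)). \<exists>y<e 0. P (case_nat x (\<lambda>i. e (Suc i))) y)"
    by (intro D0_all D0_ex TM_var TM_shift assms(2)) simp
  moreover have "(\<forall>x<t e. R e x) \<longleftrightarrow> (\<exists>b. \<forall>x<t e. \<exists>y<b. P (case_nat x e) y)" for e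
  proof -
    have "D0 \<A> (\<lambda>f. P (case_nat (f (Suc 0)) e) (f 0))"
      using s[of "\<lambda>i _. e i"] by (simp add: TM_const)
    then have "(\<forall>x<t e. \<exists>y. P (case_nat x e) y) \<longleftrightarrow> (\<exists>b. \<forall>x<t e. \<exists>y<b. P (case_nat x e) y)"
      using collection[where P = "\<lambda>x y. P (case_nat x e) y"] by blast
    moreover have "R e x \<longleftrightarrow> (\<exists>y. P (case_nat x e) y)" for x
      using P(2)[of "case_nat x e"] by simp
    ultimately show ?thesis by simp
  qed
  ultimately show ?thesis by (rule S1I[of _ "\<lambda>e b. \<forall>x<t e. \<exists>y<b. P (case_nat x e) y"])
qed

lemma S1_let:
  assumes "S1 \<A> (\<lambda>e. R (\<lambda>i. e (Suc i)) (e 0))" "F1 \<A> f"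
  shows "S1 \<A> (\<lambda>e. R e (f e))"
proof -
  have "S1 \<A> (\<lambda>e. \<exists>y. y = f e \<and> R e y)"
    by (intro S1_ex S1_conj assms assms(2)[unfolded F1_def])
  then show ?thesis by simp
qed

lemma S1_ex_TM:
  assumes "S1 \<A> (\<lambda>e. R (\<lambda>i. e (Suc i)) (e 0))" "TM t"
  shows "S1 \<A> (\<lambda>e. \<exists>x<t e. R e x)"
  by (intro S1_ex S1_conj S1_D0[OF D0_less] TM_var TM_shift assms)

lemma S1_skip:
  assumes "S1 \<A> (\<lambda>e. R (\<lambda>i. e (Suc i)) (e 0))"
  shows "S1 \<A> (\<lambda>e. R (\<lambda>i. e (Suc (Suc i))) (e 0))"
  using S1_subst[OF assms, of "case_nat (\<lambda>e. e 0) (\<lambda>i e. e (Suc (Suc i)))"]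
  by (simp add: TM_case_nat TM_var)

lemma S1_ex_less:
  assumes "S1 \<A> (\<lambda>e. R (\<lambda>i. e (Suc i)) (e 0))" "F1 \<A> f"
  shows "S1 \<A> (\<lambda>e. \<exists>x<f e. R e x)"
  by (rule S1_let[OF _ assms(2), where R = "\<lambda>e b. \<exists>x<b. R e x"])
    (intro S1_ex_TM TM_var S1_skip assms(1))

lemma S1_all_less:
  assumes "S1 \<A> (\<lambda>e. R (\<lambda>i. e (Suc i)) (e 0))" "F1 \<A> f"
  shows "S1 \<A> (\<lambda>e. \<forall>x<f e. R e x)"
  by (rule S1_let[OF _ assms(2), where R = "\<lambda>e b. \<forall>x<b. R e x"])
    (intro S1_all_TM TM_var S1_skip assms(1))

section \<open>Calculus of recursive relations and functions\<close>

named_theorems definable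

lemma D1_S1: "D1 \<A> R \<Longrightarrow> S1 \<A> R"
  by (simp add: D1_def)

lemma D1_D0: "D0 \<A> R \<Longrightarrow> D1 \<A> R"
  by (simp add: D1_def S1_D0 D0_not)

lemma D1_not [definable]: "D1 \<A> R \<Longrightarrow> D1 \<A> (\<lambda>e. \<not> R e)"
  by (simp add: D1_def)

lemma D1_conj [definable]:
  assumes "D1 \<A> R" "D1 \<A> Q"
  shows "D1 \<A> (\<lambda>e. R e \<and> Q e)"
proof -
  have *: "S1 \<A> R" "S1 \<A> Q" "S1 \<A> (\<lambda>e. \<not> R e)" "S1 \<A> (\<lambda>e. \<not> Q e)"
    using assms by (simp_all add: D1_def)
  show ?thesis
    unfolding D1_def de_Morgan_conj by (intro conjI S1_conj S1_disj *)
qed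

lemma D1_disj [definable]:
  assumes "D1 \<A> R" "D1 \<A> Q"
  shows "D1 \<A> (\<lambda>e. R e \<or> Q e)"
proof -
  have "D1 \<A> (\<lambda>e. \<not> (\<not> R e \<and> \<not> Q e))" by (intro D1_not D1_conj assms)
  then show ?thesis by simp
qed

lemma D1_imp [definable]: "D1 \<A> R \<Longrightarrow> D1 \<A> Q \<Longrightarrow> D1 \<A> (\<lambda>e. R e \<longrightarrow> Q e)"
  unfolding imp_conv_disj by (intro D1_not D1_disj)

lemma D1_iff [definable]: "D1 \<A> R \<Longrightarrow> D1 \<A> Q \<Longrightarrow> D1 \<A> (\<lambda>e. R e \<longleftrightarrow> Q e)"
  unfolding iff_conv_conj_imp by (intro D1_conj D1_imp)

lemma D1_bool [definable]: "D1 \<A> (\<lambda>e. c)"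
  by (rule D1_D0) (rule D0_bool)

lemma D1_ex [definable]:
  assumes "D1 \<A> (\<lambda>e. R (\<lambda>i. e (Suc i)) (e 0))" "F1 \<A> f"
  shows "D1 \<A> (\<lambda>e. \<exists>x<f e. R e x)"
proof -
  have *: "S1 \<A> (\<lambda>e. R (\<lambda>i. e (Suc i)) (e 0))" "S1 \<A> (\<lambda>e. \<not> R (\<lambda>i. e (Suc i)) (e 0))"
    using assms by (simp_all add: D1_def)
  have "S1 \<A> (\<lambda>e. \<exists>x<f e. R e x)" "S1 \<A> (\<lambda>e. \<forall>x<f e. \<not> R e x)"
    by (intro S1_ex_less S1_all_less * assms)+
  then show ?thesis by (simp add: D1_def)
qed

lemma D1_all [definable]:
  assumes "D1 \<A> (\<lambda>e. R (\<lambda>i. e (Suc i)) (e 0))" "F1 \<A> f"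
  shows "D1 \<A> (\<lambda>e. \<forall>x<f e. R e x)"
proof -
  have "D1 \<A> (\<lambda>e. \<not> (\<exists>x<f e. \<not> R e x))" by (intro D1_not D1_ex assms)
  then show ?thesis by simp
qed

lemma D1_subst: "D1 \<A> R \<Longrightarrow> (\<And>i. TM (s i)) \<Longrightarrow> D1 \<A> (\<lambda>e. R (\<lambda>i. s i e))"
  using S1_subst[of \<A> R s] S1_subst[of \<A> "\<lambda>e. \<not> R e" s] by (simp add: D1_def)

lemma F1_subst:
  assumes "F1 \<A> f" "\<And>i. TM (s i)"
  shows "F1 \<A> (\<lambda>e. f (\<lambda>i. s i e))"
proof -
  let ?s = "case_nat (\<lambda>e. e 0) (\<lambda>i e. s i (\<lambda>i. e (Suc i)))"
  have "S1 \<A> (\<lambda>e. ?s 0 e = f (\<lambda>i. ?s (Suc i) e))"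
    by (rule S1_subst[OF assms(1)[unfolded F1_def]]) (intro TM_case_nat TM_var TM_shift assms)
  then show ?thesis by (simp add: F1_def)
qed

lemma D1_let: "D1 \<A> (\<lambda>e. R (\<lambda>i. e (Suc i)) (e 0)) \<Longrightarrow> F1 \<A> f \<Longrightarrow> D1 \<A> (\<lambda>e. R e (f e))"
  using S1_let[of \<A> R f] S1_let[of \<A> "\<lambda>e x. \<not> R e x" f] by (simp add: D1_def)

lemma F1_let:
  assumes "F1 \<A> (\<lambda>e. g (\<lambda>i. e (Suc i)) (e 0))" "F1 \<A> f"
  shows "F1 \<A> (\<lambda>e. g e (f e))"
proof -
  let ?s = "case_nat (\<lambda>e. e (Suc 0)) (case_nat (\<lambda>e. e 0) (\<lambda>i e. e (Suc (Suc i))))"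
  have "S1 \<A> (\<lambda>e. ?s 0 e = g (\<lambda>i. ?s (Suc (Suc i)) e) (?s (Suc 0) e))"
    by (rule S1_subst[OF assms(1)[unfolded F1_def]]) (intro TM_case_nat TM_var)
  then have "S1 \<A> (\<lambda>e. e (Suc 0) = g (\<lambda>i. e (Suc (Suc i))) (e 0))" by simp
  then have "S1 \<A> (\<lambda>e. e 0 = g (\<lambda>i. e (Suc i)) (f (\<lambda>i. e (Suc i))))"
    by (rule S1_let[where R = "\<lambda>e y. e 0 = g (\<lambda>i. e (Suc i)) y"])
      (rule F1_subst[OF assms(2), of "\<lambda>i e. e (Suc i)"], rule TM_var)
  then show ?thesis by (simp add: F1_def)
qed

lemma F1_TM: "TM f \<Longrightarrow> F1 \<A> f"
  unfolding F1_def by (intro S1_D0 D0_eq TM_var TM_shift)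

lemma F1_var [definable]: "F1 \<A> (\<lambda>e. e i)"
  by (intro F1_TM TM_var)

lemma F1_const [definable]: "F1 \<A> (\<lambda>e. c)"
  by (intro F1_TM TM_const)

lemma D1_comp1: "D1 \<A> (\<lambda>e. R (e 0)) \<Longrightarrow> F1 \<A> f \<Longrightarrow> D1 \<A> (\<lambda>e. R (f e))"
  by (rule D1_let[where R = "\<lambda>e. R"])

lemma D1_comp2:
  assumes "D1 \<A> (\<lambda>e. R (e 0) (e (Suc 0)))" "F1 \<A> f" "F1 \<A> g"
  shows "D1 \<A> (\<lambda>e. R (f e) (g e))"
proof -
  have "D1 \<A> (\<lambda>e. R (e (Suc 0)) (e 0))"
    using D1_subst[OF assms(1), of "case_nat (\<lambda>e. e (Suc 0)) (\<lambda>_ e. e 0)"] by (simp add: TM_case_nat TM_var)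
  then have "D1 \<A> (\<lambda>e. R (e 0) (g (\<lambda>i. e (Suc i))))"
    by (rule D1_let[where R = "\<lambda>e y. R (e 0) y"]) (rule F1_subst[OF assms(3), of "\<lambda>i e. e (Suc i)"], rule TM_var)
  then show ?thesis by (rule D1_let[where R = "\<lambda>e x. R x (g e)"]) (rule assms(2))
qed

lemma F1_comp1: "F1 \<A> (\<lambda>e. h (e 0)) \<Longrightarrow> F1 \<A> f \<Longrightarrow> F1 \<A> (\<lambda>e. h (f e))"
  by (rule F1_let[where g = "\<lambda>e. h"])

lemma F1_comp2:
  assumes "F1 \<A> (\<lambda>e. h (e 0) (e (Suc 0)))" "F1 \<A> f" "F1 \<A> g"
  shows "F1 \<A> (\<lambda>e. h (f e) (g e))"
proof -
  have "F1 \<A> (\<lambda>e. h (e (Suc 0)) (e 0))"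
    using F1_subst[OF assms(1), of "case_nat (\<lambda>e. e (Suc 0)) (\<lambda>_ e. e 0)"] by (simp add: TM_case_nat TM_var)
  then have "F1 \<A> (\<lambda>e. h (e 0) (g (\<lambda>i. e (Suc i))))"
    by (rule F1_let[where g = "\<lambda>e y. h (e 0) y"]) (rule F1_subst[OF assms(3), of "\<lambda>i e. e (Suc i)"], rule TM_var)
  then show ?thesis by (rule F1_let[where g = "\<lambda>e x. h x (g e)"]) (rule assms(2))
qed

lemma D1_eq [definable]: "F1 \<A> f \<Longrightarrow> F1 \<A> g \<Longrightarrow> D1 \<A> (\<lambda>e. f e = g e)"
  by (rule D1_comp2[where R = "(=)"]) (intro D1_D0 D0_eq TM_var)

lemma D1_less [definable]: "F1 \<A> f \<Longrightarrow> F1 \<A> g \<Longrightarrow> D1 \<A> (\<lambda>e. f e < g e)"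
  by (rule D1_comp2[where R = "(<)"]) (intro D1_D0 D0_intros)

lemma D1_le [definable]: "F1 \<A> f \<Longrightarrow> F1 \<A> g \<Longrightarrow> D1 \<A> (\<lambda>e. f e \<le> g e)"
  by (rule D1_comp2[where R = "(\<le>)"]) (intro D1_D0 D0_intros)

lemma D1_mem: "F1 \<A> f \<Longrightarrow> A \<in> \<A> \<Longrightarrow> A \<in> fam \<Longrightarrow> D1 \<A> (\<lambda>e. f e \<in> A)"
  by (rule D1_comp1[where R = "\<lambda>x. x \<in> A"]) (intro D1_D0 D0_intros)

lemma F1_add [definable]: "F1 \<A> f \<Longrightarrow> F1 \<A> g \<Longrightarrow> F1 \<A> (\<lambda>e. f e + g e)"
  by (rule F1_comp2[where h = "(+)"]) (intro F1_TM TM_add TM_var)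

lemma F1_mul [definable]: "F1 \<A> f \<Longrightarrow> F1 \<A> g \<Longrightarrow> F1 \<A> (\<lambda>e. f e * g e)"
  by (rule F1_comp2[where h = "(*)"]) (intro F1_TM TM_mul TM_var)

lemma D1_ex_le [definable]:
  "D1 \<A> (\<lambda>e. R (\<lambda>i. e (Suc i)) (e 0)) \<Longrightarrow> F1 \<A> f \<Longrightarrow> D1 \<A> (\<lambda>e. \<exists>x\<le>f e. R e x)"
  using D1_ex[of \<A> R "\<lambda>e. f e + 1"] by (simp add: definable)

lemma D1_all_le [definable]:
  "D1 \<A> (\<lambda>e. R (\<lambda>i. e (Suc i)) (e 0)) \<Longrightarrow> F1 \<A> f \<Longrightarrow> D1 \<A> (\<lambda>e. \<forall>x\<le>f e. R e x)"
  using D1_all[of \<A> R "\<lambda>e. f e + 1"] by (simp add: definable)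

lemma F1_graph: "S1 \<A> (\<lambda>e. R (\<lambda>i. e (Suc i)) (e 0)) \<Longrightarrow> (\<And>e y. y = f e \<longleftrightarrow> R e y) \<Longrightarrow> F1 \<A> f"
  unfolding F1_def by simp

lemma D1_induct:
  assumes "D1 \<A> (\<lambda>e. P (e 0))" "P 0" "\<And>x. P x \<Longrightarrow> P (x + 1)"
  shows "P x"
  using S1_induct[OF D1_S1] assms by blast

lemma D1_least:
  assumes "D1 \<A> (\<lambda>e. P (e 0))" "P a"
  shows "\<exists>x. P x \<and> (\<forall>y<x. \<not> P y)"
proof (rule ccontr)
  assume *: "\<not> (\<exists>x. P x \<and> (\<forall>y<x. \<not> P y))"
  have "\<forall>y<n. \<not> P y" for n
  proof (rule D1_induct[where \<A> = \<A> and x = n])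
    show "D1 \<A> (\<lambda>e. \<forall>y<e 0. \<not> P y)"
      by (intro definable D1_subst[OF assms(1), of "\<lambda>i e. e i"] TM_var)
    show "\<forall>y<x + 1. \<not> P y" if "\<forall>y<x. \<not> P y" for x
      using that * by (auto simp: le_less)
  qed simp
  then show False using assms(2) less_add_one_iff by blast
qed

lemma Least_D1:
  assumes "D1 \<A> (\<lambda>e. P (e 0))" "P a"
  shows "P (LEAST x. P x)" "\<And>y. P y \<Longrightarrow> (LEAST x. P x) \<le> y"
proof -
  obtain x where x: "P x" "\<forall>y<x. \<not> P y" using D1_least[OF assms] by blast
  then have "(LEAST x. P x) = x" by (intro Least_equality) (auto simp: not_less[symmetric])
  then show "P (LEAST x. P x)" "\<And>y. P y \<Longrightarrow> (LEAST x. P x) \<le> y" using x by (auto simp: not_less[symmetric])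
qed

lemma D1_param: "D1 \<A> (\<lambda>e. R (\<lambda>i. e (Suc i)) (e 0)) \<Longrightarrow> D1 \<A> (\<lambda>e. R f (e 0))"
  using D1_subst[of \<A> "\<lambda>e. R (\<lambda>i. e (Suc i)) (e 0)" "case_nat (\<lambda>e. e 0) (\<lambda>i e. f i)"]
  by (simp add: TM_case_nat TM_var TM_const)

lemma D1_skip:
  assumes "D1 \<A> (\<lambda>e. R (\<lambda>i. e (Suc i)) (e 0))"
  shows "D1 \<A> (\<lambda>e. R (\<lambda>i. e (Suc (Suc i))) (e 0))"
  using D1_subst[OF assms, of "case_nat (\<lambda>e. e 0) (\<lambda>i e. e (Suc (Suc i)))"]
  by (simp add: TM_case_nat TM_var)

text \<open>Unbounded search with guaranteed success: besides \<open>R e y\<close>, the graph only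
  asks for the bounded statement that nothing smaller works.\<close>

lemma F1_Least:
  assumes "D1 \<A> (\<lambda>e. R (\<lambda>i. e (Suc i)) (e 0))" "\<And>e. \<exists>y. R e y"
  shows "F1 \<A> (\<lambda>e. LEAST y. R e y)"
proof (rule F1_graph[where R = "\<lambda>e y. R e y \<and> (\<forall>z<y. \<not> R e z)"])
  show "S1 \<A> (\<lambda>e. R (\<lambda>i. e (Suc i)) (e 0) \<and> (\<forall>z<e 0. \<not> R (\<lambda>i. e (Suc i)) z))"
    by (intro D1_S1 definable assms D1_skip)
  fix e y
  obtain x where "R e x" using assms(2) by blast
  then have "R e (LEAST y. R e y)" "\<And>y. R e y \<Longrightarrow> (LEAST x. R e x) \<le> y"
    using Least_D1[OF D1_param[OF assms(1), of e]] by blast+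
  then show "y = (LEAST y. R e y) \<longleftrightarrow> R e y \<and> (\<forall>z<y. \<not> R e z)"
    by (metis leD not_less_iff_gr_or_eq order_le_less)
qed

lemma F1_if [definable]:
  assumes "D1 \<A> P" "F1 \<A> f" "F1 \<A> g"
  shows "F1 \<A> (\<lambda>e. if P e then f e else g e)"
proof (rule F1_graph[where R = "\<lambda>e y. (P e \<and> y = f e) \<or> (\<not> P e \<and> y = g e)"])
  show "S1 \<A> (\<lambda>e. P (\<lambda>i. e (Suc i)) \<and> e 0 = f (\<lambda>i. e (Suc i)) \<or> \<not> P (\<lambda>i. e (Suc i)) \<and> e 0 = g (\<lambda>i. e (Suc i)))"
    by (intro D1_S1 definable D1_subst[OF assms(1)] F1_subst[OF assms(2)] F1_subst[OF assms(3)] TM_var)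
qed auto

lemma D1_comp3:
  assumes "D1 \<A> (\<lambda>e. R (e 0) (e (Suc 0)) (e (Suc (Suc 0))))" "F1 \<A> f" "F1 \<A> g" "F1 \<A> h"
  shows "D1 \<A> (\<lambda>e. R (f e) (g e) (h e))"
proof -
  have "D1 \<A> (\<lambda>e. R (e (Suc (Suc 0))) (e (Suc 0)) (e 0))"
    using D1_subst[OF assms(1), of "case_nat (\<lambda>e. e (Suc (Suc 0))) (case_nat (\<lambda>e. e (Suc 0)) (\<lambda>_ e. e 0))"]
    by (simp add: TM_case_nat TM_var)
  then have "D1 \<A> (\<lambda>e. R (e (Suc 0)) (e 0) (h (\<lambda>i. e (Suc (Suc i)))))"
    by (rule D1_let[where R = "\<lambda>e. R (e (Suc 0)) (e 0)"]) (intro F1_subst[OF assms(4)] TM_var)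
  then have "D1 \<A> (\<lambda>e. R (e 0) (g (\<lambda>i. e (Suc i))) (h (\<lambda>i. e (Suc i))))"
    by (rule D1_let[where R = "\<lambda>e x. R (e 0) x (h (\<lambda>i. e (Suc i)))"]) (intro F1_subst[OF assms(3)] TM_var)
  then show ?thesis
    by (rule D1_let[where R = "\<lambda>e x. R x (g e) (h e)"]) (rule assms)
qed

section \<open>Pairs, finite sets and recursion\<close>

definition pr :: "'a::rca0 \<Rightarrow> 'a \<Rightarrow> 'a" where
  "pr x y = (x + y) * (x + y) + x"

lemma le_square: "(x::'a::rca0) \<le> x * x"
proof (cases "x = 0")
  case False
  then have "1 \<le> x" using less_one_iff[of x] by (metis not_less)
  then show ?thesis using mult_left_mono[of 1 x x] by simp
qed simp

lemma le_pr1 [simp]: "x \<le> pr x y"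
  by (simp add: pr_def)

lemma le_pr2 [simp]: "y \<le> pr x y"
proof -
  have "y \<le> x + y" by simp
  also have "\<dots> \<le> (x + y) * (x + y)" by (rule le_square)
  also have "\<dots> \<le> pr x y" by (simp add: pr_def)
  finally show ?thesis .
qed

text \<open>\<open>pr x y\<close> lies between the squares of \<open>x + y\<close> and of
  \<open>x + y + 1\<close>, so the sum of the components can be read off.\<close>

lemma pr_less: "x + y < z + w \<Longrightarrow> pr x y < pr z w"
proof -
  assume less: "x + y < z + w"
  have "pr x y \<le> (x + y) * (x + y) + (x + y)" by (simp add: pr_def)
  also have "\<dots> < (x + y) * (x + y) + (x + y) + (x + y + 1)" by (simp add: zero_less_iff_neq_zero)
  also have "\<dots> = (x + y + 1) * (x + y + 1)" by (simp add: algebra_simps)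
  also have "\<dots> \<le> (z + w) * (z + w)" using less by (intro mult_mono) auto
  also have "\<dots> \<le> pr z w" by (simp add: pr_def)
  finally show ?thesis .
qed

lemma pr_inject [simp]: "pr x y = pr z w \<longleftrightarrow> x = z \<and> y = w"
proof
  assume eq: "pr x y = pr z w"
  then have "x + y = z + w" using pr_less[of x y z w] pr_less[of z w x y] by (cases "x + y" "z + w" rule: linorder_cases) auto
  then show "x = z \<and> y = w" using eq by (auto simp: pr_def)
qed simp

lemma pr_less_imp: "pr x y < t \<Longrightarrow> x < t" "pr x y < t \<Longrightarrow> y < t"
  by (auto intro: le_less_trans[OF le_pr1] le_less_trans[OF le_pr2])

lemma F1_pr [definable]: "F1 \<A> f \<Longrightarrow> F1 \<A> g \<Longrightarrow> F1 \<A> (\<lambda>e. pr (f e) (g e))"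
  unfolding pr_def by (intro definable)

lemma dvd_bounded: "(a::'a::rca0) dvd b \<longleftrightarrow> (\<exists>q\<le>b. b = a * q)"
proof
  assume "a dvd b"
  then obtain q where q: "b = a * q" by (auto elim: dvdE)
  show "\<exists>q\<le>b. b = a * q"
  proof (cases "a = 0")
    case True
    then show ?thesis using q by (intro exI[of _ 0]) simp
  next
    case False
    then have "1 \<le> a" using less_one_iff[of a] by (metis not_less)
    then have "q \<le> b" using q mult_right_mono[of 1 a q] by simp
    then show ?thesis using q by blast
  qed
qed auto

lemma D1_dvd [definable]: "F1 \<A> f \<Longrightarrow> F1 \<A> g \<Longrightarrow> D1 \<A> (\<lambda>e. f e dvd g e)"
  by (rule D1_comp2[where R = "(dvd)"], unfold dvd_bounded) (intro definable)

lemma D1_Collect [definable]: "D1 \<A> (\<lambda>e. P e (f e)) \<Longrightarrow> D1 \<A> (\<lambda>e. f e \<in> {x. P e x})"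
  by simp

lemma D1_shift: "D1 \<A> R \<Longrightarrow> D1 \<A> (\<lambda>e. R (\<lambda>i. e (Suc i)))"
  by (rule D1_subst[where s = "\<lambda>i e. e (Suc i)"]) (auto intro: TM_var)

lemma F1_shift: "F1 \<A> f \<Longrightarrow> F1 \<A> (\<lambda>e. f (\<lambda>i. e (Suc i)))"
  by (rule F1_subst[where s = "\<lambda>i e. e (Suc i)"]) (auto intro: TM_var)

lemma D0_mono: "D0 \<A> P \<Longrightarrow> \<A> \<inter> fam \<subseteq> \<B> \<Longrightarrow> D0 \<B> P"
  by (induction rule: D0.induct) (auto intro: D0.intros)

lemma S1_mono: "S1 \<A> P \<Longrightarrow> \<A> \<inter> fam \<subseteq> \<B> \<Longrightarrow> S1 \<B> P"
  unfolding S1_def by (blast intro: D0_mono)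

lemma D1_mono: "D1 \<A> P \<Longrightarrow> \<A> \<inter> fam \<subseteq> \<B> \<Longrightarrow> D1 \<B> P"
  unfolding D1_def using S1_mono[of \<A> P \<B>] S1_mono[of \<A> "\<lambda>e. \<not> P e" \<B>] by blast

lemma F1_mono: "F1 \<A> f \<Longrightarrow> \<A> \<inter> fam \<subseteq> \<B> \<Longrightarrow> F1 \<B> f"
  unfolding F1_def by (rule S1_mono)

lemma D1_fam: "D1 \<A> P \<Longrightarrow> D1 fam P"
  by (rule D1_mono) auto

lemma fam_iff: "A \<in> fam \<longleftrightarrow> D1 fam (\<lambda>e. e 0 \<in> A)"
  using comprehension[of fam "\<lambda>x. x \<in> A"] D1_mem[OF F1_var, of A fam] by auto

lemma famI: "D1 \<A> (\<lambda>e. e 0 \<in> A) \<Longrightarrow> A \<in> fam"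
  using comprehension[of \<A> "\<lambda>x. x \<in> A"] by simp

subsection \<open>Codes of finite sets\<close>

definition memf :: "'a::rca0 \<Rightarrow> 'a \<Rightarrow> bool" where
  "memf s t \<longleftrightarrow> (\<exists>k m n. t = pr k (pr m n) \<and> s < k \<and> m * (s + 1) + 1 dvd n)"

lemma memf_less: "memf s t \<Longrightarrow> s < t"
  unfolding memf_def using le_pr1 less_le_trans by blast

lemma memf_pr_less: "memf (pr x y) t \<Longrightarrow> x < t" "memf (pr x y) t \<Longrightarrow> y < t"
  using memf_less pr_less_imp by blast+

lemma memf_bounded:
  "memf s t \<longleftrightarrow> (\<exists>k\<le>t. \<exists>m\<le>t. \<exists>n\<le>t. t = pr k (pr m n) \<and> s < k \<and> m * (s + 1) + 1 dvd n)"
proof -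
  have "k \<le> pr k (pr m n)" "m \<le> pr k (pr m n)" "n \<le> pr k (pr m n)" for k m n :: 'a
    by (rule le_pr1, rule order_trans[OF le_pr1 le_pr2], rule order_trans[OF le_pr2 le_pr2])
  then show ?thesis unfolding memf_def by auto
qed

lemma D1_memf [definable]: "F1 \<A> f \<Longrightarrow> F1 \<A> g \<Longrightarrow> D1 \<A> (\<lambda>e. memf (f e) (g e))"
  by (rule D1_comp2[where R = memf], unfold memf_bounded) (intro definable)

text \<open>A substitute for the factorial: primitive recursion is not yet at hand, as it will rest
  on the finite sets coded with the help of \<open>m\<close>.\<close>

lemma common_multiple: "\<exists>m::'a::rca0. m \<noteq> 0 \<and> (\<forall>i<n. i + 1 dvd m)"
proof (rule S1_induct[where \<A> = "{}" and x = n])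
  show "S1 {} (\<lambda>e. \<exists>m::'a. m \<noteq> 0 \<and> (\<forall>i<e 0. i + 1 dvd m))"
    by (intro S1_ex D1_S1 definable)
  show "\<exists>m::'a. m \<noteq> 0 \<and> (\<forall>i<0. i + 1 dvd m)" by (intro exI[of _ 1]) simp
  fix n :: 'a assume "\<exists>m. m \<noteq> 0 \<and> (\<forall>i<n. i + 1 dvd m)"
  then obtain m where "m \<noteq> 0" "\<forall>i<n. i + 1 dvd m" by blast
  then have "m * (n + 1) \<noteq> 0 \<and> (\<forall>i<n+1. i + 1 dvd m * (n + 1))"
    by (auto simp: le_less)
  then show "\<exists>m. m \<noteq> 0 \<and> (\<forall>i<n+1. i + 1 dvd m)" by blast
qed

text \<open>
  If every positive number up to \<open>k\<close> divides \<open>m\<close>, the moduli \<open>m (s + 1) + 1\<close> with \<open>s < k\<close> are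
  pairwise coprime: a common divisor of two of them divides the difference of their indices.
\<close>

lemma modulus_dvd:
  fixes m :: "'a::rca0"
  assumes m: "\<forall>i<k. i + 1 dvd m" and "s < k" "t < k" "s \<noteq> t"
    and dvd: "m * (s + 1) + 1 dvd n * (m * (t + 1) + 1)"
  shows "m * (s + 1) + 1 dvd n"
proof -
  let ?p = "\<lambda>s. m * (s + 1) + 1"
  \<comment> \<open>\<open>?p s\<close> is coprime to each divisor \<open>d\<close> of
    \<open>m\<close>: it divides both \<open>n m (s + 1)\<close> and
    \<open>n m (s + 1) + n\<close>.\<close>
  have *: "?p s dvd n" if nd: "?p s dvd n * d" and d: "d dvd m" for d
  proof -
    have "n * d dvd n * (m * (s + 1))" using d by (intro mult_dvd_mono) auto
    with nd have "?p s dvd n * (m * (s + 1))" by (rule dvd_trans)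
    moreover have "?p s dvd n * (m * (s + 1)) + n" by (intro dvdI[of _ _ n]) (simp add: algebra_simps)
    ultimately show ?thesis using dvd_add_right_iff by blast
  qed
  consider d where "t = s + (d + 1)" | d where "s = t + (d + 1)"
    using \<open>s \<noteq> t\<close> std.less_cases[of s t] std.less_iff[of s t] std.less_iff[of t s] by auto
  then show ?thesis
  proof cases
    case 1
    then have "d + 1 \<le> t" by simp
    then have "d < k" using less_trans \<open>t < k\<close> by auto
    have "?p s dvd (t + 1) * n * ?p s" by simp
    \<comment> \<open>Eliminating \<open>m\<close> from the two moduli leaves the difference
      \<open>d + 1\<close> of the indices, which divides \<open>m\<close>.\<close>
    also have "(t + 1) * n * ?p s = (s + 1) * (n * ?p t) + n * (d + 1)"
      unfolding 1 by (simp add: algebra_simps)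
    finally have "?p s dvd (s + 1) * (n * ?p t) + n * (d + 1)" .
    then have "?p s dvd n * (d + 1)" using dvd dvd_add_right_iff dvd_mult by blast
    then show ?thesis using * m \<open>d < k\<close> by blast
  next
    case 2
    then have "d + 1 \<le> s" by simp
    then have "d < k" using less_trans \<open>s < k\<close> by auto
    have "?p s dvd (s + 1) * (n * ?p t)" using dvd by simp
    also have "(s + 1) * (n * ?p t) = (t + 1) * n * ?p s + n * (d + 1)"
      unfolding 2 by (simp add: algebra_simps)
    finally have "?p s dvd n * (d + 1)" using dvd_add_right_iff[of "?p s" "(t + 1) * n * ?p s"] by simp
    then show ?thesis using * m \<open>d < k\<close> by blast
  qed
qed

text \<open>At stage \<open>j\<close> the number \<open>n\<close> is the product of the moduli of
  the elements of \<open>A\<close> below \<open>j\<close>. The induction only asserts which moduli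
  divide it, and so stays within \<open>S1\<close>.\<close>

lemma code_exists:
  fixes k :: "'a::rca0"
  assumes A: "D1 \<A> (\<lambda>e. e 0 \<in> A)"
  shows "\<exists>t. \<forall>s. memf s t \<longleftrightarrow> s < k \<and> s \<in> A"
proof -
  obtain m :: 'a where m0: "m \<noteq> 0" and m: "\<forall>i<k. i + 1 dvd m" using common_multiple by blast
  let ?p = "\<lambda>s. m * (s + 1) + 1"
  have "\<exists>n. \<forall>s<k. ?p s dvd n \<longleftrightarrow> s < j \<and> s \<in> A" for j
  proof (rule S1_induct[where \<A> = \<A> and x = j])
    show "S1 \<A> (\<lambda>e. \<exists>n. \<forall>s<k. ?p s dvd n \<longleftrightarrow> s < e 0 \<and> s \<in> A)"
      by (intro S1_ex D1_S1 definable D1_comp1[OF A])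
    \<comment> \<open>No modulus may divide the empty product; this is where
      \<open>m \<noteq> 0\<close> enters.\<close>
    have "\<not> ?p s dvd 1" for s
    proof
      assume "?p s dvd 1"
      then obtain q where q: "1 = ?p s * q" by (auto elim: dvdE)
      have "m * (s + 1) \<noteq> 0" using m0 by simp
      then have "1 < ?p s" by (simp add: zero_less_iff_neq_zero)
      moreover have "q \<noteq> 0" using q by auto
      then have "1 \<le> q" using less_one_iff[of q] by (metis not_less)
      then have "?p s \<le> ?p s * q" using mult_left_mono[of 1 q "?p s"] by simp
      ultimately show False using q by simp
    qed
    then show "\<exists>n. \<forall>s<k. ?p s dvd n \<longleftrightarrow> s < 0 \<and> s \<in> A" by (intro exI[of _ 1]) simp
    fix j assume "\<exists>n. \<forall>s<k. ?p s dvd n \<longleftrightarrow> s < j \<and> s \<in> A"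
    then obtain n where n: "\<forall>s<k. ?p s dvd n \<longleftrightarrow> s < j \<and> s \<in> A" by blast
    show "\<exists>n. \<forall>s<k. ?p s dvd n \<longleftrightarrow> s < j + 1 \<and> s \<in> A"
    proof (cases "j \<in> A \<and> j < k")
      case True
      have "?p s dvd n * ?p j \<longleftrightarrow> s < j + 1 \<and> s \<in> A" if "s < k" for s
      proof (cases "s = j")
        case False
        then have "?p s dvd n * ?p j \<longleftrightarrow> ?p s dvd n"
          using modulus_dvd[OF m \<open>s < k\<close>, of j n] True by auto
        then show ?thesis using n that False by (auto simp: le_less)
      qed (use True in auto)
      then show ?thesis by blast
    next
      case False
      then have "s < j + 1 \<and> s \<in> A \<longleftrightarrow> s < j \<and> s \<in> A" if "s < k" for s
        using that by (auto simp: le_less)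
      then show ?thesis using n by blast
    qed
  qed
  from this[of k] obtain n where "\<forall>s<k. ?p s dvd n \<longleftrightarrow> s < k \<and> s \<in> A" by blast
  then have "\<forall>s. memf s (pr k (pr m n)) \<longleftrightarrow> s < k \<and> s \<in> A" by (auto simp: memf_def)
  then show ?thesis by blast
qed

definition fset :: "'a::rca0 \<Rightarrow> 'a set \<Rightarrow> 'a" where
  "fset k A = (LEAST t. \<forall>s. memf s t \<longleftrightarrow> s < k \<and> s \<in> A)"

definition finset :: "'a::rca0 \<Rightarrow> bool" where
  "finset t \<longleftrightarrow> (\<forall>u<t. \<not> (\<forall>s. memf s u \<longleftrightarrow> memf s t))"

lemma code_bounded: "(\<forall>s. memf s t \<longleftrightarrow> s < k \<and> s \<in> A) \<longleftrightarrow> (\<forall>s<t + k. memf s t \<longleftrightarrow> s < k \<and> s \<in> A)"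
proof -
  have "\<not> memf s t \<and> \<not> s < k" if "\<not> s < t + k" for s
    using that memf_less[of s t] less_le_trans[of s t "t + k"] less_le_trans[of s k "t + k"] by auto
  then show ?thesis by blast
qed

lemma memf_fset:
  assumes "A \<in> fam"
  shows "memf s (fset k A) \<longleftrightarrow> s < k \<and> s \<in> A"
proof -
  have A: "D1 fam (\<lambda>e. e 0 \<in> A)" using assms by (simp add: fam_iff)
  have "D1 fam (\<lambda>e. \<forall>s. memf s (e 0) \<longleftrightarrow> s < k \<and> s \<in> A)"
    unfolding code_bounded by (intro definable D1_mem assms)
  moreover obtain t where "\<forall>s. memf s t \<longleftrightarrow> s < k \<and> s \<in> A" using code_exists[OF A] by blast
  ultimately have "\<forall>s. memf s (LEAST t. \<forall>s. memf s t \<longleftrightarrow> s < k \<and> s \<in> A) \<longleftrightarrow> s < k \<and> s \<in> A"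
    by (rule Least_D1(1)[where P = "\<lambda>t. \<forall>s. memf s t \<longleftrightarrow> s < k \<and> s \<in> A"])
  then show ?thesis unfolding fset_def by blast
qed

lemma finset_fset:
  assumes "A \<in> fam"
  shows "finset (fset k A)"
proof -
  have "D1 fam (\<lambda>e. \<forall>s. memf s (e 0) \<longleftrightarrow> s < k \<and> s \<in> A)"
    unfolding code_bounded by (intro definable D1_mem assms)
  from Least_D1(2)[OF this] have "fset k A \<le> u" if "\<forall>s. memf s u \<longleftrightarrow> s < k \<and> s \<in> A" for u
    using that unfolding fset_def by blast
  then show ?thesis
    unfolding finset_def memf_fset[OF assms] using leD by blast
qed

lemma F1_fset [definable]:
  assumes "F1 \<A> k" "D1 \<A> (\<lambda>e. e 0 \<in> A (\<lambda>i. e (Suc i)))"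
  shows "F1 \<A> (\<lambda>e. fset (k e) (A e))"
  unfolding fset_def
proof (rule F1_Least)
  have "D1 \<A> (\<lambda>e. e 0 \<in> A (\<lambda>i. e (Suc (Suc i))))"
    by (rule D1_skip[where R = "\<lambda>e x. x \<in> A e"]) (rule assms)
  then show "D1 \<A> (\<lambda>e. \<forall>s. memf s (e 0) \<longleftrightarrow> s < k (\<lambda>i. e (Suc i)) \<and> s \<in> A (\<lambda>i. e (Suc i)))"
    unfolding code_bounded by (intro definable F1_subst[OF assms(1)] TM_var)
  show "\<exists>t. \<forall>s. memf s t \<longleftrightarrow> s < k e \<and> s \<in> A e" for e
    by (rule code_exists[OF D1_param]) (rule assms)
qed

lemma finset_eq: "finset t \<Longrightarrow> finset u \<Longrightarrow> (\<And>s. memf s t \<longleftrightarrow> memf s u) \<Longrightarrow> t = u"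
  unfolding finset_def by (metis linorder_neqE)

lemma fam_memf [simp]: "{x. memf x t} \<in> fam"
  by (rule comprehension[where \<A> = fam]) (intro definable)

lemma fset_finset: "finset t \<Longrightarrow> (\<And>s. memf s t \<longleftrightarrow> s < k \<and> s \<in> A) \<Longrightarrow> A \<in> fam \<Longrightarrow> fset k A = t"
  by (rule finset_eq) (auto simp: finset_fset memf_fset)

lemma finset_bounded: "finset t \<longleftrightarrow> (\<forall>u<t. \<not> (\<forall>s<t. memf s u \<longleftrightarrow> memf s t))"
  unfolding finset_def by (metis memf_less less_trans)

lemma D1_finset [definable]: "F1 \<A> f \<Longrightarrow> D1 \<A> (\<lambda>e. finset (f e))"
  by (rule D1_comp1[where R = finset], unfold finset_bounded) (intro definable)

subsection \<open>Primitive recursion\<close>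

text \<open>The course of values is an unordered finite set of pairs instead of a sequence: each
  pair is the initial one or comes from a pair of the set whose index is one less. All quantifiers
  are bounded by the code \<open>t\<close>, so the notion is recursive.\<close>

definition derivation :: "'a::rca0 \<Rightarrow> ('a \<Rightarrow> 'a \<Rightarrow> 'a) \<Rightarrow> 'a \<Rightarrow> bool" where
  "derivation a h t \<longleftrightarrow> (\<forall>p<t. memf p t \<longrightarrow>
    p = pr 0 a \<or> (\<exists>i<t. \<exists>x<t. p = pr (i + 1) (h i x) \<and> memf (pr i x) t))"

definition prec :: "'a::rca0 \<Rightarrow> ('a \<Rightarrow> 'a \<Rightarrow> 'a) \<Rightarrow> 'a \<Rightarrow> 'a" where
  "prec a h n = (THE x. \<exists>t. derivation a h t \<and> memf (pr n x) t)"

lemma F1_fun2: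
  assumes "F1 \<A> (\<lambda>e. h (\<lambda>i. e (Suc (Suc i))) (e (Suc 0)) (e 0))" "F1 \<A> f" "F1 \<A> g" "\<And>i. TM (s i)"
  shows "F1 \<A> (\<lambda>e. h (\<lambda>i. s i e) (f e) (g e))"
proof -
  let ?s = "case_nat (\<lambda>e. e 0) (case_nat (\<lambda>e. e (Suc 0)) (\<lambda>i e. s i (\<lambda>i. e (Suc (Suc i)))))"
  have TM2: "TM (\<lambda>e. t (\<lambda>i. e (Suc (Suc i))))" if "TM t" for t :: "(nat \<Rightarrow> 'a) \<Rightarrow> 'a"
    by (rule TM_subst[where s = "\<lambda>i e. e (Suc (Suc i))"]) (auto intro: TM_var that)
  have "F1 \<A> (\<lambda>e. h (\<lambda>i. ?s (Suc (Suc i)) e) (?s (Suc 0) e) (?s 0 e))"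
    by (rule F1_subst[OF assms(1)]) (intro TM_case_nat TM_var TM2 assms)
  then have "F1 \<A> (\<lambda>e. h (\<lambda>i. s i (\<lambda>i. e (Suc (Suc i)))) (e (Suc 0)) (e 0))" by simp
  then have "F1 \<A> (\<lambda>e. h (\<lambda>i. s i (\<lambda>i. e (Suc i))) (e 0) (g (\<lambda>i. e (Suc i))))"
    by (rule F1_let[where g = "\<lambda>e y. h (\<lambda>i. s i (\<lambda>i. e (Suc i))) (e 0) y"]) (rule F1_shift[OF assms(3)])
  then show ?thesis
    by (rule F1_let[where g = "\<lambda>e x. h (\<lambda>i. s i e) x (g e)"]) (rule assms(2))
qed

lemma F1_param2:
  assumes "F1 \<A> (\<lambda>e. h (\<lambda>i. e (Suc (Suc i))) (e (Suc 0)) (e 0))"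
  shows "F1 \<A> (\<lambda>e. h f (e (Suc 0)) (e 0))"
  using F1_fun2[OF assms, where s = "\<lambda>i e. f i" and f = "\<lambda>e. e (Suc 0)" and g = "\<lambda>e. e 0"] by (simp add: F1_const F1_var TM_const)

lemma D1_derivation:
  assumes "F1 \<A> a" "F1 \<A> (\<lambda>e. h (\<lambda>i. e (Suc (Suc i))) (e (Suc 0)) (e 0))" "F1 \<A> t"
  shows "D1 \<A> (\<lambda>e. derivation (a e) (h e) (t e))"
  unfolding derivation_def
  by (intro definable F1_subst[OF assms(1)] F1_subst[OF assms(3)] assms(3) F1_fun2[OF assms(2)] TM_var)

lemma derivation_iff:
  "derivation a h t \<longleftrightarrow> (\<forall>p. memf p t \<longrightarrow> p = pr 0 a \<or> (\<exists>i x. p = pr (i + 1) (h i x) \<and> memf (pr i x) t))"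
proof -
  have "memf p t \<Longrightarrow> p < t" "memf (pr i x) t \<Longrightarrow> i < t \<and> x < t" for p i x
    by (auto dest: memf_less memf_pr_less)
  then show ?thesis unfolding derivation_def by metis
qed

lemma derivation_exists:
  assumes h: "F1 fam (\<lambda>e. h (e (Suc 0)) (e 0))"
  shows "\<exists>t x. derivation a h t \<and> memf (pr n x) t"
proof (rule S1_induct[where \<A> = fam and x = n])
  have "D1 fam (\<lambda>e. derivation a h (e (Suc 0)) \<and> memf (pr (e (Suc (Suc 0))) (e 0)) (e (Suc 0)))"
    by (intro definable D1_derivation h)
  then show "S1 fam (\<lambda>e. \<exists>t x. derivation a h t \<and> memf (pr (e 0) x) t)"
    by (intro S1_ex D1_S1)
  have add: "\<exists>t'. \<forall>p. memf p t' \<longleftrightarrow> memf p t \<or> p = q" for t q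
  proof -
    have A: "{p. memf p t \<or> p = q} \<in> fam" by (rule comprehension[where \<A> = fam]) (intro definable)
    have "memf p (fset (t + q + 1) {p. memf p t \<or> p = q}) \<longleftrightarrow> memf p t \<or> p = q" for p
      unfolding memf_fset[OF A] using memf_less[of p t] by (auto intro: add_increasing2 order_less_imp_le add_increasing)
    then show ?thesis by blast
  qed
  obtain t where "\<forall>p. memf p t \<longleftrightarrow> memf p 0 \<or> p = pr 0 a" using add by blast
  then have "derivation a h t \<and> memf (pr 0 a) t"
    using memf_less[of _ 0] by (auto simp: derivation_iff)
  then show "\<exists>t x. derivation a h t \<and> memf (pr 0 x) t" by blast
  fix n assume "\<exists>t x. derivation a h t \<and> memf (pr n x) t"
  then obtain t x where t: "derivation a h t" "memf (pr n x) t" by blast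
  obtain t' where "\<forall>p. memf p t' \<longleftrightarrow> memf p t \<or> p = pr (n + 1) (h n x)" using add by blast
  then have "derivation a h t' \<and> memf (pr (n + 1) (h n x)) t'"
    using t unfolding derivation_iff by blast
  then show "\<exists>t x. derivation a h t \<and> memf (pr (n + 1) x) t" by blast
qed

lemma derivation_unique:
  assumes "derivation a h t" "derivation a h t'" "memf (pr n x) t" "memf (pr n y) t'"
  shows "x = y"
proof -
  have "\<forall>x<t. \<forall>y<t'. memf (pr n x) t \<longrightarrow> memf (pr n y) t' \<longrightarrow> x = y"
  proof (rule D1_induct[where \<A> = fam and x = n])
    show "D1 fam (\<lambda>e. \<forall>x<t. \<forall>y<t'. memf (pr (e 0) x) t \<longrightarrow> memf (pr (e 0) y) t' \<longrightarrow> x = y)"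
      by (intro definable)
    show "\<forall>x<t. \<forall>y<t'. memf (pr 0 x) t \<longrightarrow> memf (pr 0 y) t' \<longrightarrow> x = y"
      using assms(1,2) unfolding derivation_iff by fastforce
    fix n assume IH: "\<forall>x<t. \<forall>y<t'. memf (pr n x) t \<longrightarrow> memf (pr n y) t' \<longrightarrow> x = y"
    show "\<forall>x<t. \<forall>y<t'. memf (pr (n + 1) x) t \<longrightarrow> memf (pr (n + 1) y) t' \<longrightarrow> x = y"
    proof (intro allI impI)
      fix x y assume "memf (pr (n + 1) x) t" "memf (pr (n + 1) y) t'"
      then obtain v w where "x = h n v" "memf (pr n v) t" "y = h n w" "memf (pr n w) t'"
        using assms(1,2) unfolding derivation_iff by fastforce
      then show "x = y" using IH memf_pr_less by metis
    qed
  qed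
  then show ?thesis using assms(3,4) memf_pr_less by metis
qed

lemma prec_graph:
  assumes "F1 fam (\<lambda>e. h (e (Suc 0)) (e 0))"
  shows "y = prec a h n \<longleftrightarrow> (\<exists>t. derivation a h t \<and> memf (pr n y) t)"
proof -
  obtain t x where x: "derivation a h t" "memf (pr n x) t" using derivation_exists[OF assms] by blast
  then have "prec a h n = x"
    unfolding prec_def using derivation_unique by (intro the_equality) blast+
  then show ?thesis using x derivation_unique by blast
qed

lemma prec_0 [simp]:
  assumes "F1 fam (\<lambda>e. h (e (Suc 0)) (e 0))"
  shows "prec a h 0 = a"
proof -
  obtain t where t: "derivation a h t" "memf (pr 0 (prec a h 0)) t"
    using prec_graph[OF assms, of _ a 0] by blast
  then show ?thesis unfolding derivation_iff by fastforce
qed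

lemma prec_Suc [simp]:
  assumes "F1 fam (\<lambda>e. h (e (Suc 0)) (e 0))"
  shows "prec a h (n + 1) = h n (prec a h n)"
proof -
  obtain t where t: "derivation a h t" "memf (pr (n + 1) (prec a h (n + 1))) t"
    using prec_graph[OF assms, of _ a "n + 1"] by blast
  then obtain x where "prec a h (n + 1) = h n x" "memf (pr n x) t"
    unfolding derivation_iff by fastforce
  then show ?thesis using prec_graph[OF assms, of x a n] t(1) by blast
qed

lemma F1_prec [definable]:
  assumes "F1 \<A> a" "F1 \<A> (\<lambda>e. h (\<lambda>i. e (Suc (Suc i))) (e (Suc 0)) (e 0))" "F1 \<A> n"
  shows "F1 \<A> (\<lambda>e. prec (a e) (h e) (n e))"
proof (rule F1_graph)
  show "y = prec (a e) (h e) (n e) \<longleftrightarrow> (\<exists>t. derivation (a e) (h e) t \<and> memf (pr (n e) y) t)" for e y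
    by (rule prec_graph) (rule F1_mono[OF F1_param2[OF assms(2)]], simp)
  have "D1 \<A> (\<lambda>e. derivation (a (\<lambda>i. e (Suc (Suc i)))) (h (\<lambda>i. e (Suc (Suc i)))) (e 0))"
    by (intro D1_derivation[where h = "\<lambda>e. h (\<lambda>i. e (Suc (Suc i)))"] F1_subst[OF assms(1)]
        F1_fun2[OF assms(2)] TM_var F1_var)
  then show "S1 \<A> (\<lambda>e. \<exists>t. derivation (a (\<lambda>i. e (Suc i))) (h (\<lambda>i. e (Suc i))) t \<and> memf (pr (n (\<lambda>i. e (Suc i))) (e 0)) t)"
    by (intro S1_ex D1_S1 definable F1_subst[OF assms(3)] TM_var)
qed

subsection \<open>Counting\<close>

definition cnt :: "'a::rca0 set \<Rightarrow> 'a \<Rightarrow> 'a" where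
  "cnt A k = prec 0 (\<lambda>i c. if i \<in> A then c + 1 else c) k"

lemma F1_cnt [definable]:
  assumes "F1 \<A> k" "D1 \<A> (\<lambda>e. e 0 \<in> A (\<lambda>i. e (Suc i)))"
  shows "F1 \<A> (\<lambda>e. cnt (A e) (k e))"
  unfolding cnt_def by (intro definable assms D1_shift[OF assms(2)])

lemma cnt_0 [simp]: "A \<in> fam \<Longrightarrow> cnt A 0 = 0"
  unfolding cnt_def by (rule prec_0) (intro definable D1_mem)

lemma cnt_Suc: "A \<in> fam \<Longrightarrow> cnt A (k + 1) = (if k \<in> A then cnt A k + 1 else cnt A k)"
  unfolding cnt_def by (rule prec_Suc) (intro definable D1_mem)

lemma cnt_le: "A \<in> fam \<Longrightarrow> cnt A k \<le> k"
proof (rule D1_induct[where \<A> = fam and x = k])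
  assume A: "A \<in> fam"
  show "D1 fam (\<lambda>e. cnt A (e 0) \<le> e 0)" by (intro definable D1_mem A)
  show "cnt A 0 \<le> 0" by (simp add: A)
  show "cnt A (k + 1) \<le> k + 1" if "cnt A k \<le> k" for k
    using that by (simp add: cnt_Suc A add_increasing2)
qed

lemma cnt_mono_add:
  assumes A: "A \<in> fam"
  shows "cnt A j \<le> cnt A (j + d)"
proof (rule D1_induct[where \<A> = fam and x = d])
  show "D1 fam (\<lambda>e. cnt A j \<le> cnt A (j + e 0))" by (intro definable D1_mem A)
  show "cnt A j \<le> cnt A (j + (d + 1))" if "cnt A j \<le> cnt A (j + d)" for d
    using that cnt_Suc[OF A, of "j + d"] by (simp add: add.assoc add_increasing2)
qed simp

lemma cnt_mono: "A \<in> fam \<Longrightarrow> j \<le> k \<Longrightarrow> cnt A j \<le> cnt A k"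
  using cnt_mono_add le_iff_add[of j k] by metis

lemma cnt_strict: "A \<in> fam \<Longrightarrow> x \<in> A \<Longrightarrow> x < y \<Longrightarrow> cnt A x < cnt A y"
  using cnt_mono[of A "x + 1" y] cnt_Suc[of A x] by simp

lemma cnt_cong:
  assumes A: "A \<in> fam" and B: "B \<in> fam" and eq: "\<And>x. x < k \<Longrightarrow> x \<in> A \<longleftrightarrow> x \<in> B"
  shows "cnt A k = cnt B k"
proof -
  have "j \<le> k \<longrightarrow> cnt A j = cnt B j" for j
  proof (rule D1_induct[where \<A> = fam and x = j])
    show "D1 fam (\<lambda>e. e 0 \<le> k \<longrightarrow> cnt A (e 0) = cnt B (e 0))" by (intro definable D1_mem A B)
    show "j + 1 \<le> k \<longrightarrow> cnt A (j + 1) = cnt B (j + 1)" if "j \<le> k \<longrightarrow> cnt A j = cnt B j" for j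
      using that eq[of j] by (auto simp: cnt_Suc A B)
  qed (simp add: A B)
  then show ?thesis by blast
qed

lemma D1_Un [definable]: "D1 \<A> (\<lambda>e. f e \<in> A e) \<Longrightarrow> D1 \<A> (\<lambda>e. f e \<in> B e) \<Longrightarrow> D1 \<A> (\<lambda>e. f e \<in> A e \<union> B e)"
  unfolding Un_iff by (rule D1_disj)

lemma D1_insert [definable]: "F1 \<A> f \<Longrightarrow> F1 \<A> g \<Longrightarrow> D1 \<A> (\<lambda>e. f e \<in> A e) \<Longrightarrow> D1 \<A> (\<lambda>e. f e \<in> insert (g e) (A e))"
  unfolding insert_iff by (intro definable)

lemma D1_empty [definable]: "D1 \<A> (\<lambda>e. f e \<in> {})"
  by (simp add: D1_bool)

lemma fam_Un: "A \<in> fam \<Longrightarrow> B \<in> fam \<Longrightarrow> A \<union> B \<in> fam"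
  by (rule famI[where \<A> = fam]) (intro definable D1_mem)

lemma fam_insert: "A \<in> fam \<Longrightarrow> insert x A \<in> fam"
  by (rule famI[where \<A> = fam]) (intro definable D1_mem)

lemma fam_empty: "{} \<in> fam"
  by (rule famI[where \<A> = fam]) (intro definable)

lemma fam_UNIV: "UNIV \<in> fam"
  by (rule famI[where \<A> = fam]) (simp add: D1_bool)

lemma cnt_disjoint:
  assumes A: "A \<in> fam" and B: "B \<in> fam" and "A \<inter> B = {}"
  shows "cnt (A \<union> B) k = cnt A k + cnt B k"
proof (rule D1_induct[where \<A> = fam and x = k])
  have AB: "A \<union> B \<in> fam" by (intro fam_Un A B)
  show "D1 fam (\<lambda>e. cnt (A \<union> B) (e 0) = cnt A (e 0) + cnt B (e 0))" by (intro definable D1_mem A B)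
  show "cnt (A \<union> B) (k + 1) = cnt A (k + 1) + cnt B (k + 1)" if "cnt (A \<union> B) k = cnt A k + cnt B k" for k
    using that \<open>A \<inter> B = {}\<close> by (simp add: cnt_Suc A B AB) (auto simp: ac_simps)
  show "cnt (A \<union> B) 0 = cnt A 0 + cnt B 0" by (simp add: A B AB)
qed

lemma cnt_empty: "cnt {} k = 0"
  using cnt_disjoint[OF fam_empty fam_empty, of k] by simp

lemma cnt_singleton: "cnt {x} k = (if x < k then 1 else 0)"
proof (rule D1_induct[where \<A> = fam and x = k])
  have x: "{x} \<in> fam" by (intro fam_insert fam_empty)
  show "D1 fam (\<lambda>e. cnt {x} (e 0) = (if x < e 0 then 1 else 0))" by (intro definable)
  show "cnt {x} (k + 1) = (if x < k + 1 then 1 else 0)" if "cnt {x} k = (if x < k then 1 else 0)" for k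
    using that by (auto simp: cnt_Suc x)
  show "cnt {x} 0 = (if x < 0 then 1 else 0)" by (simp add: x)
qed

lemma cnt_insert:
  assumes A: "A \<in> fam" and "x \<notin> A" "x < k"
  shows "cnt (insert x A) k = cnt A k + 1"
  using cnt_disjoint[OF A fam_insert[OF fam_empty, of x], of k] assms by (simp add: cnt_singleton)

lemma cnt_split:
  assumes A: "A \<in> fam" and "u \<le> w"
  shows "cnt A w = cnt A u + cnt {x \<in> A. u \<le> x} w"
proof -
  have 1: "{x \<in> A. u \<le> x} \<in> fam" "{x \<in> A. x < u} \<in> fam"
    by (rule comprehension[where \<A> = fam], intro definable D1_mem A)+
  have "cnt A w = cnt ({x \<in> A. x < u} \<union> {x \<in> A. u \<le> x}) w"
    by (rule cnt_cong) (auto intro: fam_Un A 1)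
  also have "\<dots> = cnt {x \<in> A. x < u} w + cnt {x \<in> A. u \<le> x} w"
    by (rule cnt_disjoint) (auto simp: 1)
  also have "cnt {x \<in> A. x < u} w = cnt A u"
  proof -
    obtain d where d: "w = u + d" using \<open>u \<le> w\<close> le_iff_add by blast
    have "cnt {x \<in> A. x < u} (u + d) = cnt {x \<in> A. x < u} u"
    proof (rule D1_induct[where \<A> = fam and x = d])
      show "D1 fam (\<lambda>e. cnt {x \<in> A. x < u} (u + e 0) = cnt {x \<in> A. x < u} u)" by (intro definable D1_mem A)
      show "cnt {x \<in> A. x < u} (u + (d + 1)) = cnt {x \<in> A. x < u} u"
        if "cnt {x \<in> A. x < u} (u + d) = cnt {x \<in> A. x < u} u" for d
        using that cnt_Suc[OF 1(2), of "u + d"] by (simp add: add.assoc)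
    qed simp
    also have "\<dots> = cnt A u" by (rule cnt_cong) (auto simp: 1 A)
    finally show ?thesis by (simp add: d)
  qed
  finally show ?thesis .
qed

lemma cnt_value:
  assumes A: "A \<in> fam"
  shows "i < cnt A k \<longrightarrow> (\<exists>x<k. x \<in> A \<and> cnt A x = i)"
proof (rule D1_induct[where \<A> = fam and x = k])
  show "D1 fam (\<lambda>e. i < cnt A (e 0) \<longrightarrow> (\<exists>x<e 0. x \<in> A \<and> cnt A x = i))" by (intro definable D1_mem A)
  show "i < cnt A 0 \<longrightarrow> (\<exists>x<0. x \<in> A \<and> cnt A x = i)" by (simp add: A)
  show "i < cnt A (k + 1) \<longrightarrow> (\<exists>x<k+1. x \<in> A \<and> cnt A x = i)"
    if IH: "i < cnt A k \<longrightarrow> (\<exists>x<k. x \<in> A \<and> cnt A x = i)" for k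
  proof
    assume less: "i < cnt A (k + 1)"
    show "\<exists>x<k+1. x \<in> A \<and> cnt A x = i"
    proof (cases "i < cnt A k")
      case True
      then show ?thesis using IH by (auto intro: less_imp_le)
    next
      case False
      then have "k \<in> A \<and> i = cnt A k" using less by (auto simp: cnt_Suc A split: if_splits)
      then show ?thesis by auto
    qed
  qed
qed

text \<open>Induction on a bound \<open>v\<close> for the second arguments: each further element of
  \<open>B\<close> adds exactly one \<open>x\<close> to \<open>?A v\<close>, because
  \<open>R\<close> is one-to-one.\<close>

lemma cnt_bij:
  assumes A: "A \<in> fam" and B: "B \<in> fam" and R: "D1 fam (\<lambda>e. R (e 0) (e (Suc 0)))"
    and 1: "\<And>x. x < k \<Longrightarrow> x \<in> A \<Longrightarrow> \<exists>y<l. y \<in> B \<and> R x y"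
    and 2: "\<And>y. y < l \<Longrightarrow> y \<in> B \<Longrightarrow> \<exists>x<k. x \<in> A \<and> R x y"
    and inj: "\<And>x x' y y'. R x y \<Longrightarrow> R x' y' \<Longrightarrow> x = x' \<longleftrightarrow> y = y'"
  shows "cnt A k = cnt B l"
proof -
  let ?A = "\<lambda>v. {x. x \<in> A \<and> (\<exists>y<v. y \<in> B \<and> R x y)}"
  have DA: "D1 fam (\<lambda>e. f e \<in> ?A (g e))" if "F1 fam f" "F1 fam g" for f g
    by (intro definable D1_mem A B D1_comp2[OF R] that F1_subst[OF that(1)] TM_var)
  have A': "?A v \<in> fam" for v by (rule famI[where \<A> = fam]) (intro DA definable)
  have "v \<le> l \<longrightarrow> cnt (?A v) k = cnt B v" for v
  proof (rule D1_induct[where \<A> = fam and x = v])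
    show "D1 fam (\<lambda>e. e 0 \<le> l \<longrightarrow> cnt (?A (e 0)) k = cnt B (e 0))"
      by (intro DA definable D1_mem B)
    show "0 \<le> l \<longrightarrow> cnt (?A 0) k = cnt B 0" by (simp add: B cnt_empty)
    fix v assume IH: "v \<le> l \<longrightarrow> cnt (?A v) k = cnt B v"
    show "v + 1 \<le> l \<longrightarrow> cnt (?A (v + 1)) k = cnt B (v + 1)"
    proof
      assume "v + 1 \<le> l"
      then have v: "v < l" by simp
      show "cnt (?A (v + 1)) k = cnt B (v + 1)"
      proof (cases "v \<in> B")
        case True
        then obtain x where x: "x < k" "x \<in> A" "R x v" using 2 v by blast
        have "?A (v + 1) = insert x (?A v)"
          using x True inj[OF x(3)] by (auto simp: le_less)
        moreover have "x \<notin> ?A v" using inj[OF x(3)] by auto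
        ultimately show ?thesis
          using cnt_insert[OF A' _ x(1)] IH v True by (simp add: cnt_Suc B)
      next
        case False
        then have "?A (v + 1) = ?A v" by (auto simp: le_less)
        then show ?thesis using IH v False by (simp add: cnt_Suc B)
      qed
    qed
  qed
  then have "cnt (?A l) k = cnt B l" by blast
  moreover have "cnt (?A l) k = cnt A k" by (rule cnt_cong) (use 1 in \<open>auto simp: A' A\<close>)
  ultimately show ?thesis by simp
qed

text \<open>An injective \<open>h\<close> would put \<open>k + 1\<close> arguments in bijection with
  a set of numbers below \<open>k\<close>, against \<open>cnt_le\<close>. As \<open>k\<close> may be
  nonstandard, the counting is internal.\<close>

lemma pigeonhole:
  assumes h: "F1 fam (\<lambda>e. h (e 0))" and less: "\<And>i. h i < k"
  shows "\<exists>i j. i < j \<and> h i = h j"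
proof (rule ccontr)
  assume "\<not> (\<exists>i j. i < j \<and> h i = h j)"
  then have inj: "h i = h j \<longleftrightarrow> i = j" for i j by (metis linorder_neqE)
  let ?B = "{y. \<exists>i<k+1. h i = y}"
  have B: "?B \<in> fam" by (rule comprehension[where \<A> = fam]) (intro definable F1_comp1[OF h])
  have "cnt UNIV (k + 1) = cnt ?B k"
  proof (rule cnt_bij[where R = "\<lambda>i y. h i = y \<and> i < k + 1"])
    show "D1 fam (\<lambda>e. h (e 0) = e (Suc 0) \<and> e 0 < k + 1)" by (intro definable h)
  qed (use less inj B in \<open>auto simp: fam_UNIV\<close>)
  moreover have "cnt UNIV j = j" for j :: 'a
  proof (rule D1_induct[where \<A> = fam and x = j])
    show "D1 fam (\<lambda>e. cnt UNIV (e 0) = e 0)" by (intro definable D1_mem fam_UNIV)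
  qed (simp_all add: cnt_Suc fam_UNIV)
  ultimately have "k + 1 \<le> k" using cnt_le[OF B, of k] by metis
  then show False by simp
qed

definition iscard :: "'a::rca0 \<Rightarrow> 'a \<Rightarrow> bool" where
  "iscard s t \<longleftrightarrow> (\<exists>f. (\<forall>i<s. \<exists>x. memf x t \<and> memf (pr i x) f) \<and> (\<forall>x. memf x t \<longrightarrow> (\<exists>i<s. memf (pr i x) f)) \<and>
    (\<forall>i x j y. memf (pr i x) f \<and> memf (pr j y) f \<longrightarrow> (i = j \<longleftrightarrow> x = y)))"

lemma iscard_iff: "iscard s t \<longleftrightarrow> cnt {x. memf x t} t = s"
proof
  assume "iscard s t"
  then obtain f where f: "\<And>i. i < s \<Longrightarrow> \<exists>x. memf x t \<and> memf (pr i x) f"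
    "\<And>x. memf x t \<Longrightarrow> \<exists>i<s. memf (pr i x) f"
    "\<And>i x j y. memf (pr i x) f \<Longrightarrow> memf (pr j y) f \<Longrightarrow> i = j \<longleftrightarrow> x = y"
    unfolding iscard_def by blast
  have "cnt {x. memf x t} t = cnt {i. i < s} s"
  proof (rule cnt_bij[where R = "\<lambda>x i. memf (pr i x) f"])
    show "D1 fam (\<lambda>e. memf (pr (e (Suc 0)) (e 0)) f)" by (intro definable)
    show "{i. i < s} \<in> fam" by (rule comprehension[where \<A> = fam]) (intro definable)
    show "\<exists>x<t. x \<in> {x. memf x t} \<and> memf (pr y x) f" if "y < s" for y
      using f(1)[OF that] memf_less by blast
    show "x = x' \<longleftrightarrow> y = y'" if "memf (pr y x) f" "memf (pr y' x') f" for x x' y y'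
      using f(3)[OF that] by simp
  qed (use f in auto)
  also have "\<dots> = cnt UNIV s"
    by (rule cnt_cong) (auto simp: fam_UNIV intro!: comprehension[where \<A> = fam] definable)
  also have "cnt UNIV s = s"
  proof (rule D1_induct[where \<A> = fam and x = s])
    show "D1 fam (\<lambda>e. cnt UNIV (e 0) = e 0)" by (intro definable D1_mem fam_UNIV)
  qed (simp_all add: cnt_Suc fam_UNIV)
  finally show "cnt {x. memf x t} t = s" .
next
  assume s: "cnt {x. memf x t} t = s"
  let ?T = "{x. memf x t}"
  \<comment> \<open>The increasing enumeration: the index of \<open>x\<close> is the number of
    smaller elements.\<close>
  let ?F = "{p. \<exists>x<t. memf x t \<and> p = pr (cnt ?T x) x}"
  have F: "?F \<in> fam" by (rule comprehension[where \<A> = fam]) (intro definable)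
  define f where "f = fset (pr s t) ?F"
  have f: "memf (pr i x) f \<longleftrightarrow> memf x t \<and> i = cnt ?T x" for i x
  proof -
    have "pr (cnt ?T x) x < pr s t" if "memf x t"
      using cnt_strict[of ?T x t] that memf_less[OF that] unfolding s
      by (intro pr_less add_strict_mono) auto
    then show ?thesis unfolding f_def memf_fset[OF F] by (auto dest: memf_less)
  qed
  show "iscard s t"
    unfolding iscard_def
  proof (rule exI[of _ f], intro conjI allI impI)
    show "\<exists>x. memf x t \<and> memf (pr i x) f" if "i < s" for i
      using cnt_value[of ?T i t] that unfolding f s by auto
    show "\<exists>i<s. memf (pr i x) f" if "memf x t" for x
      using cnt_strict[of ?T x t] that memf_less[OF that] unfolding f s by auto
    show "i = j \<longleftrightarrow> x = y" if "memf (pr i x) f \<and> memf (pr j y) f" for i x j y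
      using that cnt_strict[of ?T x y] cnt_strict[of ?T y x] unfolding f
      by (auto intro: linorder_cases[of x y])
  qed
qed

definition xlarge :: "'a::rca0 \<Rightarrow> bool" where
  "xlarge t \<longleftrightarrow> finset t \<and> (\<exists>a. memf a t \<and> (\<forall>x. memf x t \<longrightarrow> a \<le> x) \<and> cnt {x. memf x t} t = a + 1)"

lemma xlarge_bounded:
  "xlarge t \<longleftrightarrow> finset t \<and> (\<exists>a<t. memf a t \<and> (\<forall>x<t. memf x t \<longrightarrow> a \<le> x) \<and> cnt {x. memf x t} t = a + 1)"
  unfolding xlarge_def using memf_less by blast

lemma D1_xlarge [definable]: "F1 \<A> f \<Longrightarrow> D1 \<A> (\<lambda>e. xlarge (f e))"
  by (rule D1_comp1[where R = xlarge], unfold xlarge_bounded) (intro definable)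

subsection \<open>The formulas of the theorem\<close>

lemma tm_val_pair [simp]: "tm_val std e (pair s t) = pr (tm_val std e s) (tm_val std e t)"
  by (simp add: pair_def pr_def)

lemma tm_val_num [simp]: "tm_val std e (num k) = of_nat k"
  by (induction k) (auto simp: add.commute)

lemma sat_MemF [simp]: "sat std e v (s \<^bold>\<in>\<^sub>F t) \<longleftrightarrow> memf (tm_val std e s) (tm_val std e t)"
  by (simp add: MemF_def memf_def dvd_def eval_nat_numeral)

lemma sat_FinSet [simp]: "sat std e v (FinSet t) \<longleftrightarrow> finset (tm_val std e t)"
  by (auto simp: FinSet_def finset_def eval_nat_numeral)

lemma sat_IsCard [simp]: "sat std e v (IsCard s t) \<longleftrightarrow> iscard (tm_val std e s) (tm_val std e t)"
  by (simp add: IsCard_def iscard_def eval_nat_numeral iff_conv_conj_imp)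

lemma sat_ExactlyLarge [simp]: "sat std e v (ExactlyLarge t) \<longleftrightarrow> xlarge (tm_val std e t)"
  by (auto simp: ExactlyLarge_def IsMin_def xlarge_def iscard_iff not_less)

definition infinite_set :: "'a::rca0 set \<Rightarrow> bool" where
  "infinite_set A \<longleftrightarrow> (\<forall>x. \<exists>y>x. y \<in> A)"

definition colouring :: "'a::rca0 set \<Rightarrow> bool" where
  "colouring C \<longleftrightarrow> (\<forall>p\<in>C. \<exists>x i. xlarge x \<and> i < 2 \<and> p = pr x i) \<and> (\<forall>x. xlarge x \<longrightarrow> (\<exists>!i. pr x i \<in> C))"

definition homogeneous :: "'a::rca0 set \<Rightarrow> 'a set \<Rightarrow> bool" where
  "homogeneous C L \<longleftrightarrow> (\<exists>i. \<forall>t. xlarge t \<and> (\<forall>x. memf x t \<longrightarrow> x \<in> L) \<longrightarrow> pr t i \<in> C)"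

lemma sat_RT:
  fixes e :: "nat \<Rightarrow> 'a::rca0"
  shows "sat std e v RT_exactly_large \<longleftrightarrow>
    (\<forall>A\<in>fam :: 'a set set. \<forall>C\<in>fam. infinite_set A \<and> colouring C \<longrightarrow>
      (\<exists>L\<in>fam. infinite_set L \<and> L \<subseteq> A \<and> homogeneous C L))"
proof -
  have C: "sat std e v (Colouring 0) \<longleftrightarrow> colouring (v 0)" for e :: "nat \<Rightarrow> 'a" and v
    by (simp add: Colouring_def colouring_def eval_nat_numeral Ex1_def Ball_def)
  show ?thesis
    by (simp add: RT_exactly_large_def C)
      (simp add: Infinite_def infinite_set_def Subset_def subset_iff Homogeneous_def homogeneous_def SubsetF_def eval_nat_numeral)
qed

definition tr :: "'a::rca0 \<Rightarrow> 'a \<Rightarrow> 'a \<Rightarrow> 'a" where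
  "tr e x y = pr e (pr x y)"

lemma tr_inject [simp]: "tr a b c = tr x y z \<longleftrightarrow> a = x \<and> b = y \<and> c = z"
  by (simp add: tr_def)

lemma memf_tr_less: "memf (tr e x y) d \<Longrightarrow> e < d \<and> x < d \<and> y < d"
  using memf_less[of "pr e (pr x y)" d] pr_less_imp[of e "pr x y" d] pr_less_imp[of x y d] by (auto simp: tr_def)

lemma F1_tr [definable]: "F1 \<A> f \<Longrightarrow> F1 \<A> g \<Longrightarrow> F1 \<A> h \<Longrightarrow> F1 \<A> (\<lambda>e. tr (f e) (g e) (h e))"
  unfolding tr_def by (intro definable)

text \<open>The record \<open>D\<close> is any set, not only a coded one, so that
  \<open>conv_of_step\<close> can use the union of many computations.\<close>

definition step :: "'a::rca0 set \<Rightarrow> 'a set \<Rightarrow> 'a \<Rightarrow> 'a \<Rightarrow> 'a \<Rightarrow> bool" where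
  "step X D e x y \<longleftrightarrow>
    e = pr 0 y
  \<or> e = pr 1 0 \<and> y = x
  \<or> e = pr 2 0 \<and> (\<exists>j. x = pr y j)
  \<or> e = pr 3 0 \<and> (\<exists>i. x = pr i y)
  \<or> e = pr 4 0 \<and> (\<exists>i j. x = pr i j \<and> y = i + j)
  \<or> e = pr 5 0 \<and> (\<exists>i j. x = pr i j \<and> y = i * j)
  \<or> e = pr 6 0 \<and> (\<exists>i j. x = pr i j \<and> (i < j \<and> y = 1 \<or> \<not> i < j \<and> y = 0))
  \<or> e = pr 7 0 \<and> (x \<in> X \<and> y = 1 \<or> x \<notin> X \<and> y = 0)
  \<or> (\<exists>f g z. e = pr 8 (pr f g) \<and> tr g x z \<in> D \<and> tr f z y \<in> D)
  \<or> (\<exists>f g z w. e = pr 9 (pr f g) \<and> tr f x z \<in> D \<and> tr g x w \<in> D \<and> y = pr z w)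
  \<or> (\<exists>f. e = pr 10 f \<and> tr f (pr x y) 0 \<in> D \<and> (\<forall>z<y. \<exists>w>0. tr f (pr x z) w \<in> D))"

definition computation :: "'a::rca0 set \<Rightarrow> 'a \<Rightarrow> bool" where
  "computation X d \<longleftrightarrow> (\<forall>e x y. memf (tr e x y) d \<longrightarrow> step X {p. memf p d} e x y)"

definition conv :: "'a::rca0 set \<Rightarrow> 'a \<Rightarrow> 'a \<Rightarrow> 'a \<Rightarrow> bool" where
  "conv X e x y \<longleftrightarrow> (\<exists>d. computation X d \<and> memf (tr e x y) d)"

definition jump :: "'a::rca0 set \<Rightarrow> 'a set" where
  "jump X = {e. \<exists>y. conv X e 0 y}"

definition section_of :: "'a::rca0 set \<Rightarrow> 'a \<Rightarrow> 'a set" where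
  "section_of Z n = {j. pr n j \<in> Z}"

lemma tm_val_triple [simp]:
  "tm_val std e (triple s t u) = tr (tm_val std e s) (tm_val std e t) (tm_val std e u)"
  by (simp add: triple_def tr_def)

lemma sat_Step:
  "sat std env v (Step X d e x y) \<longleftrightarrow>
    step (v X) {p. memf p (tm_val std env d)} (tm_val std env e) (tm_val std env x) (tm_val std env y)"
  by (simp add: Step_def step_def eval_nat_numeral)

lemma sat_Converges: "sat std env v (Converges X e x) \<longleftrightarrow> (\<exists>y. conv (v X) (tm_val std env e) (tm_val std env x) y)"
  by (simp add: Converges_def Computation_def sat_Step computation_def conv_def eval_nat_numeral) blast

definition jump_sequence :: "'a::rca0 set \<Rightarrow> 'a \<Rightarrow> 'a set \<Rightarrow> 'a set \<Rightarrow> bool" where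
  "jump_sequence X n W Z \<longleftrightarrow> section_of Z 0 = X \<and>
    (\<forall>i<n. section_of Z i \<in> fam \<and> section_of Z (i + 1) \<in> fam \<and> jump (section_of Z i) = section_of Z (i + 1)) \<and>
    section_of Z n = W"

lemma sat_Omega:
  fixes e :: "nat \<Rightarrow> 'a::rca0"
  shows "sat std e v Omega_jumps_exist \<longleftrightarrow>
    (\<forall>X\<in>fam :: 'a set set. \<exists>Y\<in>fam. \<forall>n. section_of Y n \<in> fam \<and> (\<exists>Z\<in>fam. jump_sequence X n (section_of Y n) Z))"
proof -
  have sec: "(\<forall>a. (a \<in> A \<longrightarrow> pr n a \<in> Z) \<and> (pr n a \<in> Z \<longrightarrow> a \<in> A)) \<longleftrightarrow> section_of Z n = A" for A Z :: "'a set" and n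
    by (auto simp: section_of_def)
  have jmp: "(\<forall>a. (a \<in> B \<longrightarrow> (\<exists>y. conv A a 0 y)) \<and> ((\<exists>y. conv A a 0 y) \<longrightarrow> a \<in> B)) \<longleftrightarrow> jump A = B" for A B :: "'a set"
    by (auto simp: jump_def)
  show ?thesis
    by (simp add: Omega_jumps_exist_def IsOmegaJump_def IsIteratedJump_def IsSection_def IsJump_def sat_Converges
        eval_nat_numeral sec jmp Bex_def jump_sequence_def)
qed

subsection \<open>Computations\<close>

lemma ex_pr1: "(\<exists>j. (x::'a::rca0) = pr y j) \<longleftrightarrow> (\<exists>j\<le>x. x = pr y j)"
  by auto

lemma ex_pr2: "(\<exists>i. (x::'a::rca0) = pr i y) \<longleftrightarrow> (\<exists>i\<le>x. x = pr i y)"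
  by auto

lemma ex_pr: "(\<exists>i j. (x::'a::rca0) = pr i j \<and> P i j) \<longleftrightarrow> (\<exists>i\<le>x. \<exists>j\<le>x. x = pr i j \<and> P i j)"
  by auto

text \<open>Components of a pair or of a recorded triple are bounded by the code, so no unbounded
  quantifier remains and \<open>step\<close> is recursive in the oracle.\<close>

lemma step_bounded:
  "step X {p. memf p d} e x y \<longleftrightarrow>
    e = pr 0 y
  \<or> e = pr 1 0 \<and> y = x
  \<or> e = pr 2 0 \<and> (\<exists>j\<le>x. x = pr y j)
  \<or> e = pr 3 0 \<and> (\<exists>i\<le>x. x = pr i y)
  \<or> e = pr 4 0 \<and> (\<exists>i\<le>x. \<exists>j\<le>x. x = pr i j \<and> y = i + j)
  \<or> e = pr 5 0 \<and> (\<exists>i\<le>x. \<exists>j\<le>x. x = pr i j \<and> y = i * j)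
  \<or> e = pr 6 0 \<and> (\<exists>i\<le>x. \<exists>j\<le>x. x = pr i j \<and> (i < j \<and> y = 1 \<or> \<not> i < j \<and> y = 0))
  \<or> e = pr 7 0 \<and> (x \<in> X \<and> y = 1 \<or> x \<notin> X \<and> y = 0)
  \<or> (\<exists>f<d. \<exists>g<d. \<exists>z<d. e = pr 8 (pr f g) \<and> memf (tr g x z) d \<and> memf (tr f z y) d)
  \<or> (\<exists>f<d. \<exists>g<d. \<exists>z<d. \<exists>w<d. e = pr 9 (pr f g) \<and> memf (tr f x z) d \<and> memf (tr g x w) d \<and> y = pr z w)
  \<or> (\<exists>f<d. e = pr 10 f \<and> memf (tr f (pr x y) 0) d \<and> (\<forall>z<y. \<exists>w<d. 0 < w \<and> memf (tr f (pr x z) w) d))"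
proof -
  have less: "memf (tr a b c) d \<Longrightarrow> a < d \<and> b < d \<and> c < d" for a b c
    by (rule memf_tr_less)
  have 8: "(\<exists>f g z. e = pr 8 (pr f g) \<and> memf (tr g x z) d \<and> memf (tr f z y) d) \<longleftrightarrow>
      (\<exists>f<d. \<exists>g<d. \<exists>z<d. e = pr 8 (pr f g) \<and> memf (tr g x z) d \<and> memf (tr f z y) d)"
    using less by blast
  have 9: "(\<exists>f g z w. e = pr 9 (pr f g) \<and> memf (tr f x z) d \<and> memf (tr g x w) d \<and> y = pr z w) \<longleftrightarrow>
      (\<exists>f<d. \<exists>g<d. \<exists>z<d. \<exists>w<d. e = pr 9 (pr f g) \<and> memf (tr f x z) d \<and> memf (tr g x w) d \<and> y = pr z w)"
    using less by blast
  have "(\<exists>w>0. memf (tr f (pr x z) w) d) \<longleftrightarrow> (\<exists>w<d. 0 < w \<and> memf (tr f (pr x z) w) d)" for f z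
    by (meson less)
  then have 10: "(\<exists>f. e = pr 10 f \<and> memf (tr f (pr x y) 0) d \<and> (\<forall>z<y. \<exists>w>0. memf (tr f (pr x z) w) d)) \<longleftrightarrow>
      (\<exists>f<d. e = pr 10 f \<and> memf (tr f (pr x y) 0) d \<and> (\<forall>z<y. \<exists>w<d. 0 < w \<and> memf (tr f (pr x z) w) d))"
    using less[of _ "pr x y" 0] by auto
  show ?thesis
    unfolding step_def mem_Collect_eq 8 9 10 ex_pr1[of x y] ex_pr2[of x y] ex_pr[of x] ..
qed

lemma D1_step:
  assumes X: "D1 \<A> (\<lambda>e. e 0 \<in> X (\<lambda>i. e (Suc i)))"
  shows "D1 \<A> (\<lambda>e. step (X (\<lambda>i. e (Suc (Suc (Suc (Suc i)))))) {p. memf p (e (Suc (Suc (Suc 0))))} (e (Suc (Suc 0))) (e (Suc 0)) (e 0))"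
proof -
  have "D1 \<A> (\<lambda>e. e (Suc 0) \<in> X (\<lambda>i. e (Suc (Suc (Suc (Suc i))))))"
    using D1_subst[OF X, of "case_nat (\<lambda>e. e (Suc 0)) (\<lambda>i e. e (Suc (Suc (Suc (Suc i)))))"]
    by (simp add: TM_case_nat TM_var)
  then show ?thesis
    unfolding step_bounded by (intro definable)
qed

lemma computation_bounded:
  "computation X d \<longleftrightarrow> (\<forall>e<d. \<forall>x<d. \<forall>y<d. memf (tr e x y) d \<longrightarrow> step X {p. memf p d} e x y)"
  unfolding computation_def by (meson memf_tr_less)

lemma D1_computation [definable]:
  assumes X: "D1 \<A> (\<lambda>e. e 0 \<in> X (\<lambda>i. e (Suc i)))" and d: "F1 \<A> d"
  shows "D1 \<A> (\<lambda>e. computation (X e) (d e))"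
proof (rule D1_let[where R = "\<lambda>e d. computation (X e) d", OF _ d], unfold computation_bounded)
  show "D1 \<A> (\<lambda>e. \<forall>x<e 0. \<forall>xa<e 0. \<forall>y<e 0. memf (tr x xa y) (e 0) \<longrightarrow>
      step (X (\<lambda>i. e (Suc i))) {p. memf p (e 0)} x xa y)"
    by (intro definable D1_step[OF X])
qed

section \<open>From Ramsey's theorem to the omega jump\<close>

text \<open>The use principle: every argument recorded in \<open>d\<close>, hence every question to
  the oracle, is smaller than the code \<open>d\<close>.\<close>

lemma computation_use:
  assumes "\<And>x. x < d \<Longrightarrow> x \<in> X \<longleftrightarrow> x \<in> X'"
  shows "computation X d \<longleftrightarrow> computation X' d"
proof -
  have "step X {p. memf p d} e x y \<longleftrightarrow> step X' {p. memf p d} e x y" if "memf (tr e x y) d" for e x y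
    using assms[of x] memf_tr_less[OF that] unfolding step_def by simp
  then show ?thesis unfolding computation_def by simp
qed

text \<open>
  For a finite set \<open>s\<close> with elements \<open>b\<^sub>1 < b\<^sub>2 < \<dots>\<close> above \<open>u\<close>, the section of \<open>approx X s n\<close> at \<open>u\<close>
  is an approximation to the \<open>n\<close>-th jump of \<open>X\<close>: computations are searched below \<open>b\<^sub>1\<close>, with the
  oracle \<open>approx X s (n - 1)\<close> at \<open>b\<^sub>1 + 1\<close>.
\<close>

definition next_in :: "'a::rca0 \<Rightarrow> 'a \<Rightarrow> 'a \<Rightarrow> bool" where
  "next_in s u v \<longleftrightarrow> memf v s \<and> u \<le> v \<and> (\<forall>x<v. u \<le> x \<longrightarrow> \<not> memf x s)"

definition approx0 :: "'a::rca0 set \<Rightarrow> 'a \<Rightarrow> 'a set" where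
  "approx0 X s = {p. \<exists>u\<le>s. \<exists>j\<le>s. p = pr u j \<and> j \<in> X}"

definition approx_step :: "'a::rca0 \<Rightarrow> 'a \<Rightarrow> 'a set" where
  "approx_step s g = {p. \<exists>u\<le>s. \<exists>j\<le>s. p = pr u j \<and> (\<exists>v<s. next_in s u v \<and>
     (\<exists>d<v. \<exists>y<d. computation {x. memf (pr (v + 1) x) g} d \<and> memf (tr j 0 y) d))}"

text \<open>Level \<open>n\<close> at \<open>u\<close> calls level \<open>n - 1\<close> at another
  place \<open>v + 1\<close>. Tabulating all places together, as pairs of \<open>u\<close> and
  \<open>j\<close>, turns this into plain primitive recursion. \<open>pr (s + 1) (s + 1)\<close>
  exceeds all pairs with \<open>u, j \<le> s\<close>.\<close>

definition approx :: "'a::rca0 set \<Rightarrow> 'a \<Rightarrow> 'a \<Rightarrow> 'a" where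
  "approx X s n = prec (fset (pr (s + 1) (s + 1)) (approx0 X s)) (\<lambda>_ g. fset (pr (s + 1) (s + 1)) (approx_step s g)) n"

lemma D1_next_in [definable]: "F1 \<A> s \<Longrightarrow> F1 \<A> u \<Longrightarrow> F1 \<A> v \<Longrightarrow> D1 \<A> (\<lambda>e. next_in (s e) (u e) (v e))"
  unfolding next_in_def by (intro definable F1_shift)

lemma D1_approx_step [definable]:
  assumes "F1 \<A> f" "F1 \<A> s" "F1 \<A> g"
  shows "D1 \<A> (\<lambda>e. f e \<in> approx_step (s e) (g e))"
  by (rule D1_comp3[where R = "\<lambda>x s g. x \<in> approx_step s g", OF _ assms]) (unfold approx_step_def, intro definable)

lemma D1_approx0 [definable]:
  assumes "X \<in> \<A>" "X \<in> fam" "F1 \<A> f" "F1 \<A> s"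
  shows "D1 \<A> (\<lambda>e. f e \<in> approx0 X (s e))"
proof (rule D1_comp2[where R = "\<lambda>x s. x \<in> approx0 X s"])
  show "D1 \<A> (\<lambda>e. e 0 \<in> approx0 X (e (Suc 0)))"
    unfolding approx0_def by (intro definable D1_mem assms)
qed (rule assms)+

lemma F1_approx [definable]:
  assumes "X \<in> \<A>" "X \<in> fam" "F1 \<A> s" "F1 \<A> n"
  shows "F1 \<A> (\<lambda>e. approx X (s e) (n e))"
  by (rule F1_comp2[where h = "approx X", OF _ assms(3,4)]) (unfold approx_def, intro definable assms)

lemma memf_approx_bounded: "u \<le> s \<Longrightarrow> j \<le> s \<Longrightarrow> pr u j < pr (s + 1) (s + 1)"
  by (intro pr_less add_strict_mono) auto

lemma approx_0:
  assumes X: "X \<in> fam" and "u \<le> s" "j \<le> s"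
  shows "memf (pr u j) (approx X s 0) \<longleftrightarrow> j \<in> X"
proof -
  have "approx0 X s \<in> fam" by (rule famI[where \<A> = fam]) (intro definable X)
  moreover have "approx X s 0 = fset (pr (s + 1) (s + 1)) (approx0 X s)"
    unfolding approx_def by (rule prec_0) (intro definable)
  ultimately show ?thesis
    using memf_approx_bounded[of u s j] assms by (auto simp: memf_fset approx0_def)
qed

lemma approx_Suc:
  assumes X: "X \<in> fam" and "u \<le> s" "j \<le> s"
  shows "memf (pr u j) (approx X s (n + 1)) \<longleftrightarrow> (\<exists>v. next_in s u v \<and>
    (\<exists>d<v. \<exists>y. computation {x. memf (pr (v + 1) x) (approx X s n)} d \<and> memf (tr j 0 y) d))"
proof -
  have "approx_step s g \<in> fam" for g by (rule famI[where \<A> = fam]) (intro definable)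
  moreover have "approx X s (n + 1) = fset (pr (s + 1) (s + 1)) (approx_step s (approx X s n))"
    unfolding approx_def by (rule prec_Suc) (intro definable)
  ultimately have "memf (pr u j) (approx X s (n + 1)) \<longleftrightarrow> (\<exists>v<s. next_in s u v \<and>
    (\<exists>d<v. \<exists>y<d. computation {x. memf (pr (v + 1) x) (approx X s n)} d \<and> memf (tr j 0 y) d))"
    using memf_approx_bounded[of u s j] assms by (auto simp: memf_fset approx_step_def)
  moreover have "next_in s u v \<Longrightarrow> v < s" for v by (auto simp: next_in_def memf_less)
  moreover have "memf (tr j 0 y) d \<Longrightarrow> y < d" for y d using memf_tr_less by blast
  ultimately show ?thesis by meson
qed

lemma next_in_unique: "next_in s u v \<Longrightarrow> next_in s u w \<Longrightarrow> v = w"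
  unfolding next_in_def by (metis linorder_neqE)

lemma next_in_exists:
  assumes "0 < cnt {x. memf x s \<and> u \<le> x} w"
  shows "\<exists>v<w. next_in s u v"
proof -
  let ?A = "{x. memf x s \<and> u \<le> x}"
  have A: "?A \<in> fam" by (rule comprehension[where \<A> = fam]) (intro definable)
  obtain x where x: "x < w" "x \<in> ?A" using cnt_value[OF A, of 0 w] assms by blast
  have "\<exists>v. v \<in> ?A \<and> (\<forall>y<v. y \<notin> ?A)"
    by (rule D1_least[where \<A> = fam and P = "\<lambda>v. v \<in> ?A" and a = x]) (intro definable, rule x(2))
  then obtain v where "v \<in> ?A" "\<forall>y<v. y \<notin> ?A" by blast
  moreover have "v \<le> x" using calculation x by (meson not_le)
  ultimately show ?thesis using x(1) unfolding next_in_def by (intro exI[of _ v]) auto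
qed

text \<open>Each level uses up one element, the first from \<open>u\<close> on, and continues behind
  it. So the \<open>n\<close>-th approximation is determined by a window below \<open>w\<close> that
  contains \<open>n\<close> elements from \<open>u\<close> on.\<close>

lemma approx_local:
  assumes X: "X \<in> fam" and "\<And>x. x < w \<Longrightarrow> memf x s \<and> u \<le> x \<longleftrightarrow> memf x s' \<and> u' \<le> x"
    and "n \<le> cnt {x. memf x s \<and> u \<le> x} w" "u \<le> s" "u' \<le> s'" "j \<le> s" "j \<le> s'"
  shows "memf (pr u j) (approx X s n) \<longleftrightarrow> memf (pr u' j) (approx X s' n)"
proof -
  let ?H = "\<lambda>n u u'. (\<forall>x<w. memf x s \<and> u \<le> x \<longleftrightarrow> memf x s' \<and> u' \<le> x) \<and> n \<le> cnt {x. memf x s \<and> u \<le> x} w"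
  have "\<forall>u\<le>s. \<forall>u'\<le>s'. \<forall>j\<le>s. j \<le> s' \<longrightarrow> ?H n u u' \<longrightarrow>
      (memf (pr u j) (approx X s n) \<longleftrightarrow> memf (pr u' j) (approx X s' n))"
  proof (rule D1_induct[where \<A> = fam and x = n])
    show "D1 fam (\<lambda>e. \<forall>u\<le>s. \<forall>u'\<le>s'. \<forall>j\<le>s. j \<le> s' \<longrightarrow> ?H (e 0) u u' \<longrightarrow>
      (memf (pr u j) (approx X s (e 0)) \<longleftrightarrow> memf (pr u' j) (approx X s' (e 0))))"
      by (intro definable X)
    show "\<forall>u\<le>s. \<forall>u'\<le>s'. \<forall>j\<le>s. j \<le> s' \<longrightarrow> ?H 0 u u' \<longrightarrow>
      (memf (pr u j) (approx X s 0) \<longleftrightarrow> memf (pr u' j) (approx X s' 0))"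
      by (simp add: approx_0 X)
    fix n assume IH: "\<forall>u\<le>s. \<forall>u'\<le>s'. \<forall>j\<le>s. j \<le> s' \<longrightarrow> ?H n u u' \<longrightarrow>
      (memf (pr u j) (approx X s n) \<longleftrightarrow> memf (pr u' j) (approx X s' n))"
    show "\<forall>u\<le>s. \<forall>u'\<le>s'. \<forall>j\<le>s. j \<le> s' \<longrightarrow> ?H (n + 1) u u' \<longrightarrow>
      (memf (pr u j) (approx X s (n + 1)) \<longleftrightarrow> memf (pr u' j) (approx X s' (n + 1)))"
    proof (intro allI impI)
      fix u u' j assume le: "u \<le> s" "u' \<le> s'" "j \<le> s" "j \<le> s'" and H: "?H (n + 1) u u'"
      then have "0 < cnt {x. memf x s \<and> u \<le> x} w"
        using le_less_trans[of 0 n "cnt {x. memf x s \<and> u \<le> x} w"] by simp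
      then obtain v where v: "v < w" "next_in s u v" using next_in_exists by blast
      have v': "next_in s' u' v"
        using v H unfolding next_in_def by (meson less_trans)
      have mem: "memf v s" "memf v s'" "u \<le> v" "u' \<le> v" using v v' by (auto simp: next_in_def)
      \<comment> \<open>Removing \<open>v\<close> still leaves \<open>n\<close> elements in the
        window, and behind \<open>v\<close> both sets coincide there.\<close>
      have "?H n (v + 1) (v + 1)"
      proof (intro conjI allI impI)
        fix x assume x: "x < w"
        show "memf x s \<and> v + 1 \<le> x \<longleftrightarrow> memf x s' \<and> v + 1 \<le> x"
          using H x mem by (metis add_one_le_iff less_imp_le order_trans)
      next
        have fam1: "{x. memf x s \<and> u \<le> x} \<in> fam" for u by (rule comprehension[where \<A> = fam]) (intro definable)
        have "memf x s \<and> u \<le> x \<longleftrightarrow> x = v \<or> memf x s \<and> v + 1 \<le> x" for x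
          using v(2) mem unfolding next_in_def
          by (cases x v rule: linorder_cases) (auto intro: order_trans less_imp_le)
        then have "{x. memf x s \<and> u \<le> x} = insert v {x. memf x s \<and> v + 1 \<le> x}" by blast
        then have "cnt {x. memf x s \<and> u \<le> x} w = cnt {x. memf x s \<and> v + 1 \<le> x} w + 1"
          using cnt_insert[OF fam1 _ v(1), of "v + 1"] by simp
        then show "n \<le> cnt {x. memf x s \<and> v + 1 \<le> x} w" using H by simp
      qed
      then have eq: "memf (pr (v + 1) x) (approx X s n) \<longleftrightarrow> memf (pr (v + 1) x) (approx X s' n)" if "x \<le> v" for x
        using IH memf_less[OF mem(1)] memf_less[OF mem(2)] that by (auto intro: order_trans less_imp_le)
      \<comment> \<open>A computation \<open>d < v\<close> asks only about numbers below
        \<open>v\<close>, where both oracles answer alike.\<close>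
      have "computation {x. memf (pr (v + 1) x) (approx X s n)} d \<longleftrightarrow>
          computation {x. memf (pr (v + 1) x) (approx X s' n)} d" if "d < v" for d
        by (rule computation_use) (use eq that in auto)
      then show "memf (pr u j) (approx X s (n + 1)) \<longleftrightarrow> memf (pr u' j) (approx X s' (n + 1))"
        unfolding approx_Suc[OF X le(1,3)] approx_Suc[OF X le(2,4)]
        using v(2) v' next_in_unique by metis
    qed
  qed
  then show ?thesis using assms by blast
qed

subsection \<open>Approximations along an infinite set\<close>

lemma cnt_unbounded:
  assumes A: "A \<in> fam" and inf: "infinite_set A"
  shows "\<exists>x. x \<in> A \<and> cnt A x = m"
proof -
  have "\<exists>w. m \<le> cnt A w" for m
  proof (rule S1_induct[where \<A> = fam and x = m])
    show "S1 fam (\<lambda>e. \<exists>w. e 0 \<le> cnt A w)" by (intro S1_ex D1_S1 definable D1_mem A)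
    fix m assume "\<exists>w. m \<le> cnt A w"
    then obtain w where w: "m \<le> cnt A w" by blast
    obtain y where y: "w < y" "y \<in> A" using inf unfolding infinite_set_def by blast
    have "m + 1 \<le> cnt A (y + 1)" using w cnt_mono[OF A less_imp_le[OF y(1)]] y(2) by (simp add: cnt_Suc A)
    then show "\<exists>w. m + 1 \<le> cnt A w" by blast
  qed auto
  then obtain w where "m + 1 \<le> cnt A w" by blast
  then show ?thesis using cnt_value[OF A, of m w] by auto
qed

lemma cnt_bounded:
  assumes A: "A \<in> fam" and "\<And>x. x \<in> A \<Longrightarrow> x < k" "\<And>x. x \<in> A \<Longrightarrow> x < l"
  shows "cnt A k = cnt A l"
proof -
  have *: "cnt A l = cnt A k" if "k \<le> l" "\<And>x. x \<in> A \<Longrightarrow> x < k" for k l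
  proof -
    have e: "{x \<in> A. k \<le> x} = {}" using that by force
    show ?thesis using cnt_split[OF A that(1)] unfolding e cnt_empty by simp
  qed
  show ?thesis using *[of k l] *[of l k] assms by (metis linear)
qed

section \<open>The colouring that compares two blocks\<close>

definition is_half :: "'a::rca0 \<Rightarrow> 'a \<Rightarrow> bool" where
  "is_half m a \<longleftrightarrow> m + m \<le> a \<and> a \<le> m + m + 1"

text \<open>
  The colour of an exactly large set \<open>{a < b\<^sub>1 < b\<^sub>2 < \<dots>}\<close> compares the approximations along \<open>b\<^sub>1, b\<^sub>2, \<dots>\<close>
  with those along \<open>b\<^bsub>m+1\<^esub>, b\<^bsub>m+2\<^esub>, \<dots>\<close>, where \<open>m\<close> is half of \<open>a\<close>.
\<close>

definition stable :: "'a::rca0 set \<Rightarrow> 'a \<Rightarrow> bool" where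
  "stable X s \<longleftrightarrow> (\<exists>a<s. \<exists>m\<le>a. \<exists>u<s. memf a s \<and> (\<forall>x<a. \<not> memf x s) \<and> is_half m a \<and>
    memf u s \<and> cnt {x. memf x s} u = m \<and>
    (\<forall>n\<le>m. \<forall>j<a. memf (pr (a + 1) j) (approx X s n) \<longleftrightarrow> memf (pr (u + 1) j) (approx X s n)))"

lemma half_exists: "\<exists>m. is_half m a"
proof -
  have "\<exists>m\<le>a. is_half m a"
  proof (rule D1_induct[where \<A> = fam and x = a])
    show "D1 fam (\<lambda>e. \<exists>m\<le>e 0. is_half m (e 0))" unfolding is_half_def by (intro definable)
    show "\<exists>m\<le>0. is_half m (0::'a)" by (simp add: is_half_def)
    fix a :: 'a assume "\<exists>m\<le>a. is_half m a"
    then obtain m where m: "m \<le> a" "m + m \<le> a" "a \<le> m + m + 1" by (auto simp: is_half_def)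
    show "\<exists>m\<le>a + 1. is_half m (a + 1)"
    proof (cases "a = m + m + 1")
      case True
      then have "is_half (m + 1) (a + 1)" by (simp add: is_half_def ac_simps)
      then show ?thesis using m(1) by (intro exI[of _ "m + 1"] conjI) simp_all
    next
      case False
      then have "a < m + m + 1" using m(3) by (rule le_neq_trans[rotated])
      then have "is_half m (a + 1)" using m(2) by (simp add: is_half_def add_increasing2)
      then show ?thesis using m(1) by (intro exI[of _ m] conjI) (simp_all add: add_increasing2)
    qed
  qed
  then show ?thesis by blast
qed

lemma half_less: "is_half m a \<Longrightarrow> n + n \<le> a \<Longrightarrow> n \<le> m"
proof (rule ccontr)
  assume m: "is_half m a" and n: "n + n \<le> a" and "\<not> n \<le> m"
  then have "m + 1 \<le> n" by simp
  then have "(m + 1) + (m + 1) \<le> n + n" by (intro add_mono)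
  also have "\<dots> \<le> m + m + 1" using m n by (auto simp: is_half_def)
  finally show False by (simp add: ac_simps)
qed

lemma half_unique: "is_half m a \<Longrightarrow> is_half m' a \<Longrightarrow> m = m'"
  using half_less[of m a m'] half_less[of m' a m] by (auto simp: is_half_def)

lemma D1_stable [definable]: "X \<in> fam \<Longrightarrow> F1 fam s \<Longrightarrow> D1 fam (\<lambda>e. stable X (s e))"
  by (rule D1_comp1[where R = "stable X"]) (unfold stable_def is_half_def, intro definable)

lemma less_double: "(c::'a::rca0) + c + (if p then 1 else 0) < (c + 1) + (c + 1)"
proof -
  have "(c + 1) + (c + 1) = c + c + 1 + 1" by (simp add: ac_simps)
  then show ?thesis by (simp only: less_add_one_iff) auto
qed

lemma double_inject:
  fixes c d :: "'a::rca0"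
  assumes "c + c + (if p then 1 else 0) = d + d + (if q then 1 else 0)"
  shows "c = d \<and> p = q"
proof -
  have *: "c + c + (if p then 1 else 0) < d + d + (if q then 1 else 0)" if "c < d" for c d :: 'a and p q
  proof -
    have "c + c + (if p then 1 else 0) < (c + 1) + (c + 1)" by (rule less_double)
    also have "\<dots> \<le> d + d" using that by (intro add_mono) auto
    also have "\<dots> \<le> d + d + (if q then 1 else 0)" by simp
    finally show ?thesis .
  qed
  have "c = d" using *[of c d p q] *[of d c q p] assms by (cases c d rule: linorder_cases) auto
  then show ?thesis using assms by (auto split: if_splits)
qed

text \<open>
  The binary number of a finite set is bounded independently of the set, as the pigeonhole principle
  requires; the divisibility codes are not suited to this.
\<close>

definition bin :: "'a::rca0 set \<Rightarrow> 'a \<Rightarrow> 'a" where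
  "bin A q = prec 0 (\<lambda>i c. c + c + (if i \<in> A then 1 else 0)) q"

definition pow2 :: "'a::rca0 \<Rightarrow> 'a" where
  "pow2 q = prec 1 (\<lambda>i c. c + c) q"

lemma F1_bin [definable]:
  assumes "F1 \<A> k" "D1 \<A> (\<lambda>e. e 0 \<in> A (\<lambda>i. e (Suc i)))"
  shows "F1 \<A> (\<lambda>e. bin (A e) (k e))"
  unfolding bin_def by (intro definable assms D1_shift[OF assms(2)])

lemma bin_rec: "A \<in> fam \<Longrightarrow> bin A 0 = 0" "A \<in> fam \<Longrightarrow> bin A (q + 1) = bin A q + bin A q + (if q \<in> A then 1 else 0)"
  unfolding bin_def by (rule prec_0, intro definable D1_mem, assumption+) (rule prec_Suc, intro definable D1_mem)

lemma pow2_rec: "pow2 0 = (1::'a::rca0)" "pow2 (q + 1) = pow2 q + pow2 (q::'a)"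
  unfolding pow2_def by (rule prec_0, intro definable) (rule prec_Suc, intro definable)

lemma bin_less:
  assumes A: "A \<in> fam"
  shows "bin A q < pow2 q"
proof (rule D1_induct[where \<A> = fam and x = q])
  show "D1 fam (\<lambda>e. bin A (e 0) < pow2 (e 0))" unfolding pow2_def by (intro definable D1_mem A)
  show "bin A (q + 1) < pow2 (q + 1)" if "bin A q < pow2 q" for q
  proof -
    have "bin A (q + 1) < (bin A q + 1) + (bin A q + 1)"
      unfolding bin_rec(2)[OF A] by (rule less_double)
    also have "\<dots> \<le> pow2 (q + 1)" unfolding pow2_rec using that by (intro add_mono) auto
    finally show ?thesis .
  qed
qed (simp add: bin_rec A pow2_rec)

lemma bin_inject:
  assumes A: "A \<in> fam" and B: "B \<in> fam" and "bin A q = bin B q"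
  shows "\<forall>i<q. i \<in> A \<longleftrightarrow> i \<in> B"
proof -
  have "bin A q = bin B q \<longrightarrow> (\<forall>i<q. i \<in> A \<longleftrightarrow> i \<in> B)"
  proof (rule D1_induct[where \<A> = fam and x = q])
    show "D1 fam (\<lambda>e. bin A (e 0) = bin B (e 0) \<longrightarrow> (\<forall>i<e 0. i \<in> A \<longleftrightarrow> i \<in> B))" by (intro definable D1_mem A B)
    show "bin A (q + 1) = bin B (q + 1) \<longrightarrow> (\<forall>i<q + 1. i \<in> A \<longleftrightarrow> i \<in> B)"
      if IH: "bin A q = bin B q \<longrightarrow> (\<forall>i<q. i \<in> A \<longleftrightarrow> i \<in> B)" for q
    proof (intro impI allI)
      fix i assume eq: "bin A (q + 1) = bin B (q + 1)" and "i < q + 1"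
      have "bin A q = bin B q \<and> (q \<in> A) = (q \<in> B)"
        by (rule double_inject) (use eq in \<open>simp only: bin_rec(2)[OF A] bin_rec(2)[OF B]\<close>)
      moreover have "i < q \<or> i = q" using \<open>i < q + 1\<close> by auto
      ultimately show "i \<in> A \<longleftrightarrow> i \<in> B" using IH by blast
    qed
  qed simp
  then show ?thesis using assms by blast
qed

section \<open>Values settled along an infinite set\<close>

context
  fixes X L :: "'a::rca0 set"
  assumes X: "X \<in> fam" and L: "L \<in> fam" and infL: "infinite_set L"
begin

lemma tail_fam: "{x \<in> L. u \<le> x} \<in> fam"
  by (rule comprehension[where \<A> = fam]) (intro definable D1_mem L)

lemma tail_infinite: "infinite_set {x \<in> L. u \<le> x}"
  unfolding infinite_set_def
proof
  fix x obtain y where "max x u < y" "y \<in> L" using infL unfolding infinite_set_def by blast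
  then show "\<exists>y>x. y \<in> {x \<in> L. u \<le> x}" by (intro exI[of _ y]) auto
qed

text \<open>The initial segment of \<open>L\<close> below \<open>w\<close> is long enough to fix the
  value: it has \<open>n\<close> elements from \<open>u\<close> on, and its code is at least
  \<open>u\<close> and \<open>j\<close>, so that the table of approximations covers them.\<close>

definition adequate :: "'a \<Rightarrow> 'a \<Rightarrow> 'a \<Rightarrow> 'a \<Rightarrow> bool" where
  "adequate n u j w \<longleftrightarrow> n \<le> cnt {x \<in> L. u \<le> x} w \<and> j \<le> fset w L \<and> u \<le> fset w L"

text \<open>The value that all adequate segments agree on. It can be stated existentially or
  universally (\<open>V_all\<close>), which makes it recursive.\<close>

definition V :: "'a \<Rightarrow> 'a \<Rightarrow> 'a \<Rightarrow> bool" where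
  "V n u j \<longleftrightarrow> (\<exists>w. adequate n u j w \<and> memf (pr u j) (approx X (fset w L) n))"

lemma D1_adequate: "D1 fam (\<lambda>e. adequate (e i) (e j) (e k) (e l))"
  unfolding adequate_def by (intro definable D1_mem L)

lemma ex_adequate: "\<exists>w>b. adequate n u j w"
proof -
  obtain x where x: "x \<in> {x \<in> L. u \<le> x}" "cnt {x \<in> L. u \<le> x} x = n"
    using cnt_unbounded[OF tail_fam tail_infinite] by blast
  obtain y where y: "max (max u j) (max b x) < y" "y \<in> L" using infL unfolding infinite_set_def by blast
  then have "memf y (fset (y + 1) L)" by (simp add: memf_fset L)
  then have "y < fset (y + 1) L" by (rule memf_less)
  moreover have "x \<le> y + 1" using y(1) by (auto intro: add_increasing2 less_imp_le)
  then have "n \<le> cnt {x \<in> L. u \<le> x} (y + 1)"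
    using x(2) cnt_mono[OF tail_fam, of x "y + 1" u] by simp
  ultimately show ?thesis
    using y(1) by (intro exI[of _ "y + 1"]) (auto simp: adequate_def)
qed

lemma adequate_eq:
  assumes "adequate n u j w" "adequate n u j w'"
  shows "memf (pr u j) (approx X (fset w L) n) \<longleftrightarrow> memf (pr u j) (approx X (fset w' L) n)"
proof (rule approx_local[OF X, where w = "min w w'"])
  show "x < min w w' \<Longrightarrow> memf x (fset w L) \<and> u \<le> x \<longleftrightarrow> memf x (fset w' L) \<and> u \<le> x" for x
    by (auto simp: memf_fset L)
  have "cnt {x. memf x (fset w L) \<and> u \<le> x} (min w w') = cnt {x \<in> L. u \<le> x} (min w w')"
    by (rule cnt_cong) (auto simp: memf_fset L tail_fam intro!: comprehension[where \<A> = fam] definable D1_mem L)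
  then show "n \<le> cnt {x. memf x (fset w L) \<and> u \<le> x} (min w w')"
    using assms by (auto simp: adequate_def min_def)
qed (use assms in \<open>auto simp: adequate_def\<close>)

lemma V_iff: "adequate n u j w \<Longrightarrow> V n u j \<longleftrightarrow> memf (pr u j) (approx X (fset w L) n)"
  unfolding V_def using adequate_eq by blast

lemma V_all: "V n u j \<longleftrightarrow> (\<forall>w. adequate n u j w \<longrightarrow> memf (pr u j) (approx X (fset w L) n))"
  using V_iff ex_adequate by blast

lemma D1_V [definable]:
  assumes "F1 fam n" "F1 fam u" "F1 fam j"
  shows "D1 fam (\<lambda>e. V (n e) (u e) (j e))"
proof -
  have *: "D1 fam (\<lambda>e. adequate (e (Suc 0)) (e (Suc (Suc 0))) (e (Suc (Suc (Suc 0)))) (e 0))"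
    "D1 fam (\<lambda>e. memf (pr (e (Suc (Suc 0))) (e (Suc (Suc (Suc 0))))) (approx X (fset (e 0) L) (e (Suc 0))))"
    by (rule D1_adequate) (intro definable D1_mem X L)
  have "S1 fam (\<lambda>e. V (e 0) (e (Suc 0)) (e (Suc (Suc 0))))"
    unfolding V_def by (intro S1_ex D1_S1 D1_conj *)
  moreover have "S1 fam (\<lambda>e. \<not> V (e 0) (e (Suc 0)) (e (Suc (Suc 0))))"
    unfolding V_all not_all not_imp by (intro S1_ex D1_S1 D1_conj D1_not *)
  ultimately have "D1 fam (\<lambda>e. V (e 0) (e (Suc 0)) (e (Suc (Suc 0))))" by (simp add: D1_def)
  then show ?thesis by (rule D1_comp3[where R = V, OF _ assms])
qed

lemma V_0: "V 0 u j \<longleftrightarrow> j \<in> X"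
proof -
  obtain w where w: "adequate 0 u j w" using ex_adequate by blast
  then show ?thesis using V_iff[OF w] approx_0[OF X] by (auto simp: adequate_def)
qed

definition next_elt :: "'a \<Rightarrow> 'a" where
  "next_elt u = (LEAST v. v \<in> L \<and> u \<le> v)"

lemma next_elt: "next_elt u \<in> L" "u \<le> next_elt u" "v \<in> L \<Longrightarrow> u \<le> v \<Longrightarrow> next_elt u \<le> v"
proof -
  obtain x where x: "x \<in> L \<and> u \<le> x" using infL less_imp_le unfolding infinite_set_def by blast
  have D: "D1 fam (\<lambda>e. e 0 \<in> L \<and> u \<le> e 0)" by (intro definable D1_mem L)
  show "next_elt u \<in> L" "u \<le> next_elt u" "v \<in> L \<Longrightarrow> u \<le> v \<Longrightarrow> next_elt u \<le> v"
    unfolding next_elt_def using Least_D1[OF D x] by blast+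
qed

lemma V_Suc:
  "V (n + 1) u j \<longleftrightarrow> (\<exists>d<next_elt u. \<exists>y. computation {x. V n (next_elt u + 1) x} d \<and> memf (tr j 0 y) d)"
proof -
  let ?v = "next_elt u"
  \<comment> \<open>\<open>w0\<close> lies beyond \<open>?v\<close>, \<open>w\<close> is adequate
    for level \<open>n\<close> behind \<open>?v\<close>, and \<open>w1\<close> for level
    \<open>n + 1\<close> at \<open>u\<close>; the segment below \<open>w1\<close> then serves both
    levels.\<close>
  obtain w0 where w0: "w0 > ?v" "adequate (n + 1) u j w0" using ex_adequate by blast
  obtain w where w: "w > w0" "adequate n (?v + 1) ?v w" using ex_adequate by blast
  obtain w1 where w1: "w1 > w" "adequate (n + 1) u j w1" using ex_adequate by blast
  let ?t = "fset w1 L"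
  have v1: "memf ?v ?t" using next_elt(1)[of u] w0 w w1(1) by (auto simp: memf_fset L)
  have "\<not> memf x ?t" if "x < ?v" "u \<le> x" for x
    using next_elt(3)[of x u] that by (auto simp: memf_fset L)
  then have nx1: "next_in ?t u ?v"
    unfolding next_in_def using v1 next_elt(2)[of u] by blast
  have ad: "adequate n (?v + 1) x w1" if "x \<le> ?v" for x
  proof -
    have "cnt {x \<in> L. ?v + 1 \<le> x} w \<le> cnt {x \<in> L. ?v + 1 \<le> x} w1"
      by (rule cnt_mono[OF tail_fam less_imp_le[OF w1(1)]])
    then show ?thesis
      using w(2) memf_less[OF v1] that by (auto simp: adequate_def)
  qed
  have "V (n + 1) u j \<longleftrightarrow> (\<exists>v. next_in ?t u v \<and>
    (\<exists>d<v. \<exists>y. computation {x. memf (pr (v + 1) x) (approx X ?t n)} d \<and> memf (tr j 0 y) d))"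
    unfolding V_iff[OF w1(2)] by (rule approx_Suc[OF X]) (use w1(2) in \<open>auto simp: adequate_def\<close>)
  also have "\<dots> \<longleftrightarrow> (\<exists>d<?v. \<exists>y. computation {x. memf (pr (?v + 1) x) (approx X ?t n)} d \<and> memf (tr j 0 y) d)"
    using nx1 next_in_unique by blast
  also have "\<dots> \<longleftrightarrow> (\<exists>d<?v. \<exists>y. computation {x. V n (?v + 1) x} d \<and> memf (tr j 0 y) d)"
  proof -
    have "computation {x. memf (pr (?v + 1) x) (approx X ?t n)} d \<longleftrightarrow> computation {x. V n (?v + 1) x} d" if "d < ?v" for d
      by (rule computation_use) (use V_iff[OF ad] that in auto)
    then show ?thesis by blast
  qed
  finally show ?thesis .
qed

text \<open>The witness consists of \<open>a\<close>, the \<open>m\<close> elements of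
  \<open>L\<close> from \<open>u\<close> up to \<open>w\<close>, and \<open>a - m\<close> elements
  of \<open>L\<close> from \<open>v\<close> on. \<open>stable\<close> compares just these two
  blocks, and by \<open>approx_local\<close> each is long enough to give the value \<open>V\<close>
  along all of \<open>L\<close>.\<close>

lemma stable_block:
  assumes a: "a \<in> L" "is_half m a" and u: "a < u" "u \<le> w" "cnt {x \<in> L. u \<le> x} w = m" and v: "w \<le> v"
  shows "\<exists>s. xlarge s \<and> (\<forall>x. memf x s \<longrightarrow> x \<in> L) \<and>
    (stable X s \<longleftrightarrow> (\<forall>n\<le>m. \<forall>j<a. V n u j \<longleftrightarrow> V n v j))"
proof -
  obtain c where c: "a = m + m + c" using a(2) le_iff_add by (auto simp: is_half_def)
  \<comment> \<open>The size of the second block: \<open>m\<close> or \<open>m + 1\<close> according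
    to the parity of \<open>a\<close>.\<close>
  define k where "k = m + c"
  have k: "a = m + k" "m \<le> k" by (simp_all add: k_def c add.assoc)
  obtain r where r: "cnt {x \<in> L. v \<le> x} r = k" using cnt_unbounded[OF tail_fam tail_infinite] by blast
  define B1 where "B1 = {x \<in> L. u \<le> x \<and> x < w}"
  define B2 where "B2 = {x \<in> L. v \<le> x \<and> x < r}"
  define S where "S = insert a (B1 \<union> B2)"
  define K where "K = a + w + r + 1"
  have fam: "B1 \<in> fam" "B2 \<in> fam"
    unfolding B1_def B2_def by (rule comprehension[where \<A> = fam], intro definable D1_mem L)+
  have S: "S \<in> fam" unfolding S_def by (intro fam_insert fam_Un fam)
  have "a < K" "w < K" "r < K" by (simp_all add: K_def add_increasing2)
  then have less: "a < K" "x < w \<Longrightarrow> x < K" "x < r \<Longrightarrow> x < K" for x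
    by (auto intro: less_trans)
  have SK: "x < K" if "x \<in> S" for x using that less by (auto simp: S_def B1_def B2_def)
  define s where "s = fset K S"
  have s: "memf x s \<longleftrightarrow> x \<in> S" for x using SK by (auto simp: s_def memf_fset S)
  have Ss: "{x. memf x s} = S" by (simp add: s)
  have aw: "a < w" using u by simp
  have cB1: "cnt B1 w = m"
    unfolding u(3)[symmetric] by (rule cnt_cong) (auto simp: fam tail_fam, auto simp: B1_def)
  have cB2: "cnt B2 r = k"
    unfolding r[symmetric] by (rule cnt_cong) (auto simp: fam tail_fam, auto simp: B2_def)
  have "a \<notin> B1 \<union> B2" using u v by (auto simp: B1_def B2_def)
  then have "cnt S K = cnt (B1 \<union> B2) K + 1"
    unfolding S_def by (intro cnt_insert fam_Un fam less)
  also have "cnt (B1 \<union> B2) K = cnt B1 K + cnt B2 K"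
    by (rule cnt_disjoint) (use v in \<open>auto simp: fam\<close>, auto simp: B1_def B2_def)
  also have "cnt B1 K = m" unfolding cB1[symmetric] by (rule cnt_bounded) (auto simp: fam, auto simp: B1_def less)
  also have "cnt B2 K = k" unfolding cB2[symmetric] by (rule cnt_bounded) (auto simp: fam, auto simp: B2_def less)
  also have "cnt S K = cnt S s" by (rule cnt_bounded) (auto simp: S SK s[symmetric] memf_less)
  finally have cS: "cnt S s = a + 1" by (simp add: k)
  have min: "a \<le> x" if "x \<in> S" for x using that u v by (auto simp: S_def B1_def B2_def)
  have "finset s" "memf a s" by (simp add: s_def finset_fset S) (simp add: s S_def)
  then have xl: "xlarge s"
    unfolding xlarge_def Ss using cS min s by blast
  have sub: "memf x s \<Longrightarrow> x \<in> L" for x using a by (auto simp: s S_def B1_def B2_def)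
  have as: "a < s" using memf_less[of a s] by (simp add: s S_def)
  have "cnt S w = cnt (insert a B1) w"
    by (rule cnt_cong) (use v in \<open>auto simp: S fam fam_insert, auto simp: S_def B2_def\<close>)
  also have "a \<notin> B1" using u by (auto simp: B1_def)
  from cnt_insert[OF fam(1) this aw] have "cnt (insert a B1) w = m + 1" by (simp add: cB1)
  finally have cSw: "cnt S w = m + 1" .
  \<comment> \<open>The last element of the first block, or \<open>a\<close> itself if
    \<open>m = 0\<close>. Since \<open>a\<close> has rank 0 in \<open>S\<close>, this element has
    rank \<open>m\<close>; the second comparison of \<open>stable\<close> starts behind it.\<close>
  then obtain b where b: "b < w" "b \<in> S" "cnt S b = m" using cnt_value[OF S, of m w] by auto
  have bmax: "x \<le> b" if "x \<in> S" "x < w" for x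
  proof (rule ccontr)
    assume "\<not> x \<le> b"
    then have "cnt S b < cnt S x" "cnt S x < cnt S w" using cnt_strict[OF S] b that by auto
    then show False using b(3) cSw by simp
  qed
  have b_unique: "x = b" if "x \<in> S" "cnt S x = m" for x
    using that b cnt_strict[OF S, of x b] cnt_strict[OF S, of b x] by (cases x b rule: linorder_cases) auto
  have a_unique: "x = a" if "x \<in> S" "\<forall>y<x. y \<notin> S" for x
    using that min[of x] by (auto simp: S_def le_less)
  have "stable X s \<longleftrightarrow> (\<forall>n\<le>m. \<forall>j<a. memf (pr (a + 1) j) (approx X s n) \<longleftrightarrow> memf (pr (b + 1) j) (approx X s n))"
  proof
    assume "stable X s"
    then obtain a' m' u' where *: "memf a' s" "\<forall>x<a'. \<not> memf x s" "is_half m' a'" "memf u' s" "cnt {x. memf x s} u' = m'"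
      "\<forall>n\<le>m'. \<forall>j<a'. memf (pr (a' + 1) j) (approx X s n) \<longleftrightarrow> memf (pr (u' + 1) j) (approx X s n)"
      unfolding stable_def by blast
    have "a' = a" using *(1,2) a_unique by (simp add: s)
    moreover have "m' = m" using *(3) a(2) half_unique calculation by blast
    moreover have "u' = b" using *(4,5) b_unique calculation by (simp add: Ss s)
    ultimately show "\<forall>n\<le>m. \<forall>j<a. memf (pr (a + 1) j) (approx X s n) \<longleftrightarrow> memf (pr (b + 1) j) (approx X s n)"
      using *(6) by blast
  next
    assume *: "\<forall>n\<le>m. \<forall>j<a. memf (pr (a + 1) j) (approx X s n) \<longleftrightarrow> memf (pr (b + 1) j) (approx X s n)"
    have "m \<le> a" by (simp add: k(1))
    moreover have "memf b s" using b(2) by (simp add: s)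
    moreover have "b < s" by (rule memf_less) fact
    moreover have "\<forall>x<a. \<not> memf x s" using min by (auto simp: s dest: leD)
    ultimately have "m \<le> a" "b < s" "memf a s" "memf b s" "\<forall>x<a. \<not> memf x s"
      using \<open>memf a s\<close> by blast+
    then show "stable X s"
      unfolding stable_def Ss using as a(2) b(3) * by blast
  qed
  moreover have "memf (pr (a + 1) j) (approx X s n) \<longleftrightarrow> V n u j" if n: "n \<le> m" and j: "j < a" for n j
  proof -
    obtain W where W: "W > w" "adequate n u j W" using ex_adequate by blast
    have eq: "memf x s \<and> a + 1 \<le> x \<longleftrightarrow> x \<in> L \<and> u \<le> x" if "x < w" for x
      using that u v by (auto simp: s S_def B1_def B2_def)
    have "memf (pr (a + 1) j) (approx X s n) \<longleftrightarrow> memf (pr u j) (approx X (fset W L) n)"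
    proof (rule approx_local[OF X, where w = w])
      show "memf x s \<and> a + 1 \<le> x \<longleftrightarrow> memf x (fset W L) \<and> u \<le> x" if "x < w" for x
        using eq[OF that] that W(1) by (auto simp: memf_fset L)
      have "cnt {x. memf x s \<and> a + 1 \<le> x} w = cnt {x \<in> L. u \<le> x} w"
      proof (rule cnt_cong)
        show "{x. memf x s \<and> a + 1 \<le> x} \<in> fam" by (rule comprehension[where \<A> = fam]) (intro definable)
      qed (use eq tail_fam in auto)
      then show "n \<le> cnt {x. memf x s \<and> a + 1 \<le> x} w" using n u(3) by simp
    qed (use W(2) as j in \<open>auto simp: adequate_def\<close>)
    then show ?thesis using V_iff[OF W(2)] by simp
  qed
  moreover have "memf (pr (b + 1) j) (approx X s n) \<longleftrightarrow> V n v j" if n: "n \<le> m" and j: "j < a" for n j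
  proof -
    obtain W where W: "W > r" "adequate n v j W" using ex_adequate by blast
    have eq: "memf x s \<and> b + 1 \<le> x \<longleftrightarrow> x \<in> L \<and> v \<le> x" if "x < r" for x
    proof
      assume x: "memf x s \<and> b + 1 \<le> x"
      then have "\<not> x < w" using bmax[of x] by (auto simp: s)
      then show "x \<in> L \<and> v \<le> x" using x aw by (auto simp: s S_def B1_def B2_def)
    next
      assume "x \<in> L \<and> v \<le> x"
      then show "memf x s \<and> b + 1 \<le> x" using that b(1) v by (auto simp: s S_def B2_def)
    qed
    have "memf (pr (b + 1) j) (approx X s n) \<longleftrightarrow> memf (pr v j) (approx X (fset W L) n)"
    proof (rule approx_local[OF X, where w = r])
      show "memf x s \<and> b + 1 \<le> x \<longleftrightarrow> memf x (fset W L) \<and> v \<le> x" if "x < r" for x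
        using eq[OF that] that W(1) by (auto simp: memf_fset L)
      have "cnt {x. memf x s \<and> b + 1 \<le> x} r = cnt {x \<in> L. v \<le> x} r"
      proof (rule cnt_cong)
        show "{x. memf x s \<and> b + 1 \<le> x} \<in> fam" by (rule comprehension[where \<A> = fam]) (intro definable)
      qed (use eq tail_fam in auto)
      then show "n \<le> cnt {x. memf x s \<and> b + 1 \<le> x} r" using n k(2) r by simp
      show "b + 1 \<le> s" using memf_less[of b s] b(2) by (simp add: s)
    qed (use W(2) as j in \<open>auto simp: adequate_def\<close>)
    then show ?thesis using V_iff[OF W(2)] by simp
  qed
  ultimately have "stable X s \<longleftrightarrow> (\<forall>n\<le>m. \<forall>j<a. V n u j \<longleftrightarrow> V n v j)" by simp
  then show ?thesis using xl sub by blast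
qed

lemma block_end: "\<exists>w. u \<le> w \<and> cnt {x \<in> L. u \<le> x} w = m"
  using cnt_unbounded[OF tail_fam[of u] tail_infinite[of u], of m] by auto

text \<open>Both starting points are compared with a third one, beyond the ends of their two
  blocks.\<close>

lemma V_stable:
  assumes hom: "\<And>s. xlarge s \<Longrightarrow> (\<And>x. memf x s \<Longrightarrow> x \<in> L) \<Longrightarrow> stable X s"
    and "a \<in> L" "n + n \<le> a" "j < a" "a < u" "a < u'"
  shows "V n u j \<longleftrightarrow> V n u' j"
proof -
  obtain m where m: "is_half m a" using half_exists by blast
  have n: "n \<le> m" by (rule half_less[OF m \<open>n + n \<le> a\<close>])
  obtain w where w: "u \<le> w" "cnt {x \<in> L. u \<le> x} w = m" using block_end by blast
  obtain w' where w': "u' \<le> w'" "cnt {x \<in> L. u' \<le> x} w' = m" using block_end by blast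
  have "V n u j \<longleftrightarrow> V n (max w w') j"
    using stable_block[OF \<open>a \<in> L\<close> m \<open>a < u\<close> w max.cobounded1[of w w']] hom n \<open>j < a\<close> by blast
  moreover have "V n u' j \<longleftrightarrow> V n (max w w') j"
    using stable_block[OF \<open>a \<in> L\<close> m \<open>a < u'\<close> w' max.cobounded2[of w' w]] hom n \<open>j < a\<close> by blast
  ultimately show ?thesis by simp
qed

lemma ex_stable: "\<exists>s. xlarge s \<and> (\<forall>x. memf x s \<longrightarrow> x \<in> L) \<and> stable X s"
proof -
  obtain a where a: "a \<in> L" using infL unfolding infinite_set_def by blast
  obtain m where m: "is_half m a" using half_exists by blast
  define w where "w = (\<lambda>v. LEAST w. v \<le> w \<and> cnt {x \<in> L. v \<le> x} w = m)"
  have D: "D1 fam (\<lambda>e. v \<le> e 0 \<and> cnt {x \<in> L. v \<le> x} (e 0) = m)" for v by (intro definable D1_mem L)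
  have w: "v \<le> w v" "cnt {x \<in> L. v \<le> x} (w v) = m" for v
    using block_end[of v m] Least_D1(1)[OF D[of v]] unfolding w_def by blast+
  have Fw: "F1 fam (\<lambda>e. w (e 0))"
    unfolding w_def by (rule F1_Least) (intro definable D1_mem L, rule block_end)
  \<comment> \<open>The starting points of consecutive blocks with \<open>m\<close> elements
    each.\<close>
  define vs where "vs = prec (a + 1) (\<lambda>_. w)"
  have vs: "vs 0 = a + 1" "vs (i + 1) = w (vs i)" for i
    unfolding vs_def by (intro prec_0 prec_Suc Fw)+
  have Fvs: "F1 fam (\<lambda>e. vs (e 0))" unfolding vs_def by (intro definable Fw)
  have mono: "vs i \<le> vs (i + d)" for i d
  proof (rule D1_induct[where \<A> = fam and x = d])
    show "D1 fam (\<lambda>e. vs i \<le> vs (i + e 0))" by (intro definable F1_comp1[OF Fvs])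
    show "vs i \<le> vs (i + (d + 1))" if "vs i \<le> vs (i + d)" for d
      using that w(1)[of "vs (i + d)"] vs(2)[of "i + d"] by (simp add: add.assoc)
  qed simp
  \<comment> \<open>All values that a set with least element \<open>a\<close> compares, collected
    into one finite set; its binary number has a bound that does not depend on
    \<open>i\<close>.\<close>
  let ?A = "\<lambda>i. {p. \<exists>n\<le>m. \<exists>j<a. p = pr n j \<and> V n (vs i) j}"
  have A: "?A i \<in> fam" for i by (rule comprehension[where \<A> = fam]) (intro definable)
  have "\<exists>i j. i < j \<and> bin (?A i) (pr (m + 1) a) = bin (?A j) (pr (m + 1) a)"
  proof (rule pigeonhole)
    show "F1 fam (\<lambda>e. bin (?A (e 0)) (pr (m + 1) a))" by (intro definable F1_comp1[OF Fvs])
    show "bin (?A i) (pr (m + 1) a) < pow2 (pr (m + 1) a)" for i by (rule bin_less[OF A])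
  qed
  then obtain i i' where i: "i < i'" "bin (?A i) (pr (m + 1) a) = bin (?A i') (pr (m + 1) a)" by blast
  have eq: "V n (vs i) j \<longleftrightarrow> V n (vs i') j" if "n \<le> m" "j < a" for n j
  proof -
    have "pr n j < pr (m + 1) a" using that by (intro pr_less add_less_le_mono) auto
    then have "pr n j \<in> ?A i \<longleftrightarrow> pr n j \<in> ?A i'" using bin_inject[OF A A i(2)] by blast
    then show ?thesis using that by auto
  qed
  obtain d where "i' = i + 1 + d" using i(1) le_iff_add[of "i + 1" i'] by auto
  then have "w (vs i) \<le> vs i'" using mono[of "i + 1" d] vs(2) by simp
  moreover have "a < vs i" using mono[of 0 i] vs(1) by simp
  ultimately show ?thesis
    using stable_block[OF a m _ w] eq by blast
qed

text \<open>Past an element \<open>a\<close> of \<open>L\<close> with \<open>n + n \<le> a\<close>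
  and \<open>j < a\<close> the value \<open>V n u j\<close> no longer depends on \<open>u\<close>.
  Hence it is correct: a computation, once found, lies below the next element of \<open>L\<close>
  from a suitable \<open>u\<close> on.\<close>

lemma omega_jump_of_stable:
  assumes hom: "\<And>s. xlarge s \<Longrightarrow> (\<And>x. memf x s \<Longrightarrow> x \<in> L) \<Longrightarrow> stable X s"
  shows "\<exists>Y\<in>fam. section_of Y 0 = X \<and> (\<forall>n. section_of Y (n + 1) = jump (section_of Y n))"
proof -
  define far where "far = (\<lambda>n j u. \<exists>a<u. a \<in> L \<and> n + n \<le> a \<and> j < a)"
  have far: "\<exists>u. far n j u" for n j
  proof -
    obtain a where "n + n + j < a" "a \<in> L" using infL unfolding infinite_set_def by blast
    moreover from this have "n + n < a" "j < a"
      using le_less_trans[of "n + n" "n + n + j" a] le_less_trans[of j "n + n + j" a] by auto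
    ultimately have "far n j (a + 1)"
      unfolding far_def by (intro exI[of _ a]) auto
    then show ?thesis by blast
  qed
  define g where "g = (\<lambda>n j. LEAST u. far n j u)"
  have Dfar: "D1 fam (\<lambda>e. far n j (e 0))" for n j unfolding far_def by (intro definable D1_mem L)
  have g: "far n j (g n j)" for n j
    using far[of n j] Least_D1(1)[OF Dfar[of n j]] unfolding g_def by blast
  define Y where "Y = {p. \<exists>n\<le>p. \<exists>j\<le>p. p = pr n j \<and> V n (g n j) j}"
  have "Y \<in> fam"
  proof -
    have "F1 fam (\<lambda>e. g (e 0) (e (Suc 0)))"
      unfolding g_def far_def by (rule F1_Least) (intro definable D1_mem L, rule far[unfolded far_def])
    note Fg = F1_comp2[where h = g, OF this]
    show ?thesis
      unfolding Y_def by (rule comprehension[where \<A> = fam]) (intro definable Fg)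
  qed
  have Y: "j \<in> section_of Y n \<longleftrightarrow> V n u j" if u: "far n j u" for n j u
  proof -
    have "j \<in> section_of Y n \<longleftrightarrow> V n (g n j) j" by (auto simp: Y_def section_of_def)
    also have "\<dots> \<longleftrightarrow> V n u j"
    proof -
      obtain a where a: "a < u" "a \<in> L" "n + n \<le> a" "j < a" using u unfolding far_def by blast
      obtain b where b: "b < g n j" "b \<in> L" "n + n \<le> b" "j < b" using g[of n j] unfolding far_def by blast
      have "V n (g n j) j \<longleftrightarrow> V n (max u (g n j)) j"
        by (rule V_stable[OF hom b(2-4)]) (use b in \<open>auto simp: less_max_iff_disj\<close>)
      also have "\<dots> \<longleftrightarrow> V n u j"
        by (rule V_stable[OF hom a(2-4)]) (use a in \<open>auto simp: less_max_iff_disj\<close>)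
      finally show ?thesis .
    qed
    finally show ?thesis .
  qed
  have sec0: "section_of Y 0 = X"
    using Y[OF g] V_0 by blast
  have "j \<in> section_of Y (n + 1) \<longleftrightarrow> j \<in> jump (section_of Y n)" for n j
  proof -
    \<comment> \<open>\<open>next_elt u\<close> belongs to \<open>L\<close> and is itself the
      element that certifies settled oracle values at \<open>next_elt u + 1\<close> for all
      arguments below it.\<close>
    have comp: "computation {x. V n (next_elt u + 1) x} d \<longleftrightarrow> computation (section_of Y n) d"
      if u: "far (n + 1) j u" and d: "d < next_elt u" for u d
    proof (rule computation_use)
      fix x assume "x < d"
      have "n + n \<le> next_elt u"
      proof -
        obtain a where "a < u" "n + 1 + (n + 1) \<le> a" using u unfolding far_def by blast
        moreover have "n + n \<le> n + 1 + (n + 1)" by (intro add_mono) simp_all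
        ultimately show ?thesis using next_elt(2)[of u] by (meson less_imp_le order_trans)
      qed
      then have "far n x (next_elt u + 1)"
        unfolding far_def using next_elt(1)[of u] \<open>x < d\<close> d by (intro exI[of _ "next_elt u"]) auto
      then show "x \<in> {x. V n (next_elt u + 1) x} \<longleftrightarrow> x \<in> section_of Y n" using Y by simp
    qed
    show ?thesis
    proof
      assume "j \<in> section_of Y (n + 1)"
      then have "V (n + 1) (g (n + 1) j) j" using Y[OF g] by blast
      then obtain d y where d: "d < next_elt (g (n + 1) j)" "computation {x. V n (next_elt (g (n + 1) j) + 1) x} d"
        "memf (tr j 0 y) d" unfolding V_Suc by blast
      then have "computation (section_of Y n) d" using comp[OF g d(1)] by blast
      then show "j \<in> jump (section_of Y n)" unfolding jump_def conv_def using d(3) by blast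
    next
      assume "j \<in> jump (section_of Y n)"
      then obtain d y where d: "computation (section_of Y n) d" "memf (tr j 0 y) d"
        unfolding jump_def conv_def by blast
      \<comment> \<open>Far enough for level \<open>n + 1\<close>, and beyond the code of the given
        computation.\<close>
      define u where "u = max (g (n + 1) j) (d + 1)"
      have u: "far (n + 1) j u"
        using g[of "n + 1" j] unfolding far_def u_def by (auto simp: less_max_iff_disj)
      have "d < u" by (simp add: u_def less_max_iff_disj)
      then have "d < next_elt u" using next_elt(2)[of u] by simp
      then have "V (n + 1) u j" unfolding V_Suc using comp[OF u] d by blast
      then show "j \<in> section_of Y (n + 1)" using Y[OF u] by blast
    qed
  qed
  then show ?thesis using \<open>Y \<in> fam\<close> sec0 by blast
qed

end

lemma fam_section: "Z \<in> fam \<Longrightarrow> section_of Z n \<in> fam"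
  unfolding section_of_def by (rule comprehension[where \<A> = fam]) (intro definable D1_mem)

theorem RT_imp_Omega:
  assumes RT: "\<And>A C :: 'a::rca0 set. A \<in> fam \<Longrightarrow> C \<in> fam \<Longrightarrow> infinite_set A \<Longrightarrow> colouring C \<Longrightarrow>
      \<exists>L\<in>fam. infinite_set L \<and> L \<subseteq> A \<and> homogeneous C L"
    and X: "X \<in> (fam :: 'a set set)"
  shows "\<exists>Y\<in>fam. \<forall>n. section_of Y n \<in> fam \<and> (\<exists>Z\<in>fam. jump_sequence X n (section_of Y n) Z)"
proof -
  let ?C = "{p. \<exists>s\<le>p. xlarge s \<and> (stable X s \<and> p = pr s 0 \<or> \<not> stable X s \<and> p = pr s 1)}"
  have "?C \<in> fam" by (rule comprehension[where \<A> = fam]) (intro definable X)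
  moreover have C: "pr s i \<in> ?C \<longleftrightarrow> xlarge s \<and> (stable X s \<and> i = 0 \<or> \<not> stable X s \<and> i = 1)" for s i by auto
  have "colouring ?C"
    unfolding colouring_def
  proof (intro conjI ballI allI impI)
    show "\<exists>x i. xlarge x \<and> i < 2 \<and> p = pr x i" if "p \<in> ?C" for p
      using that by (auto intro: zero_less_numeral)
    show "\<exists>!i. pr x i \<in> ?C" if "xlarge x" for x using that unfolding C by auto
  qed
  moreover have "infinite_set (UNIV :: 'a set)"
    unfolding infinite_set_def by (metis UNIV_I less_add_one)
  ultimately obtain L where L: "L \<in> fam" "infinite_set L" "homogeneous ?C L"
    using RT[OF fam_UNIV] by blast
  then obtain i where i: "pr s i \<in> ?C" if "xlarge s" "\<forall>x. memf x s \<longrightarrow> x \<in> L" for s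
    unfolding homogeneous_def by blast
  \<comment> \<open>A single stable set with elements in \<open>L\<close> excludes homogeneity for
    the other colour.\<close>
  have "i = 0" using ex_stable[OF X L(1,2)] i unfolding C by blast
  then have "stable X s" if "xlarge s" "\<And>x. memf x s \<Longrightarrow> x \<in> L" for s
    using i[of s] that unfolding C by auto
  then obtain Y where Y: "Y \<in> fam" "section_of Y 0 = X" "\<forall>n. section_of Y (n + 1) = jump (section_of Y n)"
    using omega_jump_of_stable[OF X L(1,2)] by blast
  \<comment> \<open>The sections of \<open>Y\<close> form a jump sequence, so \<open>Y\<close> is
    also the coding set required for each \<open>n\<close>.\<close>
  show ?thesis
    by (intro bexI[of _ Y] allI conjI) (simp_all add: jump_sequence_def Y(1,2) Y(3)[rule_format, symmetric] fam_section)
qed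

section \<open>Completeness of the computation model\<close>

lemma step_8: "step X D (pr 8 (pr f g)) x y \<longleftrightarrow> (\<exists>z. tr g x z \<in> D \<and> tr f z y \<in> D)"
  by (simp add: step_def)

lemma step_9: "step X D (pr 9 (pr f g)) x y \<longleftrightarrow> (\<exists>z w. tr f x z \<in> D \<and> tr g x w \<in> D \<and> y = pr z w)"
  by (simp add: step_def)

lemma step_10: "step X D (pr 10 f) x y \<longleftrightarrow> tr f (pr x y) 0 \<in> D \<and> (\<forall>z<y. \<exists>w>0. tr f (pr x z) w \<in> D)"
  by (simp add: step_def)

lemma step_cases:
  obtains f g where "e = pr 8 (pr f g)" | f g where "e = pr 9 (pr f g)" | f where "e = pr 10 f"
    | "\<And>f g. e \<noteq> pr 8 (pr f g)" "\<And>f g. e \<noteq> pr 9 (pr f g)" "\<And>f. e \<noteq> pr 10 f"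
  by blast

lemma step_mono:
  assumes "D \<subseteq> D'" "step X D e x y"
  shows "step X D' e x y"
proof (cases e rule: step_cases)
  case (1 f g)
  then show ?thesis using assms unfolding 1 step_8 by blast
next
  case (2 f g)
  then show ?thesis using assms unfolding 2 step_9 by blast
next
  case (3 f)
  then show ?thesis using assms unfolding 3 step_10 by blast
next
  case 4
  then show ?thesis using assms(2) unfolding step_def by simp
qed

text \<open>The union of all computations below \<open>b\<close> is a computation since
  \<open>step\<close> is monotone in the record, and the new triple can be added. Taking everything
  below a bound avoids choosing particular computations.\<close>

lemma conv_of_step:
  assumes X: "X \<in> fam" and "step X {p. \<exists>d<b. computation X d \<and> memf p d} e x y"
  shows "conv X e x y"
proof -
  let ?D = "{p. (\<exists>d<b. computation X d \<and> memf p d) \<or> p = tr e x y}"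
  have D: "?D \<in> fam" by (rule comprehension[where \<A> = fam]) (intro definable D1_mem X)
  define d where "d = fset (b + tr e x y + 1) ?D"
  have "p < b + tr e x y + 1" if "p \<in> ?D" for p
  proof -
    have "p \<le> b \<or> p \<le> tr e x y" using that by (auto dest!: memf_less)
    then show ?thesis by (auto intro: add_increasing add_increasing2)
  qed
  then have d: "memf p d \<longleftrightarrow> p \<in> ?D" for p unfolding d_def memf_fset[OF D] by blast
  have "computation X d"
    unfolding computation_def
  proof (intro allI impI)
    fix e' x' y' assume "memf (tr e' x' y') d"
    then consider d' where "d' < b" "computation X d'" "memf (tr e' x' y') d'" | "e' = e" "x' = x" "y' = y"
      unfolding d by auto
    then show "step X {p. memf p d} e' x' y'"
    proof cases
      case (1 d')
      then have "step X {p. memf p d'} e' x' y'" by (simp add: computation_def)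
      then show ?thesis by (rule step_mono[rotated]) (use 1 in \<open>auto simp: d\<close>)
    next
      case 2
      show ?thesis unfolding 2 by (rule step_mono[OF _ assms(2)]) (auto simp: d)
    qed
  qed
  then show ?thesis unfolding conv_def using d by blast
qed

lemma conv_basic:
  assumes "X \<in> fam"
  shows "conv X (pr 0 y) x y" "conv X (pr 1 0) x x" "conv X (pr 2 0) (pr i j) i" "conv X (pr 3 0) (pr i j) j"
    "conv X (pr 4 0) (pr i j) (i + j)" "conv X (pr 5 0) (pr i j) (i * j)"
    "conv X (pr 6 0) (pr i j) (if i < j then 1 else 0)" "conv X (pr 7 0) x (if x \<in> X then 1 else 0)"
  by (rule conv_of_step[OF assms, of 0], simp add: step_def)+

lemma conv_comp:
  assumes X: "X \<in> fam" and "conv X g x z" "conv X f z y"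
  shows "conv X (pr 8 (pr f g)) x y"
proof -
  obtain d d' where d: "computation X d" "memf (tr g x z) d" "computation X d'" "memf (tr f z y) d'"
    using assms unfolding conv_def by blast
  have "d < d + d' + 1" "d' < d + d' + 1" by simp_all
  then show ?thesis
    using d by (intro conv_of_step[OF X, of "d + d' + 1"]) (unfold step_8 mem_Collect_eq, blast)
qed

lemma conv_pair:
  assumes X: "X \<in> fam" and "conv X f x z" "conv X g x w"
  shows "conv X (pr 9 (pr f g)) x (pr z w)"
proof -
  obtain d d' where d: "computation X d" "memf (tr f x z) d" "computation X d'" "memf (tr g x w) d'"
    using assms unfolding conv_def by blast
  have "d < d + d' + 1" "d' < d + d' + 1" by simp_all
  then show ?thesis
    using d by (intro conv_of_step[OF X, of "d + d' + 1"]) (unfold step_9 mem_Collect_eq, blast)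
qed

text \<open>A \<open>D1\<close> predicate hides a second unbounded witness;
  \<open>collection\<close> is applied to a common bound \<open>v\<close> of both.\<close>

lemma collection_D1:
  assumes "D1 \<A> (\<lambda>e. P (e (Suc 0)) (e 0))" and "\<forall>x<a. \<exists>y. P x y"
  shows "\<exists>b. \<forall>x<a. \<exists>y<b. P x y"
proof -
  obtain Q where Q: "D0 \<A> (\<lambda>e. Q (\<lambda>i. e (Suc i)) (e 0))" "\<And>e. P (e (Suc 0)) (e 0) \<longleftrightarrow> (\<exists>y. Q e y)"
    using D1_S1[OF assms(1)] by (rule S1E) blast
  let ?s = "case_nat (\<lambda>e. e 0) (case_nat (\<lambda>e. e (Suc 0)) (case_nat (\<lambda>e. e (Suc (Suc (Suc 0)))) (\<lambda>i e. 0)))"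
  let ?e = "\<lambda>x y. case_nat y (case_nat x (\<lambda>_. 0))"
  have "D0 \<A> (\<lambda>e. Q (\<lambda>i. ?s (Suc i) e) (?s 0 e))"
    by (rule D0_subst[OF Q(1)]) (intro TM_case_nat TM_var TM_const)
  moreover have "(\<lambda>i. ?s (Suc i) e) = ?e (e (Suc (Suc (Suc 0)))) (e (Suc 0))" for e :: "nat \<Rightarrow> 'a"
    by (auto simp: fun_eq_iff split: nat.split)
  ultimately have D: "D0 \<A> (\<lambda>e. Q (?e (e (Suc (Suc (Suc 0)))) (e (Suc 0))) (e 0))" by simp
  have PQ: "P x y \<longleftrightarrow> (\<exists>z. Q (?e x y) z)" for x y using Q(2)[of "?e x y"] by simp
  have "\<exists>b. \<forall>x<a. \<exists>v<b. \<exists>y<v. \<exists>z<v. Q (?e x y) z"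
  proof (rule collection)
    show "D0 \<A> (\<lambda>e. \<exists>y<e 0. \<exists>z<e 0. Q (?e (e (Suc 0)) y) z)" by (intro D0_ex TM_var D)
    show "\<forall>x<a. \<exists>v. \<exists>y<v. \<exists>z<v. Q (?e x y) z"
      using assms(2) S1_bounds[of "\<lambda>y z. Q (?e _ y) z"] unfolding PQ by blast
  qed
  then obtain b where "\<forall>x<a. \<exists>v<b. \<exists>y<v. \<exists>z<v. Q (?e x y) z" by blast
  then show ?thesis unfolding PQ by (meson less_trans)
qed

lemma conv_mu:
  assumes X: "X \<in> fam" and "conv X f (pr x y) 0" "\<forall>z<y. \<exists>w>0. conv X f (pr x z) w"
  shows "conv X (pr 10 f) x y"
proof -
  obtain d where d: "computation X d" "memf (tr f (pr x y) 0) d" using assms unfolding conv_def by blast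
  \<comment> \<open>Each \<open>z < y\<close> has a computation of its own; collection puts them all
    below one number, as \<open>conv_of_step\<close> requires.\<close>
  have "\<exists>b. \<forall>z<y. \<exists>d<b. computation X d \<and> (\<exists>w<d. 0 < w \<and> memf (tr f (pr x z) w) d)"
  proof (rule collection_D1)
    show "D1 fam (\<lambda>e. computation X (e 0) \<and> (\<exists>w<e 0. 0 < w \<and> memf (tr f (pr x (e (Suc 0))) w) (e 0)))"
      by (intro definable D1_mem X)
    show "\<forall>z<y. \<exists>d. computation X d \<and> (\<exists>w<d. 0 < w \<and> memf (tr f (pr x z) w) d)"
      using assms(3) memf_tr_less unfolding conv_def by meson
  qed
  then obtain b where b: "\<forall>z<y. \<exists>d<b. computation X d \<and> (\<exists>w<d. 0 < w \<and> memf (tr f (pr x z) w) d)" by blast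
  let ?D = "{p. \<exists>d'<b + d + 1. computation X d' \<and> memf p d'}"
  have "d < b + d + 1" "\<And>d'. d' < b \<Longrightarrow> d' < b + d + 1" by (auto intro: add_increasing add_increasing2 less_imp_le)
  then have "tr f (pr x y) 0 \<in> ?D" "\<forall>z<y. \<exists>w>0. tr f (pr x z) w \<in> ?D"
    using d b by blast+
  then have "step X ?D (pr 10 f) x y" unfolding step_10 by blast
  then show ?thesis by (rule conv_of_step[OF X])
qed

lemma less_pr: "0 < a \<Longrightarrow> z < pr a z"
proof -
  assume "0 < a"
  then have "z < a + z" by simp
  also have "a + z \<le> (a + z) * (a + z)" by (rule le_square)
  also have "\<dots> \<le> pr a z" by (simp add: pr_def)
  finally show ?thesis .
qed

lemma index_less: "0 < a \<Longrightarrow> f < pr a (pr f g)" "0 < a \<Longrightarrow> g < pr a (pr f g)"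
  using le_less_trans[OF le_pr1 less_pr] le_less_trans[OF le_pr2 less_pr] by blast+

text \<open>Only smaller indices are consulted, so uniqueness goes by induction on the index. For
  clause 10, the zero found at the smaller value contradicts the positive value recorded there on
  the other side.\<close>

lemma step_unique:
  assumes IH: "\<And>e' x y z. e' < e \<Longrightarrow> tr e' x y \<in> D \<Longrightarrow> tr e' x z \<in> D' \<Longrightarrow> y = z"
    and 1: "step X D e x y" and 2: "step X D' e x z"
  shows "y = z"
proof -
  show ?thesis
  proof (cases e rule: step_cases)
    case (1 f g)
    then obtain a b where a: "tr g x a \<in> D" "tr f a y \<in> D" "tr g x b \<in> D'" "tr f b z \<in> D'"
      using assms by (auto simp: step_8)
    then have "a = b" using IH[of g x a b] index_less(2)[of 8 g f] 1 by simp
    then show ?thesis using IH[of f b y z] index_less(1)[of 8 f g] 1 a by simp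
  next
    case (2 f g)
    then obtain a b a' b' where a: "tr f x a \<in> D" "tr g x b \<in> D" "y = pr a b" "tr f x a' \<in> D'" "tr g x b' \<in> D'" "z = pr a' b'"
      using assms by (auto simp: step_9)
    then show ?thesis
      using IH[of f x a a'] IH[of g x b b'] index_less[of 9 f g] index_less[of 9 g f] 2 by simp
  next
    case (3 f)
    have f: "f < e" unfolding 3 by (rule less_pr) simp
    have y: "tr f (pr x y) 0 \<in> D" "\<forall>z<y. \<exists>w>0. tr f (pr x z) w \<in> D" using 1 3 by (auto simp: step_10)
    have z: "tr f (pr x z) 0 \<in> D'" "\<forall>v<z. \<exists>w>0. tr f (pr x v) w \<in> D'" using 2 3 by (auto simp: step_10)
    show ?thesis
    proof (rule linorder_cases[of y z])
      assume "y < z"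
      then obtain w where "w > 0" "tr f (pr x y) w \<in> D'" using z(2) by blast
      then show ?thesis using IH[OF f y(1)] by fastforce
    next
      assume "z < y"
      then obtain w where "w > 0" "tr f (pr x z) w \<in> D" using y(2) by blast
      then show ?thesis using IH[OF f _ z(1)] by fastforce
    qed
  next
    case 4
    with assms(2,3) show ?thesis unfolding step_def by (elim disjE) (simp_all, fastforce+)
  qed
qed

lemma conv_unique:
  assumes "conv X e x y" "conv X e x z"
  shows "y = z"
proof -
  obtain d d' where d: "computation X d" "memf (tr e x y) d" and d': "computation X d'" "memf (tr e x z) d'"
    using assms unfolding conv_def by blast
  have "\<forall>e<n. \<forall>x<d. \<forall>y<d. \<forall>z<d'. memf (tr e x y) d \<longrightarrow> memf (tr e x z) d' \<longrightarrow> y = z" for n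
  proof (rule D1_induct[where \<A> = fam and x = n])
    show "D1 fam (\<lambda>f. \<forall>e<f 0. \<forall>x<d. \<forall>y<d. \<forall>z<d'. memf (tr e x y) d \<longrightarrow> memf (tr e x z) d' \<longrightarrow> y = z)"
      by (intro definable)
    fix n assume "\<forall>e<n. \<forall>x<d. \<forall>y<d. \<forall>z<d'. memf (tr e x y) d \<longrightarrow> memf (tr e x z) d' \<longrightarrow> y = z"
    then have IH: "y = z" if "e < n" "tr e x y \<in> {p. memf p d}" "tr e x z \<in> {p. memf p d'}" for e x y z
      using that memf_tr_less[of e x y d] memf_tr_less[of e x z d'] by blast
    have "y = z" if "memf (tr n x y) d" "memf (tr n x z) d'" for x y z
    proof (rule step_unique[where D = "{p. memf p d}" and D' = "{p. memf p d'}", OF IH])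
      show "step X {p. memf p d} n x y" "step X {p. memf p d'} n x z"
        using d(1) d'(1) that unfolding computation_def by blast+
    qed
    then show "\<forall>e<n + 1. \<forall>x<d. \<forall>y<d. \<forall>z<d'. memf (tr e x y) d \<longrightarrow> memf (tr e x z) d' \<longrightarrow> y = z"
      using IH by (auto simp: le_less)
  qed simp
  from this[of "e + 1"] show ?thesis
    using d(2) d'(2) memf_tr_less[OF d(2)] memf_tr_less[OF d'(2)] by auto
qed

subsection \<open>Computable functions and relations\<close>

text \<open>Arguments have any type and \<open>inp\<close> codes them as numbers; thus assignments,
  pairs and intermediate results are treated alike.\<close>

definition Val :: "'a::rca0 set \<Rightarrow> 'a \<Rightarrow> ('b \<Rightarrow> 'a) \<Rightarrow> ('b \<Rightarrow> 'a) \<Rightarrow> bool" where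
  "Val X i inp f \<longleftrightarrow> (\<forall>a. conv X i (inp a) (f a))"

text \<open>Truth is the value 0 because clause 10 searches for a zero.\<close>

abbreviation Dec :: "'a::rca0 set \<Rightarrow> 'a \<Rightarrow> ('b \<Rightarrow> 'a) \<Rightarrow> ('b \<Rightarrow> bool) \<Rightarrow> bool" where
  "Dec X i inp P \<equiv> Val X i inp (\<lambda>a. if P a then 0 else 1)"

primrec tup :: "nat \<Rightarrow> (nat \<Rightarrow> 'a::rca0) \<Rightarrow> 'a" where
  "tup 0 e = 0"
| "tup (Suc k) e = pr (e 0) (tup k (\<lambda>i. e (Suc i)))"

text \<open>\<open>smn i x\<close> is an index of the function with constant value \<open>{i}(x)\<close>.\<close>

definition smn :: "'a::rca0 \<Rightarrow> 'a \<Rightarrow> 'a" where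
  "smn i x = pr 8 (pr i (pr 0 x))"

context
  fixes X :: "'a::rca0 set"
  assumes X: "X \<in> fam"
begin

lemma Val_comp: "Val X g inp f \<Longrightarrow> Val X h f F \<Longrightarrow> \<exists>i. Val X i inp F"
  unfolding Val_def using conv_comp[OF X] by blast

lemma Val_pair: "Val X g inp f \<Longrightarrow> Val X h inp F \<Longrightarrow> \<exists>i. Val X i inp (\<lambda>a. pr (f a) (F a))"
  unfolding Val_def using conv_pair[OF X] by blast

lemma Val_const: "\<exists>i. Val X i inp (\<lambda>a. c)"
  unfolding Val_def using conv_basic(1)[OF X] by blast

lemma Val_basic:
  "Val X (pr 2 0) (\<lambda>a. pr (f a) (g a)) f" "Val X (pr 3 0) (\<lambda>a. pr (f a) (g a)) g"
  "Val X (pr 4 0) (\<lambda>a. pr (f a) (g a)) (\<lambda>a. f a + g a)" "Val X (pr 5 0) (\<lambda>a. pr (f a) (g a)) (\<lambda>a. f a * g a)"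
  "Val X (pr 6 0) (\<lambda>a. pr (f a) (g a)) (\<lambda>a. if f a < g a then 1 else 0)"
  "Val X (pr 7 0) f (\<lambda>a. if f a \<in> X then 1 else 0)"
  by (simp_all add: Val_def conv_basic[OF X])

lemma Val_fun2:
  assumes "\<exists>i. Val X i inp f" "\<exists>i. Val X i inp g" "Val X h (\<lambda>a. pr (f a) (g a)) F"
  shows "\<exists>i. Val X i inp F"
  using assms Val_pair Val_comp by blast

lemma Dec_not:
  assumes "\<exists>i. Dec X i inp P"
  shows "\<exists>i. Dec X i inp (\<lambda>a. \<not> P a)"
proof -
  \<comment> \<open>Asking whether the truth value is less than 1 interchanges 0 and 1.\<close>
  have "Dec X (pr 6 0) (\<lambda>a. pr (if P a then 0 else 1) 1) (\<lambda>a. \<not> P a)"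
    using Val_basic(5)[of "\<lambda>a. if P a then 0 else 1" "\<lambda>a. 1"] unfolding Val_def
    by (auto split: if_splits)
  then show ?thesis by (rule Val_fun2[OF assms Val_const])
qed

lemma Dec_if:
  assumes "\<exists>i. Val X i inp (\<lambda>a. if P a then 1 else 0)"
  shows "\<exists>i. Dec X i inp P"
proof -
  have "(\<lambda>a. if P a then 1 else 0) = (\<lambda>a. if \<not> P a then 0 else (1::'a))" by auto
  with assms have "\<exists>i. Dec X i inp (\<lambda>a. \<not> P a)" by metis
  from Dec_not[OF this] show ?thesis by simp
qed

lemma Dec_less:
  assumes "\<exists>i. Val X i inp f" "\<exists>i. Val X i inp g"
  shows "\<exists>i. Dec X i inp (\<lambda>a. f a < g a)"
  by (rule Dec_if) (rule Val_fun2[OF assms Val_basic(5)])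

lemma Dec_conj:
  assumes P: "\<exists>i. Dec X i inp P" and Q: "\<exists>i. Dec X i inp Q"
  shows "\<exists>i. Dec X i inp (\<lambda>a. P a \<and> Q a)"
proof -
  let ?v = "\<lambda>P a. if P a then 0 else (1::'a)"
  have "\<exists>i. Val X i inp (\<lambda>a. ?v P a + ?v Q a)" by (rule Val_fun2[OF P Q Val_basic(3)])
  from Dec_less[OF Val_const this] have "\<exists>i. Dec X i inp (\<lambda>a. 0 < ?v P a + ?v Q a)" .
  moreover have "0 < ?v P a + ?v Q a \<longleftrightarrow> \<not> (P a \<and> Q a)" for a
    by (auto simp: zero_less_iff_neq_zero)
  ultimately have "\<exists>i. Dec X i inp (\<lambda>a. \<not> (P a \<and> Q a))" by simp
  from Dec_not[OF this] show ?thesis by simp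
qed

lemma Dec_eq:
  assumes "\<exists>i. Val X i inp f" "\<exists>i. Val X i inp g"
  shows "\<exists>i. Dec X i inp (\<lambda>a. f a = g a)"
proof -
  have "\<exists>i. Dec X i inp (\<lambda>a. \<not> f a < g a \<and> \<not> g a < f a)"
    by (intro Dec_conj Dec_not Dec_less assms)
  moreover have "\<not> f a < g a \<and> \<not> g a < f a \<longleftrightarrow> f a = g a" for a by auto
  ultimately show ?thesis by simp
qed

lemma Val_mu:
  assumes "Dec X q (\<lambda>(a, y). pr (inp a) y) (\<lambda>(a, y). R a y)"
    and "\<And>a. R a (f a)" "\<And>a z. z < f a \<Longrightarrow> \<not> R a z"
  shows "Val X (pr 10 q) inp f"
  unfolding Val_def
proof
  fix a
  have q: "conv X q (pr (inp a) y) (if R a y then 0 else 1)" for y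
    using assms(1) unfolding Val_def by (auto dest: spec[of _ "(a, y)"])
  show "conv X (pr 10 q) (inp a) (f a)"
  proof (rule conv_mu[OF X])
    show "conv X q (pr (inp a) (f a)) 0" using q[of "f a"] assms(2) by simp
    show "\<forall>z<f a. \<exists>w>0. conv X q (pr (inp a) z) w"
    proof (intro allI impI)
      fix z assume "z < f a"
      then have "conv X q (pr (inp a) z) 1" using q[of z] assms(3) by simp
      then show "\<exists>w>0. conv X q (pr (inp a) z) w" by (intro exI[of _ 1]) simp
    qed
  qed
qed

lemma Val_var: "j < k \<Longrightarrow> \<exists>i. Val X i (tup k) (\<lambda>e. e j)"
proof (induction j arbitrary: k)
  case 0
  then obtain k' where k: "k = Suc k'" by (cases k) auto
  then have "Val X (pr 2 0) (tup k) (\<lambda>e. e 0)" by (simp add: Val_def conv_basic[OF X])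
  then show ?case by blast
next
  case (Suc j)
  then obtain k' where k: "k = Suc k'" "j < k'" by (cases k) auto
  then obtain i where i: "Val X i (tup k') (\<lambda>e. e j)" using Suc by blast
  have "Val X i (\<lambda>e. tup k' (\<lambda>i. e (Suc i))) (\<lambda>e. e (Suc j))"
    unfolding Val_def
  proof
    fix e :: "nat \<Rightarrow> 'a"
    show "conv X i (tup k' (\<lambda>i. e (Suc i))) (e (Suc j))"
      using i[unfolded Val_def, rule_format, of "\<lambda>i. e (Suc i)"] by simp
  qed
  moreover have "Val X (pr 3 0) (tup k) (\<lambda>e. tup k' (\<lambda>i. e (Suc i)))"
    by (simp add: Val_def conv_basic[OF X] k)
  ultimately show ?case using Val_comp by blast
qed

text \<open>Stated for all sufficiently long tuples so that two subterms can share one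
  length.\<close>

lemma TM_computable: "TM t \<Longrightarrow> \<exists>n. \<forall>k\<ge>n. \<exists>i. Val X i (tup k) t"
proof (induction rule: TM.induct)
  case (TM_var i)
  have "\<forall>k\<ge>Suc i. \<exists>j. Val X j (tup k) (\<lambda>e. e i)" using Val_var by (simp add: Suc_le_eq)
  then show ?case by blast
next
  case (TM_const c)
  show ?case using Val_const by blast
next
  case (TM_add s t)
  then obtain n m where *: "\<forall>k\<ge>n. \<exists>i. Val X i (tup k) s" "\<forall>k\<ge>m. \<exists>i. Val X i (tup k) t" by blast
  have "\<exists>i. Val X i (tup k) (\<lambda>e. s e + t e)" if "max n m \<le> k" for k
    by (rule Val_fun2[OF _ _ Val_basic(3)]) (use * that in auto)
  then show ?case by blast
next
  case (TM_mul s t)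
  then obtain n m where *: "\<forall>k\<ge>n. \<exists>i. Val X i (tup k) s" "\<forall>k\<ge>m. \<exists>i. Val X i (tup k) t" by blast
  have "\<exists>i. Val X i (tup k) (\<lambda>e. s e * t e)" if "max n m \<le> k" for k
    by (rule Val_fun2[OF _ _ Val_basic(4)]) (use * that in auto)
  then show ?case by blast
qed

lemma D0_computable: "D0 {X} P \<Longrightarrow> \<exists>n. \<forall>k\<ge>n. \<exists>i. Dec X i (tup k) P"
proof (induction rule: D0.induct)
  case (D0_eq s t)
  obtain n m where *: "\<forall>k\<ge>n. \<exists>i. Val X i (tup k) s" "\<forall>k\<ge>m. \<exists>i. Val X i (tup k) t"
    using TM_computable D0_eq by blast
  have "\<exists>i. Dec X i (tup k) (\<lambda>e. s e = t e)" if "max n m \<le> k" for k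
    by (rule Dec_eq) (use * that in auto)
  then show ?case by blast
next
  case (D0_less s t)
  obtain n m where *: "\<forall>k\<ge>n. \<exists>i. Val X i (tup k) s" "\<forall>k\<ge>m. \<exists>i. Val X i (tup k) t"
    using TM_computable D0_less by blast
  have "\<exists>i. Dec X i (tup k) (\<lambda>e. s e < t e)" if "max n m \<le> k" for k
    by (rule Dec_less) (use * that in auto)
  then show ?case by blast
next
  case (D0_mem A t)
  then obtain n where *: "\<forall>k\<ge>n. \<exists>i. Val X i (tup k) t" using TM_computable by blast
  have "\<exists>i. Dec X i (tup k) (\<lambda>e. t e \<in> X)" if "n \<le> k" for k
    by (rule Dec_if) (use * that Val_comp[OF _ Val_basic(6)] in blast)
  then show ?case using D0_mem by auto
next
  case (D0_not P)
  then show ?case using Dec_not by blast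
next
  case (D0_conj P Q)
  then obtain n m where *: "\<forall>k\<ge>n. \<exists>i. Dec X i (tup k) P" "\<forall>k\<ge>m. \<exists>i. Dec X i (tup k) Q" by blast
  have "\<exists>i. Dec X i (tup k) (\<lambda>e. P e \<and> Q e)" if "max n m \<le> k" for k
    by (rule Dec_conj) (use * that in auto)
  then show ?case by blast
next
  case (D0_ex_raw P t)
  then obtain n m where *: "\<forall>k\<ge>n. \<exists>i. Dec X i (tup k) P" "\<forall>k\<ge>m. \<exists>i. Val X i (tup k) t"
    using TM_computable by blast
  \<comment> \<open>A bounded quantifier by unbounded search: the search stops at the first witness
    or else at \<open>t e\<close>, so it always converges, and the statement holds iff it stops
    before \<open>t e\<close>.\<close>
  define f where "f = (\<lambda>e. LEAST y. \<not> (y < t e \<and> \<not> P (case_nat y e)))"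
  have D: "D1 fam (\<lambda>h. \<not> (h 0 < t e \<and> \<not> P (case_nat (h 0) e)))" for e
  proof -
    have "D1 fam (\<lambda>h. P (\<lambda>i. case_nat (\<lambda>h. h 0) (\<lambda>i h. e i) i h))"
      by (rule D1_subst[OF D1_fam[OF D1_D0[OF D0_ex_raw(1)]]]) (intro TM_case_nat TM_var TM_const)
    moreover have "(\<lambda>i. case_nat (\<lambda>h. h 0) (\<lambda>i h. e i) i h) = case_nat (h 0) e" for h :: "nat \<Rightarrow> 'a"
      by (auto simp: fun_eq_iff split: nat.split)
    ultimately show ?thesis by (intro definable) simp
  qed
  have f: "\<not> (f e < t e \<and> \<not> P (case_nat (f e) e))" "z < f e \<Longrightarrow> z < t e \<and> \<not> P (case_nat z e)" for e z
    using Least_D1[OF D[of e], of "t e"] leD unfolding f_def by blast+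
  have "\<exists>i. Dec X i (tup k) (\<lambda>e. \<exists>x<t e. P (case_nat x e))" if "max n m \<le> k" for k
  proof -
    from that have "n \<le> Suc k" "m \<le> k" by simp_all
    with * obtain p i where p: "Dec X p (tup (Suc k)) P" and i: "Val X i (tup k) t" by blast
    let ?inp = "\<lambda>(e, y). pr (tup k e) y"
    have fst: "Val X (pr 2 0) ?inp (\<lambda>(e, y). tup k e)" and snd: "Val X (pr 3 0) ?inp (\<lambda>(e, y). y)"
      by (auto simp: Val_def conv_basic[OF X])
    have "Val X i (\<lambda>(e, y). tup k e) (\<lambda>(e, y). t e)" using i by (auto simp: Val_def)
    then have t: "\<exists>i. Val X i ?inp (\<lambda>(e, y). t e)" by (rule Val_comp[OF fst])
    have "Dec X p (\<lambda>a. pr (case a of (e, y) \<Rightarrow> y) (case a of (e, y) \<Rightarrow> tup k e)) (\<lambda>(e, y). P (case_nat y e))"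
      unfolding Val_def
    proof
      fix a :: "(nat \<Rightarrow> 'a) \<times> 'a"
      obtain e y where a: "a = (e, y)" by (cases a) auto
      show "conv X p (pr (case a of (e, y) \<Rightarrow> y) (case a of (e, y) \<Rightarrow> tup k e)) (if case a of (e, y) \<Rightarrow> P (case_nat y e) then 0 else 1)"
        using p[unfolded Val_def, rule_format, of "case_nat y e"] by (simp add: a)
    qed
    then have "\<exists>i. Dec X i ?inp (\<lambda>(e, y). P (case_nat y e))"
      by (rule Val_fun2[rotated 2]) (use fst snd in blast)+
    then have "\<exists>i. Dec X i ?inp (\<lambda>a. \<not> ((case a of (e, y) \<Rightarrow> y) < (case a of (e, y) \<Rightarrow> t e) \<and> \<not> (case a of (e, y) \<Rightarrow> P (case_nat y e))))"
      by (intro Dec_not Dec_conj Dec_less t) (use snd in blast)+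
    then obtain q where "Dec X q ?inp (\<lambda>(e, y). \<not> (y < t e \<and> \<not> P (case_nat y e)))"
      by (auto simp: Val_def)
    from Val_mu[OF this f(1)] have "\<exists>i. Val X i (tup k) f" using f(2) by blast
    then have "\<exists>i. Dec X i (tup k) (\<lambda>e. f e < t e)" by (rule Dec_less) (use i in blast)
    moreover have "f e < t e \<longleftrightarrow> (\<exists>x<t e. P (case_nat x e))" for e
    proof
      assume "f e < t e"
      then show "\<exists>x<t e. P (case_nat x e)" using f(1)[of e] by blast
    next
      assume "\<exists>x<t e. P (case_nat x e)"
      then obtain x where x: "x < t e" "P (case_nat x e)" by blast
      then have "\<not> x < f e" using f(2)[of x e] by blast
      then show "f e < t e" using x(1) by simp
    qed
    ultimately show ?thesis by simp
  qed
  then show ?case by blast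
qed

lemma conv_smn: "(\<exists>y. conv X (smn i x) 0 y) \<longleftrightarrow> (\<exists>y. conv X i x y)"
proof
  assume "\<exists>y. conv X i x y"
  then show "\<exists>y. conv X (smn i x) 0 y"
    unfolding smn_def using conv_comp[OF X conv_basic(1)[OF X]] by blast
next
  assume "\<exists>y. conv X (smn i x) 0 y"
  then obtain d y where d: "computation X d" "memf (tr (smn i x) 0 y) d" by (auto simp: conv_def)
  then have "step X {p. memf p d} (smn i x) 0 y" by (simp add: computation_def)
  then obtain z where z: "memf (tr (pr 0 x) 0 z) d" "memf (tr i z y) d"
    by (auto simp: smn_def step_8)
  then have "conv X (pr 0 x) 0 z" using d by (auto simp: conv_def)
  then have "z = x" using conv_unique conv_basic(1)[OF X] by blast
  then show "\<exists>y. conv X i x y" using z(2) d(1) by (auto simp: conv_def)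
qed

text \<open>\<open>Z\<close> is the domain of a search for the witness of its defining relation. As
  the jump evaluates at 0 only, \<open>smn\<close> moves the argument into the index.\<close>

lemma jump_complete:
  assumes "S1 {X} (\<lambda>e. e 0 \<in> Z)"
  shows "\<exists>i. \<forall>x. x \<in> Z \<longleftrightarrow> smn i x \<in> jump X"
proof -
  obtain P where P: "D0 {X} (\<lambda>e. P (\<lambda>i. e (Suc i)) (e 0))" "\<And>e. e 0 \<in> Z \<longleftrightarrow> (\<exists>y. P e y)"
    using assms by (rule S1E) blast
  let ?P = "\<lambda>x y. P (case_nat x (\<lambda>_. 0)) y"
  obtain n where "\<forall>k\<ge>n. \<exists>i. Dec X i (tup k) (\<lambda>e. P (\<lambda>i. e (Suc i)) (e 0))"
    using D0_computable[OF P(1)] by blast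
  then obtain p where p: "Dec X p (tup (Suc (Suc n))) (\<lambda>e. P (\<lambda>i. e (Suc i)) (e 0))"
    by (meson le_SucI order_refl)
  let ?inp = "\<lambda>(x, y). pr x y" and ?c = "tup n (\<lambda>_. 0)"
  have fst: "Val X (pr 2 0) ?inp (\<lambda>(x, y). x)" and snd: "Val X (pr 3 0) ?inp (\<lambda>(x, y). y)"
    by (auto simp: Val_def conv_basic[OF X])
  obtain j where "Val X j ?inp (\<lambda>_. ?c)" using Val_const by blast
  from Val_pair[OF fst this] obtain j where "Val X j ?inp (\<lambda>a. pr (case a of (x, y) \<Rightarrow> x) ?c)" by blast
  from Val_pair[OF snd this]
  obtain j where j: "Val X j ?inp (\<lambda>a. pr (case a of (x, y) \<Rightarrow> y) (pr (case a of (x, y) \<Rightarrow> x) ?c))" by blast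
  have "Dec X p (\<lambda>a. pr (case a of (x, y) \<Rightarrow> y) (pr (case a of (x, y) \<Rightarrow> x) ?c)) (\<lambda>(x, y). ?P x y)"
    unfolding Val_def
  proof
    fix a :: "'a \<times> 'a"
    obtain x y where a: "a = (x, y)" by (cases a) auto
    show "conv X p (pr (case a of (x, y) \<Rightarrow> y) (pr (case a of (x, y) \<Rightarrow> x) ?c)) (if case a of (x, y) \<Rightarrow> ?P x y then 0 else 1)"
      using p[unfolded Val_def, rule_format, of "case_nat y (case_nat x (\<lambda>_. 0))"] by (simp add: a)
  qed
  from Val_comp[OF j this] obtain q where q: "Dec X q ?inp (\<lambda>(x, y). ?P x y)" by blast
  have q: "conv X q (pr x y) (if ?P x y then 0 else 1)" for x y
    using q[unfolded Val_def, rule_format, of "(x, y)"] by simp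
  have D: "D1 fam (\<lambda>h. ?P x (h 0))" for x
  proof -
    let ?s = "case_nat (\<lambda>h. h 0) (case_nat (\<lambda>h. x) (\<lambda>_ h. 0))"
    have "D1 fam (\<lambda>h. P (\<lambda>i. ?s (Suc i) h) (?s 0 h))"
      by (rule D1_subst[OF D1_fam[OF D1_D0[OF P(1)]]]) (intro TM_case_nat TM_var TM_const)
    moreover have "(\<lambda>i. ?s (Suc i) h) = case_nat x (\<lambda>_. 0)" for h :: "nat \<Rightarrow> 'a"
      by (auto simp: fun_eq_iff split: nat.split)
    ultimately show ?thesis by simp
  qed
  have "x \<in> Z \<longleftrightarrow> (\<exists>y. conv X (pr 10 q) x y)" for x
  proof
    assume "x \<in> Z"
    then obtain y where "?P x y" using P(2)[of "case_nat x (\<lambda>_. 0)"] by auto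
    then obtain y where y: "?P x y" "\<forall>z<y. \<not> ?P x z" using D1_least[OF D] by blast
    have "conv X (pr 10 q) x y"
    proof (rule conv_mu[OF X])
      show "conv X q (pr x y) 0" using q[of x y] y by simp
      show "\<forall>z<y. \<exists>w>0. conv X q (pr x z) w"
      proof (intro allI impI)
        fix z assume "z < y"
        then have "conv X q (pr x z) 1" using q[of x z] y by simp
        then show "\<exists>w>0. conv X q (pr x z) w" by (intro exI[of _ 1]) simp
      qed
    qed
    then show "\<exists>y. conv X (pr 10 q) x y" ..
  next
    assume "\<exists>y. conv X (pr 10 q) x y"
    then obtain d y where d: "computation X d" "memf (tr (pr 10 q) x y) d" by (auto simp: conv_def)
    then have "step X {p. memf p d} (pr 10 q) x y" by (simp add: computation_def)
    then have "conv X q (pr x y) 0" using d(1) by (auto simp: step_10 conv_def)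
    then have "?P x y" using conv_unique[OF q] by (metis zero_neq_one)
    then show "x \<in> Z" using P(2)[of "case_nat x (\<lambda>_. 0)"] by auto
  qed
  then have "\<forall>x. x \<in> Z \<longleftrightarrow> smn (pr 10 q) x \<in> jump X"
    using conv_smn by (simp add: jump_def)
  then show ?thesis by blast
qed

end

section \<open>Arithmetical comprehension\<close>

lemma TM_pr: "TM s \<Longrightarrow> TM t \<Longrightarrow> TM (\<lambda>e. pr (s e) (t e))"
  unfolding pr_def by (intro TM.intros)

lemma D0_trans:
  assumes "D0 \<A> P" and mem: "\<And>A. A \<in> \<A> \<Longrightarrow> A \<in> fam \<Longrightarrow> D0 \<B> (\<lambda>e. e 0 \<in> A)"
  shows "D0 \<B> P"
  using assms(1)
proof (induction rule: D0.induct)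
  case (D0_mem A t)
  show ?case using D0_subst[OF mem[OF D0_mem(1,2)], of "\<lambda>_. t"] D0_mem(3) by simp
next
  case (D0_ex_raw P t)
  then show ?case by (intro D0.D0_ex_raw)
qed (intro D0.intros; assumption)+

lemma S1_trans:
  assumes "S1 \<A> R" "\<And>A. A \<in> \<A> \<Longrightarrow> A \<in> fam \<Longrightarrow> D0 \<B> (\<lambda>e. e 0 \<in> A)"
  shows "S1 \<B> R"
  using assms(1) D0_trans[OF _ assms(2)] unfolding S1_def by blast

lemma D1_trans:
  assumes "D1 \<A> R" "\<And>A. A \<in> \<A> \<Longrightarrow> A \<in> fam \<Longrightarrow> D0 \<B> (\<lambda>e. e 0 \<in> A)"
  shows "D1 \<B> R"
  using assms(1) S1_trans[OF _ assms(2)] unfolding D1_def by blast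

definition join :: "'a::rca0 set \<Rightarrow> 'a set \<Rightarrow> 'a set" where
  "join A B = {p. \<exists>z\<le>p. p = pr 0 z \<and> z \<in> A \<or> p = pr 1 z \<and> z \<in> B}"

lemma mem_join [simp]: "pr 0 z \<in> join A B \<longleftrightarrow> z \<in> A" "pr 1 z \<in> join A B \<longleftrightarrow> z \<in> B"
  by (auto simp: join_def)

lemma fam_join: "A \<in> fam \<Longrightarrow> B \<in> fam \<Longrightarrow> join A B \<in> fam"
  unfolding join_def by (rule comprehension[where \<A> = fam]) (intro definable D1_mem)

lemma D0_join:
  assumes "A \<in> fam" "B \<in> fam"
  shows "D0 {join A B} (\<lambda>e. e 0 \<in> A)" "D0 {join A B} (\<lambda>e. e 0 \<in> B)"
proof -
  have "D0 {join A B} (\<lambda>e. pr 0 (e 0) \<in> join A B)" "D0 {join A B} (\<lambda>e. pr 1 (e 0) \<in> join A B)"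
    by (intro D0_mem TM_pr TM_var TM_const fam_join assms singletonI)+
  then show "D0 {join A B} (\<lambda>e. e 0 \<in> A)" "D0 {join A B} (\<lambda>e. e 0 \<in> B)" by simp_all
qed

text \<open>\<open>jump_complete\<close> allows one oracle, so the set parameters of a relation are
  merged by joins.\<close>

lemma D0_single: "D0 fam P \<Longrightarrow> \<exists>A\<in>fam. D0 {A} P"
proof (induction rule: D0.induct)
  case (D0_conj P Q)
  then obtain A B where AB: "A \<in> fam" "D0 {A} P" "B \<in> fam" "D0 {B} Q" by blast
  have "D0 {join A B} P" by (rule D0_trans[OF AB(2)]) (use D0_join AB in auto)
  moreover have "D0 {join A B} Q" by (rule D0_trans[OF AB(4)]) (use D0_join AB in auto)
  ultimately show ?case using D0.D0_conj fam_join AB by blast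
next
  case (D0_mem A t)
  then show ?case using D0.D0_mem[of A "{A}" t] by blast
next
  case (D0_not P)
  then show ?case using D0.D0_not by blast
next
  case (D0_ex_raw P t)
  then obtain A where "A \<in> fam" "D0 {A} P" by blast
  then show ?case using D0.D0_ex_raw[of "{A}" P t] D0_ex_raw(2) by blast
next
  case (D0_eq s t)
  then show ?case using D0.D0_eq[of s t] fam_UNIV by blast
next
  case (D0_less s t)
  then show ?case using D0.D0_less[of s t] fam_UNIV by blast
qed

lemma S1_single:
  assumes "S1 fam R"
  shows "\<exists>A\<in>fam. S1 {A} R"
  using assms D0_single unfolding S1_def by blast

lemma TM_support: "TM t \<Longrightarrow> \<exists>k. \<forall>e e'. (\<forall>i<k. e i = e' i) \<longrightarrow> t e = t e'"
proof (induction rule: TM.induct)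
  case (TM_var i)
  show ?case by (rule exI[of _ "Suc i"]) simp
next
  case (TM_add s t)
  then obtain k l where "\<forall>e e'. (\<forall>i<k. e i = e' i) \<longrightarrow> s e = s e'" "\<forall>e e'. (\<forall>i<l. e i = e' i) \<longrightarrow> t e = t e'" by blast
  then show ?case by (intro exI[of _ "max k l"]) (metis less_max_iff_disj)
next
  case (TM_mul s t)
  then obtain k l where "\<forall>e e'. (\<forall>i<k. e i = e' i) \<longrightarrow> s e = s e'" "\<forall>e e'. (\<forall>i<l. e i = e' i) \<longrightarrow> t e = t e'" by blast
  then show ?case by (intro exI[of _ "max k l"]) (metis less_max_iff_disj)
qed simp

lemma D0_support: "D0 \<A> P \<Longrightarrow> \<exists>k. \<forall>e e'. (\<forall>i<k. e i = e' i) \<longrightarrow> P e = P e'"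
proof (induction rule: D0.induct)
  case (D0_eq s t)
  obtain k l where "\<forall>e e'. (\<forall>i<k. e i = e' i) \<longrightarrow> s e = s e'" "\<forall>e e'. (\<forall>i<l. e i = e' i) \<longrightarrow> t e = t e'"
    using TM_support[OF D0_eq(1)] TM_support[OF D0_eq(2)] by blast
  then show ?case by (intro exI[of _ "max k l"]) (metis less_max_iff_disj)
next
  case (D0_less s t)
  obtain k l where "\<forall>e e'. (\<forall>i<k. e i = e' i) \<longrightarrow> s e = s e'" "\<forall>e e'. (\<forall>i<l. e i = e' i) \<longrightarrow> t e = t e'"
    using TM_support[OF D0_less(1)] TM_support[OF D0_less(2)] by blast
  then show ?case by (intro exI[of _ "max k l"]) (metis less_max_iff_disj)
next
  case (D0_mem A t)
  obtain k where "\<forall>e e'. (\<forall>i<k. e i = e' i) \<longrightarrow> t e = t e'" using TM_support[OF D0_mem(3)] by blast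
  then show ?case by metis
next
  case (D0_not P)
  then show ?case by simp
next
  case (D0_conj P Q)
  then obtain k l where "\<forall>e e'. (\<forall>i<k. e i = e' i) \<longrightarrow> P e = P e'" "\<forall>e e'. (\<forall>i<l. e i = e' i) \<longrightarrow> Q e = Q e'" by blast
  then show ?case by (intro exI[of _ "max k l"]) (metis less_max_iff_disj)
next
  case (D0_ex_raw P t)
  then obtain k l where *: "\<forall>e e'. (\<forall>i<k. e i = e' i) \<longrightarrow> P e = P e'" "\<forall>e e'. (\<forall>i<l. e i = e' i) \<longrightarrow> t e = t e'"
    using TM_support[OF D0_ex_raw(2)] D0_ex_raw(3) by blast
  show ?case
  proof (intro exI[of _ "max k l"] allI impI)
    fix e e' :: "nat \<Rightarrow> 'a" assume eq: "\<forall>i<max k l. e i = e' i"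
    have "P (case_nat x e) = P (case_nat x e')" for x
      using *(1)[rule_format, of "case_nat x e" "case_nat x e'"] eq by (simp split: nat.split)
    moreover have "t e = t e'" using *(2)[rule_format, of e e'] eq by simp
    ultimately show "(\<exists>x<t e. P (case_nat x e)) = (\<exists>x<t e'. P (case_nat x e'))" by simp
  qed
qed

text \<open>The form \<open>Suc k\<close> provides at least one variable, as the base case of
  \<open>S1_as_set\<close> needs: a set is a relation of one argument.\<close>

lemma S1_support:
  assumes "S1 \<A> R"
  shows "\<exists>k. \<forall>e e'. (\<forall>i<Suc k. e i = e' i) \<longrightarrow> R e = R e'"
proof -
  obtain P where P: "D0 \<A> (\<lambda>e. P (\<lambda>i. e (Suc i)) (e 0))" "\<And>e. R e \<longleftrightarrow> (\<exists>y. P e y)"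
    using assms by (rule S1E) blast
  obtain k where k: "\<forall>e e'. (\<forall>i<k. e i = e' i) \<longrightarrow> P (\<lambda>i. e (Suc i)) (e 0) = P (\<lambda>i. e' (Suc i)) (e' 0)"
    using D0_support[OF P(1)] by blast
  show ?thesis
  proof (intro exI[of _ k] allI impI)
    fix e e' :: "nat \<Rightarrow> 'a" assume "\<forall>i<Suc k. e i = e' i"
    then have "P e y = P e' y" for y
      using k[rule_format, of "case_nat y e" "case_nat y e'"] by (simp split: nat.split)
    then have "P e = P e'" by (rule ext)
    then show "R e = R e'" unfolding P(2) by simp
  qed
qed

lemma D0_smn: "A \<in> fam \<Longrightarrow> D0 {A} (\<lambda>e. smn i (e 0) \<in> A)"
  unfolding smn_def by (intro D0_mem TM_pr TM_var TM_const singletonI)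

context
  assumes jump_fam: "\<And>X :: 'a::rca0 set. X \<in> fam \<Longrightarrow> jump X \<in> fam"
begin

text \<open>Membership in \<open>Z\<close> reduces by \<open>smn\<close> to the jump of its single
  parameter, so \<open>Z\<close> is recursive in that jump.\<close>

lemma sigma_comprehension:
  fixes Z :: "'a set"
  assumes "S1 fam (\<lambda>e. e 0 \<in> Z)"
  shows "Z \<in> fam"
proof -
  obtain A where A: "A \<in> fam" "S1 {A} (\<lambda>e. e 0 \<in> Z)" using S1_single[OF assms] by blast
  then obtain i where i: "\<forall>x. x \<in> Z \<longleftrightarrow> smn i x \<in> jump A" using jump_complete by blast
  have "D1 {jump A} (\<lambda>e. e 0 \<in> Z)" using D1_D0[OF D0_smn[OF jump_fam[OF A(1)]]] i by simp
  then show ?thesis by (rule famI)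
qed

text \<open>Comprehension yields sets of numbers, not relations. The first two variables are
  contracted into a pair until a single one is left, and \<open>t\<close> records the
  pairing.\<close>

lemma S1_as_set:
  fixes R :: "(nat \<Rightarrow> 'a) \<Rightarrow> bool"
  assumes "S1 fam R" "\<forall>e e'. (\<forall>i<Suc k. e i = e' i) \<longrightarrow> R e = R e'"
  shows "\<exists>Z\<in>fam. \<exists>t. TM t \<and> (\<forall>e. R e \<longleftrightarrow> t e \<in> Z)"
  using assms
proof (induction k arbitrary: R)
  case 0
  have "S1 fam (\<lambda>e. R (\<lambda>i. e 0))"
    using S1_subst[OF 0(1), of "\<lambda>i e. e 0"] by (simp add: TM_var)
  then have "{x. R (\<lambda>_. x)} \<in> fam" by (intro sigma_comprehension) simp
  moreover have "R e \<longleftrightarrow> e 0 \<in> {x. R (\<lambda>_. x)}" for e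
    using 0(2)[rule_format, of e "\<lambda>_. e 0"] by simp
  ultimately show ?case using TM_var[of 0] by blast
next
  case (Suc k)
  let ?R = "\<lambda>e a b. R (case_nat a (case_nat b (\<lambda>i. e (Suc i))))"
  let ?R' = "\<lambda>e. \<exists>a b. e 0 = pr a b \<and> ?R e a b"
  have "S1 fam (\<lambda>e. ?R (\<lambda>i. e (Suc (Suc i))) (e (Suc 0)) (e 0))"
  proof -
    let ?s = "case_nat (\<lambda>e. e (Suc 0)) (case_nat (\<lambda>e. e 0) (\<lambda>i e. e (Suc (Suc (Suc i)))))"
    have "S1 fam (\<lambda>e. R (\<lambda>i. ?s i e))"
      by (rule S1_subst[OF Suc(2)]) (intro TM_case_nat TM_var)
    moreover have "(\<lambda>i. ?s i e) = case_nat (e (Suc 0)) (case_nat (e 0) (\<lambda>i. e (Suc (Suc (Suc i)))))" for e :: "nat \<Rightarrow> 'a"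
      by (auto simp: fun_eq_iff split: nat.split)
    ultimately show ?thesis by simp
  qed
  then have S: "S1 fam ?R'" by (intro S1_ex S1_conj D1_S1[OF D1_eq] definable)
  have sup: "\<forall>e e'. (\<forall>i<Suc k. e i = e' i) \<longrightarrow> ?R' e = ?R' e'"
  proof (intro allI impI)
    fix e e' :: "nat \<Rightarrow> 'a" assume eq: "\<forall>i<Suc k. e i = e' i"
    have "?R e a b = ?R e' a b" for a b
      by (rule Suc(3)[rule_format]) (use eq in \<open>auto split: nat.split\<close>)
    then show "?R' e = ?R' e'" using eq by simp
  qed
  from Suc(1)[OF S sup] obtain Z t where Z: "Z \<in> fam" "TM t" "\<forall>e. ?R' e \<longleftrightarrow> t e \<in> Z"
    by blast
  let ?s = "case_nat (\<lambda>e. pr (e 0) (e (Suc 0))) (\<lambda>i e. e (Suc (Suc i)))"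
  have "TM (\<lambda>e. t (\<lambda>i. ?s i e))"
    by (rule TM_subst[OF Z(2)]) (intro TM_case_nat TM_pr TM_var)
  moreover have "R e \<longleftrightarrow> t (\<lambda>i. ?s i e) \<in> Z" for e
  proof -
    have "case_nat (e 0) (case_nat (e (Suc 0)) (\<lambda>i. ?s (Suc i) e)) = e"
      by (auto simp: fun_eq_iff split: nat.split)
    then have "?R' (\<lambda>i. ?s i e) \<longleftrightarrow> R e" by simp
    then show ?thesis by (rule trans[OF sym Z(3)[THEN spec]])
  qed
  ultimately show ?case using Z(1) by blast
qed

text \<open>Hence arithmetical relations are already definable by bounded formulas, with suitable set parameters.\<close>

lemma D1_of_S1:
  fixes R :: "(nat \<Rightarrow> 'a) \<Rightarrow> bool"
  assumes "S1 fam R"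
  shows "D1 fam R"
proof -
  obtain k where "\<forall>e e'. (\<forall>i<Suc k. e i = e' i) \<longrightarrow> R e = R e'" using S1_support[OF assms] by blast
  from S1_as_set[OF assms this] obtain Z t where Z: "Z \<in> fam" "TM t" "\<forall>e. R e \<longleftrightarrow> t e \<in> Z" by blast
  have "D1 fam (\<lambda>e. t e \<in> Z)" by (intro D1_mem F1_TM Z)
  moreover have "R = (\<lambda>e. t e \<in> Z)" by (intro ext) (simp add: Z(3))
  ultimately show ?thesis by simp
qed

lemma D1_Ex:
  fixes R :: "(nat \<Rightarrow> 'a) \<Rightarrow> 'a \<Rightarrow> bool"
  assumes "D1 fam (\<lambda>e. R (\<lambda>i. e (Suc i)) (e 0))"
  shows "D1 fam (\<lambda>e. \<exists>x. R e x)"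
  by (rule D1_of_S1, rule S1_ex, rule D1_S1, rule assms)

lemma D1_All:
  fixes R :: "(nat \<Rightarrow> 'a) \<Rightarrow> 'a \<Rightarrow> bool"
  assumes "D1 fam (\<lambda>e. R (\<lambda>i. e (Suc i)) (e 0))"
  shows "D1 fam (\<lambda>e. \<forall>x. R e x)"
proof -
  have "D1 fam (\<lambda>e. \<not> (\<exists>x. \<not> R e x))" by (intro D1_not D1_Ex assms)
  then show ?thesis by simp
qed

end

section \<open>From the omega jump to Ramsey's theorem\<close>

subsection \<open>One limit\<close>

definition ins :: "'a::rca0 \<Rightarrow> 'a \<Rightarrow> 'a" where
  "ins s x = fset (s + x + 1) {y. memf y s \<or> y = x}"

lemma F1_ins [definable]: "F1 \<A> f \<Longrightarrow> F1 \<A> g \<Longrightarrow> F1 \<A> (\<lambda>e. ins (f e) (g e))"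
  by (rule F1_comp2[where h = ins]) (unfold ins_def, intro definable)

lemma ins_fam: "{y. memf y s \<or> y = x} \<in> fam"
  by (rule comprehension[where \<A> = fam]) (intro definable)

lemma memf_ins [simp]: "memf y (ins s x) \<longleftrightarrow> memf y s \<or> y = x"
  unfolding ins_def memf_fset[OF ins_fam] using memf_less[of y s]
  by (auto intro: add_increasing add_increasing2 less_imp_le)

lemma finset_ins: "finset (ins s x)"
  unfolding ins_def by (rule finset_fset[OF ins_fam])

text \<open>
  A set \<open>S\<close> codes the infinite set of all \<open>x\<close> with \<open>pr 0 x \<in> S\<close>, along which limits are taken, and a
  two-colouring of the finite sets, the set of all \<open>s\<close> with \<open>pr 1 s \<in> S\<close>.
\<close>

definition unbounded :: "'a::rca0 set \<Rightarrow> bool" where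
  "unbounded S \<longleftrightarrow> (\<forall>w. \<exists>x>w. pr 0 x \<in> S)"

definition limit_of :: "'a::rca0 set \<Rightarrow> 'a set \<Rightarrow> bool" where
  "limit_of S S' \<longleftrightarrow> unbounded S' \<and> (\<forall>x. pr 0 x \<in> S' \<longrightarrow> pr 0 x \<in> S) \<and>
    (\<forall>s. \<exists>w. \<forall>x>w. pr 0 x \<in> S' \<longrightarrow> (pr 1 (ins s x) \<in> S \<longleftrightarrow> pr 1 s \<in> S'))"

text \<open>\<open>\<sigma>\<close> codes a guess, namely the set of those \<open>s < n\<close> that
  receive the positive colour in the limit; \<open>x\<close> agrees if its one-point extensions
  already have the guessed colours.\<close>

definition agrees :: "'a::rca0 set \<Rightarrow> 'a \<Rightarrow> 'a \<Rightarrow> 'a \<Rightarrow> bool" where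
  "agrees S n \<sigma> x \<longleftrightarrow> pr 0 x \<in> S \<and> (\<forall>s<n. pr 1 (ins s x) \<in> S \<longleftrightarrow> memf s \<sigma>)"

text \<open>That infinitely many \<open>x\<close> agree with a guess needs two unbounded
  quantifiers. It is decided in two recursively enumerable steps: whether some \<open>x > w\<close>
  agrees, and then whether this fails for some \<open>w\<close>. The part tagged 0 carries
  \<open>S\<close> along.\<close>

definition agree_above :: "'a::rca0 set \<Rightarrow> 'a set" where
  "agree_above S = {p. (\<exists>z. p = pr 0 z \<and> z \<in> S) \<or>
    (\<exists>w n \<sigma> x. p = pr 1 (pr w (pr n \<sigma>)) \<and> w < x \<and> agrees S n \<sigma> x)}"

definition agree_bounded :: "'a::rca0 set \<Rightarrow> 'a set" where
  "agree_bounded T = {p. (\<exists>z. p = pr 0 z \<and> pr 0 z \<in> T) \<or>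
    (\<exists>w n \<sigma>. p = pr 1 (pr n \<sigma>) \<and> pr 1 (pr w (pr n \<sigma>)) \<notin> T)}"

lemma D1_agrees:
  assumes "S \<in> \<A>" "S \<in> fam"
  shows "D1 \<A> (\<lambda>e. agrees S (e i) (e j) (e k))"
  unfolding agrees_def by (intro definable D1_mem assms)

lemma S1_agree_above:
  assumes S: "S \<in> fam"
  shows "S1 {S} (\<lambda>e. e 0 \<in> agree_above S)"
proof -
  have "S1 {S} (\<lambda>e. \<exists>z. e 0 = pr 0 z \<and> z \<in> S)"
    by (intro S1_ex D1_S1 definable D1_mem singletonI S)
  moreover have "S1 {S} (\<lambda>e. \<exists>w n \<sigma> x. e 0 = pr 1 (pr w (pr n \<sigma>)) \<and> w < x \<and> agrees S n \<sigma> x)"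
    by (intro S1_ex D1_S1 definable D1_agrees singletonI S)
  ultimately show ?thesis unfolding agree_above_def mem_Collect_eq by (rule S1_disj)
qed

lemma S1_agree_bounded:
  assumes T: "T \<in> fam"
  shows "S1 {T} (\<lambda>e. e 0 \<in> agree_bounded T)"
proof -
  have "S1 {T} (\<lambda>e. \<exists>z. e 0 = pr 0 z \<and> pr 0 z \<in> T)"
    by (intro S1_ex D1_S1 definable D1_mem singletonI T)
  moreover have "S1 {T} (\<lambda>e. \<exists>w n \<sigma>. e 0 = pr 1 (pr n \<sigma>) \<and> pr 1 (pr w (pr n \<sigma>)) \<notin> T)"
    by (intro S1_ex D1_S1 definable D1_mem singletonI T)
  ultimately show ?thesis unfolding agree_bounded_def mem_Collect_eq by (rule S1_disj)
qed

text \<open>A path through the binary tree of guesses is followed such that infinitely many elements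
  agree with each of its nodes; the \<open>n\<close>-th element of the new set is taken from those
  that agree with the first \<open>n\<close> guesses. The path is the limit colouring, and all of
  this is recursive in \<open>T\<close>.\<close>

lemma limit_exists:
  fixes S T :: "'a::rca0 set"
  assumes S: "S \<in> fam" and T: "T \<in> fam" and T_def: "T = agree_bounded (agree_above S)" and unb: "unbounded S"
  shows "\<exists>S'. D1 {T} (\<lambda>e. e 0 \<in> S') \<and> limit_of S S'"
proof -
  have mem: "pr 0 z \<in> T \<longleftrightarrow> z \<in> S" for z
    unfolding T_def agree_bounded_def agree_above_def by auto
  have inf: "pr 1 (pr n \<sigma>) \<notin> T \<longleftrightarrow> (\<forall>w. \<exists>x>w. agrees S n \<sigma> x)" for n \<sigma>
    unfolding T_def agree_bounded_def agree_above_def by auto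
  have "D0 {T} (\<lambda>e. pr 0 (e 0) \<in> T)" by (intro D0_mem TM_pr TM_var TM_const T singletonI)
  then have ST: "D0 {T} (\<lambda>e. e 0 \<in> S)" unfolding mem .
  \<comment> \<open>The negative colour for \<open>n\<close> is preferred; \<open>n\<close> is
    inserted only if finitely many elements agree with the guess that leaves it out.\<close>
  define h where "h = (\<lambda>n \<sigma>. if pr 1 (pr (n + 1) \<sigma>) \<in> T then ins \<sigma> n else \<sigma>)"
  define path where "path = prec (fset 0 {}) h"
  have Fh: "F1 \<A> (\<lambda>e. h (e (Suc 0)) (e 0))" if "T \<in> \<A>" for \<A>
    unfolding h_def by (intro definable D1_mem T that)
  have path_0: "path 0 = fset 0 {}" and path_Suc: "path (n + 1) = h n (path n)" for n
    unfolding path_def by (intro prec_0 prec_Suc Fh T)+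
  have Fpath: "F1 \<A> (\<lambda>e. path (e 0))" if "T \<in> \<A>" for \<A>
    unfolding path_def by (intro definable Fh that)
  have path: "pr 1 (pr n (path n)) \<notin> T \<and> (\<forall>s<path n. memf s (path n) \<longrightarrow> s < n)" for n
  proof (rule D1_induct[where \<A> = fam and x = n])
    show "D1 fam (\<lambda>e. pr 1 (pr (e 0) (path (e 0))) \<notin> T \<and> (\<forall>s<path (e 0). memf s (path (e 0)) \<longrightarrow> s < e 0))"
      by (intro definable D1_mem T F1_comp1[OF Fpath[OF T]])
    have "\<not> memf s (path 0)" for s unfolding path_0 by (simp add: memf_fset fam_empty)
    then show "pr 1 (pr 0 (path 0)) \<notin> T \<and> (\<forall>s<path 0. memf s (path 0) \<longrightarrow> s < 0)"
      using unb unfolding inf by (simp add: agrees_def unbounded_def)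
    fix n assume IH: "pr 1 (pr n (path n)) \<notin> T \<and> (\<forall>s<path n. memf s (path n) \<longrightarrow> s < n)"
    then have less: "s < n" if "memf s (path n)" for s using memf_less that by blast
    show "pr 1 (pr (n + 1) (path (n + 1))) \<notin> T \<and> (\<forall>s<path (n + 1). memf s (path (n + 1)) \<longrightarrow> s < n + 1)"
    proof (cases "pr 1 (pr (n + 1) (path n)) \<in> T")
      case False
      then show ?thesis using less less_imp_le by (auto simp: path_Suc h_def)
    next
      case True
      then have eq: "path (n + 1) = ins (path n) n" by (simp add: path_Suc h_def)
      obtain w where w: "\<And>x. w < x \<Longrightarrow> \<not> agrees S (n + 1) (path n) x" using True inf by blast
      \<comment> \<open>Beyond \<open>w\<close>, an element that agrees with the first
        \<open>n\<close> guesses cannot have the negative colour at \<open>n\<close>, so it has the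
        positive one.\<close>
      have "\<exists>x>v. agrees S (n + 1) (ins (path n) n) x" for v
      proof -
        obtain x where x: "max v w < x" "agrees S n (path n) x" using IH inf by blast
        have "\<not> agrees S (n + 1) (path n) x" using w x(1) by simp
        then have "pr 1 (ins n x) \<in> S" using x(2) less[of n] unfolding agrees_def by (auto simp: le_less)
        then have "agrees S (n + 1) (ins (path n) n) x" using x(2) unfolding agrees_def by (auto simp: le_less)
        then show ?thesis using x(1) by auto
      qed
      then show ?thesis using less less_imp_le unfolding eq inf by auto
    qed
  qed
  \<comment> \<open>Stage \<open>s\<close> settles \<open>s\<close> for good, since later stages
    only insert larger numbers.\<close>
  have path_stable: "memf s (path (s + 1 + d)) \<longleftrightarrow> memf s (path (s + 1))" for s d
  proof (rule D1_induct[where \<A> = fam and x = d])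
    show "D1 fam (\<lambda>e. memf s (path (s + 1 + e 0)) \<longleftrightarrow> memf s (path (s + 1)))"
      by (intro definable F1_comp1[OF Fpath[OF T]])
    have "s \<noteq> s + 1 + d" for d
      using add_one_le_iff[of s "s + 1 + d"] by (auto simp del: add_one_le_iff)
    then show "memf s (path (s + 1 + (d + 1))) \<longleftrightarrow> memf s (path (s + 1))"
      if "memf s (path (s + 1 + d)) \<longleftrightarrow> memf s (path (s + 1))" for d
      using that path_Suc[of "s + 1 + d"] by (simp add: add.assoc h_def)
  qed simp
  have ex: "\<exists>x. b < x \<and> agrees S n (path n) x" for n b
    using path[of n] inf by blast
  define b where "b = prec 0 (\<lambda>n b. LEAST x. b < x \<and> agrees S n (path n) x)"
  have DA: "D1 {T} (\<lambda>e. agrees S (e i) (e j) (e k))" for i j k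
    by (rule D1_trans[OF D1_agrees[of S "{S}"]]) (use ST S in auto)
  have DP: "D1 {T} (\<lambda>e. agrees S (e (Suc (Suc 0))) (path (e (Suc (Suc 0)))) (e 0))"
  proof (rule D1_let[where R = "\<lambda>e y. agrees S (e (Suc (Suc 0))) y (e 0)"])
    show "F1 {T} (\<lambda>e. path (e (Suc (Suc 0))))" by (rule F1_comp1[OF Fpath F1_var]) simp
  qed (rule DA)
  have Fb': "F1 {T} (\<lambda>e. LEAST x. e 0 < x \<and> agrees S (e (Suc 0)) (path (e (Suc 0))) x)"
    by (rule F1_Least) (intro definable DP, rule ex)
  note Fb'' = F1_mono[OF Fb', of fam, simplified]
  have b_Suc: "b (n + 1) = (LEAST x. b n < x \<and> agrees S n (path n) x)" for n
    unfolding b_def by (rule prec_Suc) (rule Fb'')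
  have Fb: "F1 {T} (\<lambda>e. b (e 0))" unfolding b_def by (intro definable Fb')
  note Fb_fam = F1_mono[OF Fb, of fam, simplified]
  have b: "b n < b (n + 1)" "agrees S n (path n) (b (n + 1))" for n
  proof -
    obtain x where x: "b n < x \<and> agrees S n (path n) x" using ex by blast
    have "D1 fam (\<lambda>e. b n < e 0 \<and> agrees S n (path n) (e 0))"
      unfolding agrees_def by (intro definable D1_mem S)
    from Least_D1(1)[OF this x] show "b n < b (n + 1)" "agrees S n (path n) (b (n + 1))"
      unfolding b_Suc by blast+
  qed
  have b_mono: "b n \<le> b (n + d)" for n d
  proof (rule D1_induct[where \<A> = fam and x = d])
    show "D1 fam (\<lambda>e. b n \<le> b (n + e 0))" by (intro definable F1_comp1[OF Fb_fam])
    show "b n \<le> b (n + (d + 1))" if "b n \<le> b (n + d)" for d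
      using that b(1)[of "n + d"] by (simp add: add.assoc)
  qed simp
  have b_ge: "n \<le> b n" for n
  proof (rule D1_induct[where \<A> = fam and x = n])
    show "D1 fam (\<lambda>e. e 0 \<le> b (e 0))" by (intro definable Fb_fam)
    show "n + 1 \<le> b (n + 1)" if "n \<le> b n" for n
      using le_less_trans[OF that b(1)] by simp
  qed simp
  \<comment> \<open>The bound \<open>n \<le> x\<close> loses nothing because of \<open>b_ge\<close>;
    the limit colour of \<open>x\<close> is read off right after the stage that settles it.\<close>
  define S' where "S' = {p. \<exists>x\<le>p. p = pr 0 x \<and> (\<exists>n\<le>x. x = b (n + 1)) \<or> p = pr 1 x \<and> memf x (path (x + 1))}"
  have mem0: "pr 0 x \<in> S' \<longleftrightarrow> (\<exists>n. x = b (n + 1))" for x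
  proof -
    have "n \<le> b (n + 1)" for n using b_ge[of "n + 1"] by (simp add: less_imp_le)
    then show ?thesis unfolding S'_def by auto
  qed
  have mem1: "pr 1 s \<in> S' \<longleftrightarrow> memf s (path (s + 1))" for s unfolding S'_def by auto
  have "D1 {T} (\<lambda>e. e 0 \<in> S')"
    unfolding S'_def by (intro definable F1_comp1[OF Fb] F1_comp1[OF Fpath] singletonI)
  moreover have "limit_of S S'"
    unfolding limit_of_def
  proof (intro conjI allI impI)
    show "unbounded S'"
      unfolding unbounded_def mem0 using b_ge[of "_ + 1"] by (metis add_one_le_iff)
    show "pr 0 x \<in> S" if "pr 0 x \<in> S'" for x
      using that b(2) unfolding mem0 agrees_def by blast
    show "\<exists>w. \<forall>x>w. pr 0 x \<in> S' \<longrightarrow> (pr 1 (ins s x) \<in> S \<longleftrightarrow> pr 1 s \<in> S')" for s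
    \<comment> \<open>Elements beyond \<open>b (s + 1)\<close> were chosen when the colour of
      \<open>s\<close> was already settled.\<close>
    proof (intro exI[of _ "b (s + 1)"] allI impI)
      fix x assume x: "b (s + 1) < x" "pr 0 x \<in> S'"
      then obtain n where n: "x = b (n + 1)" using mem0 by blast
      have "s < n"
      proof (rule ccontr)
        assume "\<not> s < n"
        then obtain d where "s = n + d" using le_iff_add[of n s] by auto
        then have "b (n + 1) \<le> b (s + 1)" using b_mono[of "n + 1" d] by (simp add: ac_simps)
        then show False using x(1) n by simp
      qed
      then obtain d where d: "n = s + 1 + d" using le_iff_add[of "s + 1" n] by auto
      have "pr 1 (ins s x) \<in> S \<longleftrightarrow> memf s (path n)"
        using b(2)[of n] \<open>s < n\<close> unfolding n agrees_def by blast
      then show "pr 1 (ins s x) \<in> S \<longleftrightarrow> pr 1 s \<in> S'"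
        unfolding mem1 d path_stable .
    qed
  qed
  ultimately show ?thesis by blast
qed

subsection \<open>Iterated limits\<close>

text \<open>
  For \<open>q = (n, i)\<close> with \<open>n > 0\<close>, \<open>W Y q\<close> is the \<open>i\<close>-th set that is recursively enumerable in section
  \<open>n - 1\<close> of the omega jump \<open>Y\<close>. These sets are closed under arithmetical definability, and being
  indexed by numbers they can be quantified over, which makes the induction on \<open>k\<close> in
  \<open>limit_sequence\<close> arithmetical in \<open>Y\<close>.
\<close>

definition W :: "'a::rca0 set \<Rightarrow> 'a \<Rightarrow> 'a set" where
  "W Y q = {x. \<exists>n\<le>q. \<exists>i\<le>q. q = pr n i \<and> pr n (smn i x) \<in> Y}"

text \<open>\<open>col Y q k\<close> and \<open>res Y q k\<close> are the colouring
  \<open>c\<^sub>k\<close> and the infinite set \<open>B\<^sub>k\<close> of the introduction, both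
  given by the index \<open>q k\<close>.\<close>

definition col :: "'a::rca0 set \<Rightarrow> ('a \<Rightarrow> 'a) \<Rightarrow> 'a \<Rightarrow> 'a \<Rightarrow> bool" where
  "col Y q k s \<longleftrightarrow> pr 1 s \<in> W Y (q k)"

definition res :: "'a::rca0 set \<Rightarrow> ('a \<Rightarrow> 'a) \<Rightarrow> 'a \<Rightarrow> 'a \<Rightarrow> bool" where
  "res Y q k x \<longleftrightarrow> pr 0 x \<in> W Y (q k)"

context
  fixes Y :: "'a::rca0 set"
  assumes jump_fam: "\<And>X :: 'a set. X \<in> fam \<Longrightarrow> jump X \<in> fam"
    and Y: "Y \<in> fam" and Y_Suc: "\<And>n. section_of Y (n + 1) = jump (section_of Y n)"
begin

lemmas arithmetical = D1_Ex[OF jump_fam] D1_All[OF jump_fam]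

lemma W_pr: "W Y (pr n i) = {x. smn i x \<in> section_of Y n}"
  by (auto simp: W_def section_of_def)

lemma D1_W [definable]: "F1 fam f \<Longrightarrow> F1 fam q \<Longrightarrow> D1 fam (\<lambda>e. f e \<in> W Y (q e))"
  by (rule D1_comp2[where R = "\<lambda>x q. x \<in> W Y q"]) (unfold W_def smn_def, intro definable D1_mem Y)

lemma W_fam: "W Y q \<in> fam"
  by (rule famI[where \<A> = fam]) (intro definable)

lemma W_of_S1:
  assumes "S1 {section_of Y n} (\<lambda>e. e 0 \<in> Z)"
  shows "\<exists>q. Z = W Y q"
proof -
  obtain i where "\<forall>x. x \<in> Z \<longleftrightarrow> smn i x \<in> jump (section_of Y n)"
    using jump_complete[OF fam_section[OF Y] assms] by blast
  then have "Z = W Y (pr (n + 1) i)" unfolding W_pr Y_Suc by blast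
  then show ?thesis by blast
qed

text \<open>If \<open>q = pr n i\<close>, then \<open>W Y q\<close> is recursive in section
  \<open>n\<close>, so what is enumerable in it is enumerable in section \<open>n\<close> and has an
  index at level \<open>n + 1\<close>.\<close>

lemma W_closed:
  assumes "S1 {W Y q} (\<lambda>e. e 0 \<in> Z)"
  shows "\<exists>q'. Z = W Y q'"
proof (cases "\<exists>n i. q = pr n i")
  case True
  then obtain n i where q: "q = pr n i" by blast
  have "S1 {section_of Y n} (\<lambda>e. e 0 \<in> Z)"
  proof (rule S1_trans[OF assms])
    show "D0 {section_of Y n} (\<lambda>e. e 0 \<in> A)" if "A \<in> {W Y q}" for A
      using D0_smn[OF fam_section[OF Y], of n i] that by (simp add: q W_pr)
  qed
  then show ?thesis by (rule W_of_S1)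
next
  \<comment> \<open>The pairing is not surjective; an index that is no pair denotes the empty set,
    which is recursive in section 0.\<close>
  case False
  then have "W Y q = {}" by (auto simp: W_def)
  have "S1 {section_of Y 0} (\<lambda>e. e 0 \<in> Z)"
  proof (rule S1_trans[OF assms])
    show "D0 {section_of Y 0} (\<lambda>e. e 0 \<in> A)" if "A \<in> {W Y q}" for A
      using that D0_bool[of "{section_of Y 0}" False] by (simp add: \<open>W Y q = {}\<close>)
  qed
  then show ?thesis by (rule W_of_S1)
qed

text \<open>Three closure steps: two for the decision set of \<open>limit_exists\<close>, one for
  the limit itself.\<close>

lemma limit_in_W:
  assumes "unbounded (W Y q)"
  shows "\<exists>q'. limit_of (W Y q) (W Y q')"
proof -
  obtain q1 where q1: "agree_above (W Y q) = W Y q1" using W_closed[OF S1_agree_above[OF W_fam]] by blast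
  obtain q2 where q2: "agree_bounded (W Y q1) = W Y q2" using W_closed[OF S1_agree_bounded[OF W_fam]] by blast
  obtain S' where S': "D1 {W Y q2} (\<lambda>e. e 0 \<in> S')" "limit_of (W Y q) S'"
    using limit_exists[OF W_fam W_fam _ assms, of q2] q1 q2 by auto
  then obtain q' where "S' = W Y q'" using W_closed[OF D1_S1] by blast
  then show ?thesis using S'(2) by blast
qed

lemma limit_sequence:
  assumes "unbounded (W Y q0)"
  shows "\<exists>q. F1 fam (\<lambda>e. q (e 0)) \<and> q 0 = q0 \<and> (\<forall>k. limit_of (W Y (q k)) (W Y (q (k + 1))))"
proof -
  \<comment> \<open>The premise inside the search makes it succeed for every \<open>q\<close>, as
    \<open>F1_Least\<close> demands.\<close>
  define next_index where "next_index = (\<lambda>q. LEAST q'. unbounded (W Y q) \<longrightarrow> limit_of (W Y q) (W Y q'))"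
  have D: "D1 fam (\<lambda>e. unbounded (W Y (e (Suc 0))) \<longrightarrow> limit_of (W Y (e (Suc 0))) (W Y (e 0)))"
    unfolding unbounded_def limit_of_def by (intro definable arithmetical)
  have F: "F1 fam (\<lambda>e. next_index (e 0))"
    unfolding next_index_def by (rule F1_Least) (rule D, use limit_in_W in blast)
  have Dq: "D1 fam (\<lambda>e. unbounded (W Y q) \<longrightarrow> limit_of (W Y q) (W Y (e 0)))" for q
    unfolding unbounded_def limit_of_def by (intro definable arithmetical)
  have nx: "limit_of (W Y q) (W Y (next_index q))" if unb: "unbounded (W Y q)" for q
  proof -
    obtain q' where "unbounded (W Y q) \<longrightarrow> limit_of (W Y q) (W Y q')" using limit_in_W by blast
    from Least_D1(1)[OF Dq this] show ?thesis using unb unfolding next_index_def by blast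
  qed
  define q where "q = prec q0 (\<lambda>_. next_index)"
  have q: "q 0 = q0" "q (k + 1) = next_index (q k)" for k
    unfolding q_def by (intro prec_0 prec_Suc F)+
  have Fq: "F1 fam (\<lambda>e. q (e 0))" unfolding q_def by (intro definable F)
  have "unbounded (W Y (q k))" for k
  proof (rule D1_induct[where \<A> = fam and x = k])
    show "D1 fam (\<lambda>e. unbounded (W Y (q (e 0))))"
      unfolding unbounded_def by (intro definable arithmetical F1_comp1[OF Fq])
    show "unbounded (W Y (q 0))" using assms q by simp
    show "unbounded (W Y (q (k + 1)))" if "unbounded (W Y (q k))" for k
      using nx[OF that] unfolding q(2) limit_of_def by blast
  qed
  then show ?thesis using nx q Fq by metis
qed

text \<open>The bound is not computed. Sets containing the new number \<open>k\<close> have the form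
  \<open>ins s k\<close> with \<open>s < K\<close>, and collection bounds their codes; the induction
  is arithmetical because it quantifies over all \<open>s\<close>.\<close>

lemma finset_bound: "\<exists>K. \<forall>s. finset s \<and> (\<forall>x. memf x s \<longrightarrow> x < k) \<longrightarrow> s < (K :: 'a)"
proof (rule D1_induct[where \<A> = fam and x = k])
  show "D1 fam (\<lambda>e. \<exists>K. \<forall>s. finset s \<and> (\<forall>x. memf x s \<longrightarrow> x < e 0) \<longrightarrow> s < (K :: 'a))"
    by (intro definable arithmetical)
  have empty: "s = fset 0 {}" if "finset s" "\<forall>x. \<not> memf x s" for s :: 'a
    using that by (intro finset_eq) (auto simp: finset_fset fam_empty memf_fset)
  show "\<exists>K. \<forall>s. finset s \<and> (\<forall>x. memf x s \<longrightarrow> x < 0) \<longrightarrow> s < (K :: 'a)"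
    by (rule exI[of _ "fset 0 {} + 1"]) (use empty in auto)
  fix k :: 'a assume "\<exists>K. \<forall>s. finset s \<and> (\<forall>x. memf x s \<longrightarrow> x < k) \<longrightarrow> s < (K :: 'a)"
  then obtain K :: 'a where K: "\<And>s. finset s \<Longrightarrow> (\<And>x. memf x s \<Longrightarrow> x < k) \<Longrightarrow> s < K" by blast
  have "\<exists>b. \<forall>s<K. \<exists>t<b. t = ins s k"
    by (rule collection_D1[where \<A> = fam]) (intro definable, simp)
  then obtain b where b: "\<And>s. s < K \<Longrightarrow> ins s k < b" by blast
  have "s < max K b" if s: "finset s" "\<And>x. memf x s \<Longrightarrow> x < k + 1" for s
  proof (cases "memf k s")
    case False
    then have "s < K" using s by (intro K) (auto simp: le_less)
    then show ?thesis by (simp add: less_max_iff_disj)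
  next
    case True
    let ?t = "fset k {x. memf x s}"
    have t: "finset ?t" "\<And>x. memf x ?t \<longleftrightarrow> x < k \<and> memf x s" by (simp_all add: finset_fset memf_fset)
    have "ins ?t k = s" by (rule finset_eq) (use s True t in \<open>auto simp: finset_ins le_less\<close>)
    moreover have "?t < K" using t by (intro K) auto
    ultimately show ?thesis using b by (metis less_max_iff_disj)
  qed
  then show "\<exists>K. \<forall>s. finset s \<and> (\<forall>x. memf x s \<longrightarrow> x < k + 1) \<longrightarrow> s < (K :: 'a)" by blast
qed

context
  fixes q :: "'a \<Rightarrow> 'a"
  assumes Fq: "F1 fam (\<lambda>e. q (e 0))" and lim: "\<And>k. limit_of (W Y (q k)) (W Y (q (k + 1)))"
    and unb0: "unbounded (W Y (q 0))"
begin

lemma D1_col [definable]: "F1 fam k \<Longrightarrow> F1 fam s \<Longrightarrow> D1 fam (\<lambda>e. col Y q (k e) (s e))"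
  unfolding col_def by (intro definable F1_comp1[OF Fq])

lemma D1_res [definable]: "F1 fam k \<Longrightarrow> F1 fam x \<Longrightarrow> D1 fam (\<lambda>e. res Y q (k e) (x e))"
  unfolding res_def by (intro definable F1_comp1[OF Fq])

lemma res_unbounded: "\<exists>x>w. res Y q (k + 1) x"
  using lim[of k] unfolding limit_of_def unbounded_def res_def by blast

lemma res_mono: "res Y q (k + d) x \<longrightarrow> res Y q k x"
proof (rule D1_induct[where \<A> = fam and x = d])
  show "D1 fam (\<lambda>e. res Y q (k + e 0) x \<longrightarrow> res Y q k x)" by (intro definable)
  show "res Y q (k + (d + 1)) x \<longrightarrow> res Y q k x" if "res Y q (k + d) x \<longrightarrow> res Y q k x" for d
    using that lim[of "k + d"] unfolding limit_of_def res_def by (simp add: add.assoc)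
qed simp

lemma col_limit: "\<exists>w. \<forall>x>w. res Y q (k + 1) x \<longrightarrow> (col Y q k (ins s x) \<longleftrightarrow> col Y q (k + 1) s)"
  using lim[of k] unfolding limit_of_def res_def col_def by blast

text \<open>Indices \<open>k \<le> x\<close> are enough, since an exactly large set with least
  element \<open>a \<le> x\<close> involves no colouring beyond index \<open>a\<close>. Membership
  at index \<open>x + 1\<close> puts \<open>y\<close> into all the sets along which these limits are
  taken.\<close>

definition good_next :: "'a \<Rightarrow> 'a \<Rightarrow> bool" where
  "good_next x y \<longleftrightarrow> x < y \<and> res Y q (x + 1) y \<and>
    (\<forall>s. finset s \<and> (\<forall>z. memf z s \<longrightarrow> z \<le> x) \<longrightarrow> (\<forall>k\<le>x. col Y q k (ins s y) \<longleftrightarrow> col Y q (k + 1) s))"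

lemma good_next_exists: "\<exists>y. good_next x y"
proof -
  obtain K where K: "\<And>s. finset s \<Longrightarrow> (\<And>z. memf z s \<Longrightarrow> z < x + 1) \<Longrightarrow> s < K"
    using finset_bound[of "x + 1"] by blast
  let ?P = "\<lambda>k s w. \<forall>y>w. res Y q (k + 1) y \<longrightarrow> (col Y q k (ins s y) \<longleftrightarrow> col Y q (k + 1) s)"
  \<comment> \<open>Each pair of \<open>k\<close> and \<open>s\<close> has its own threshold; one
    collection over \<open>s\<close> and another over \<open>k\<close> bound them all.\<close>
  have inner: "\<exists>b. \<forall>s<K. \<exists>w<b. ?P k s w" for k
  proof (rule collection_D1[where \<A> = fam])
    show "D1 fam (\<lambda>e. ?P k (e (Suc 0)) (e 0))" by (intro definable arithmetical)
    show "\<forall>s<K. \<exists>w. ?P k s w" using col_limit by simp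
  qed
  have "\<exists>c. \<forall>k<x + 1. \<exists>b<c. \<forall>s<K. \<exists>w<b. ?P k s w"
  proof (rule collection_D1[where \<A> = fam])
    show "D1 fam (\<lambda>e. \<forall>s<K. \<exists>w<e 0. ?P (e (Suc 0)) s w)" by (intro definable arithmetical)
    show "\<forall>k<x + 1. \<exists>b. \<forall>s<K. \<exists>w<b. ?P k s w" using inner by simp
  qed
  then obtain c where c: "\<And>k. k \<le> x \<Longrightarrow> \<exists>b<c. \<forall>s<K. \<exists>w<b. ?P k s w" by auto
  obtain y where y: "max x c < y" "res Y q (x + 1) y" using res_unbounded by blast
  have "col Y q k (ins s y) \<longleftrightarrow> col Y q (k + 1) s"
    if s: "finset s" "\<forall>z. memf z s \<longrightarrow> z \<le> x" and k: "k \<le> x" for s k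
  proof -
    have "s < K" using s by (intro K) auto
    then obtain b w where w: "b < c" "w < b" "?P k s w" using c[OF k] by blast
    obtain d where d: "x = k + d" using k le_iff_add by blast
    have "res Y q (k + 1) y" using res_mono[of "k + 1" d y] y(2) by (simp add: d ac_simps)
    moreover have "w < y" using w y(1) by (auto dest: less_trans)
    ultimately show ?thesis using w(3) by blast
  qed
  then show ?thesis using y unfolding good_next_def by (intro exI[of _ y]) auto
qed

lemma prehomogeneous:
  "\<exists>L\<in>fam. infinite_set L \<and> (\<forall>y\<in>L. res Y q 0 y) \<and>
    (\<forall>y\<in>L. \<forall>s k a. finset s \<and> (\<forall>z. memf z s \<longrightarrow> z \<in> L \<and> z < y) \<and> a \<in> L \<and> a < y \<and> k \<le> a \<longrightarrow>
      (col Y q k (ins s y) \<longleftrightarrow> col Y q (k + 1) s))"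
proof -
  define f where "f = (\<lambda>x. LEAST y. good_next x y)"
  have Ff: "F1 fam (\<lambda>e. f (e 0))"
    unfolding f_def
  proof (rule F1_Least)
    show "D1 fam (\<lambda>e. good_next (e (Suc 0)) (e 0))" unfolding good_next_def by (intro definable arithmetical)
  qed (rule good_next_exists)
  have Dg: "D1 fam (\<lambda>e. good_next x (e 0))" for x unfolding good_next_def by (intro definable arithmetical)
  have f: "good_next x (f x)" for x
    using good_next_exists[of x] Least_D1(1)[OF Dg] unfolding f_def by blast
  define a where "a = prec 0 (\<lambda>_. f)"
  have a_Suc: "a (n + 1) = f (a n)" for n unfolding a_def by (intro prec_Suc Ff)
  have Fa: "F1 fam (\<lambda>e. a (e 0))" unfolding a_def by (intro definable Ff)
  have less: "a n < a (n + 1)" for n using f[of "a n"] unfolding a_Suc good_next_def by blast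
  have mono: "a n \<le> a (n + d)" for n d
  proof (rule D1_induct[where \<A> = fam and x = d])
    show "D1 fam (\<lambda>e. a n \<le> a (n + e 0))" by (intro definable F1_comp1[OF Fa])
    show "a n \<le> a (n + (d + 1))" if "a n \<le> a (n + d)" for d
      using that less[of "n + d"] by (simp add: add.assoc)
  qed simp
  have below: "a m \<le> a n" if "a m < a (n + 1)" for m n
  proof -
    have "\<not> n + 1 \<le> m"
    proof
      assume "n + 1 \<le> m"
      then obtain d where "m = n + 1 + d" using le_iff_add by blast
      then show False using mono[of "n + 1" d] that by simp
    qed
    then obtain d where "n = m + d" using le_iff_add[of m n] by auto
    then show ?thesis using mono[of m d] by simp
  qed
  have ge: "n \<le> a n" for n
  proof (rule D1_induct[where \<A> = fam and x = n])
    show "D1 fam (\<lambda>e. e 0 \<le> a (e 0))" by (intro definable Fa)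
    show "n + 1 \<le> a (n + 1)" if "n \<le> a n" for n using le_less_trans[OF that less] by simp
  qed simp
  \<comment> \<open>The start \<open>a 0 = 0\<close> is left out because nothing places it in the
    given infinite set.\<close>
  define L where "L = {y. \<exists>n. y = a (n + 1)}"
  have "L \<in> fam" unfolding L_def by (rule comprehension[where \<A> = fam]) (intro definable arithmetical F1_comp1[OF Fa])
  moreover have "infinite_set L"
    unfolding infinite_set_def L_def using ge[of "_ + 1"] by (metis (mono_tags, lifting) add_one_le_iff mem_Collect_eq)
  moreover have "res Y q 0 y" if y: "y \<in> L" for y
  proof -
    obtain n where "y = f (a n)" using y by (auto simp: L_def a_Suc)
    then have "res Y q (0 + (a n + 1)) y" using f[of "a n"] by (simp add: good_next_def)
    then show ?thesis using res_mono by blast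
  qed
  moreover have "col Y q k (ins s y) \<longleftrightarrow> col Y q (k + 1) s"
    if y: "y \<in> L" and s: "finset s" "\<forall>z. memf z s \<longrightarrow> z \<in> L \<and> z < y" and b: "b \<in> L" "b < y" "k \<le> b" for y s k b
  proof -
    obtain n where n: "y = a (n + 1)" using y by (auto simp: L_def)
    have le: "z \<le> a n" if "z \<in> L" "z < y" for z using that below n by (auto simp: L_def)
    then have "k \<le> a n" "\<forall>z. memf z s \<longrightarrow> z \<le> a n" using s b order_trans by blast+
    then show ?thesis using f[of "a n"] s(1) unfolding n a_Suc good_next_def by blast
  qed
  ultimately show ?thesis by blast
qed

lemma homogeneous_exists:
  "\<exists>L\<in>fam. infinite_set L \<and> (\<forall>y\<in>L. res Y q 0 y) \<and>
    (\<exists>c. \<forall>t. xlarge t \<and> (\<forall>x. memf x t \<longrightarrow> x \<in> L) \<longrightarrow> (col Y q 0 t \<longleftrightarrow> c))"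
proof -
  obtain L where L: "L \<in> fam" "infinite_set L" "\<And>y. y \<in> L \<Longrightarrow> res Y q 0 y"
    and pre: "\<And>y s k a. y \<in> L \<Longrightarrow> finset s \<Longrightarrow> (\<And>z. memf z s \<Longrightarrow> z \<in> L \<and> z < y) \<Longrightarrow> a \<in> L \<Longrightarrow> a < y \<Longrightarrow> k \<le> a \<Longrightarrow>
      col Y q k (ins s y) \<longleftrightarrow> col Y q (k + 1) s"
    using prehomogeneous by metis
  let ?c = "\<lambda>a. col Y q a (fset (a + 1) {a})"
  have Dc: "D1 fam (\<lambda>e. ?c (e 0))" by (intro definable)
  \<comment> \<open>The thinning by the colour \<open>c\<^sub>a({a})\<close>: one of its two values
    occurs infinitely often.\<close>
  have split: "\<exists>c. infinite_set {a \<in> L. ?c a \<longleftrightarrow> c}"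
  proof (rule ccontr)
    assume "\<not> ?thesis"
    then have "\<not> infinite_set {a \<in> L. ?c a \<longleftrightarrow> True}" "\<not> infinite_set {a \<in> L. ?c a \<longleftrightarrow> False}" by blast+
    then obtain u v where "\<forall>y>u. \<not> (y \<in> L \<and> ?c y)" "\<forall>y>v. \<not> (y \<in> L \<and> \<not> ?c y)"
      by (auto simp: infinite_set_def)
    moreover obtain y where "max u v < y" "y \<in> L" using L(2) unfolding infinite_set_def by blast
    ultimately show False by auto
  qed
  then obtain c where c: "infinite_set {a \<in> L. ?c a \<longleftrightarrow> c}" by blast
  let ?L = "{a \<in> L. ?c a \<longleftrightarrow> c}"
  have "?L \<in> fam" by (rule comprehension[where \<A> = fam]) (intro definable D1_mem L Dc)
  moreover have "col Y q 0 t \<longleftrightarrow> c" if t: "xlarge t" "\<forall>x. memf x t \<longrightarrow> x \<in> ?L" for t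
  proof -
    let ?T = "{x. memf x t}"
    obtain a where a: "finset t" "memf a t" "\<And>x. memf x t \<Longrightarrow> a \<le> x" "cnt ?T t = a + 1"
      using t(1) unfolding xlarge_def by blast
    have T: "?T \<in> fam" by simp
    have cnt_a: "cnt ?T (a + 1) = 1"
    proof -
      have "cnt ?T a = cnt {} a" by (rule cnt_cong) (use a(3) in \<open>auto simp: fam_empty dest: leD\<close>)
      then show ?thesis using a(2) by (simp add: cnt_Suc[OF T] cnt_empty)
    qed
    \<comment> \<open>An initial segment of \<open>t\<close> with \<open>i\<close> elements is
      coloured by index \<open>k = a + 1 - i\<close>. This starts with \<open>{a}\<close> at
      \<open>k = a\<close> and ends with \<open>t\<close> at \<open>k = 0\<close>; \<open>w\<close>
      measures how far the segment reaches beyond \<open>a\<close>.\<close>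
    have step: "\<forall>k\<le>a. cnt ?T (a + 1 + w) + k = a + 1 \<longrightarrow> (col Y q k (fset (a + 1 + w) ?T) \<longleftrightarrow> c)" for w
    proof (rule D1_induct[where \<A> = fam and x = w])
      show "D1 fam (\<lambda>e. \<forall>k\<le>a. cnt ?T (a + 1 + e 0) + k = a + 1 \<longrightarrow> (col Y q k (fset (a + 1 + e 0) ?T) \<longleftrightarrow> c))"
        by (intro definable)
      have "fset (a + 1) ?T = fset (a + 1) {a}"
        by (rule finset_eq) (use a in \<open>auto simp: finset_fset memf_fset fam_insert fam_empty dest: antisym\<close>)
      moreover have "?c a \<longleftrightarrow> c" using t(2) a(2) by blast
      ultimately show "\<forall>k\<le>a. cnt ?T (a + 1 + 0) + k = a + 1 \<longrightarrow> (col Y q k (fset (a + 1 + 0) ?T) \<longleftrightarrow> c)"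
        using cnt_a by (simp add: add.commute[of 1])
      fix w assume IH: "\<forall>k\<le>a. cnt ?T (a + 1 + w) + k = a + 1 \<longrightarrow> (col Y q k (fset (a + 1 + w) ?T) \<longleftrightarrow> c)"
      let ?y = "a + 1 + w"
      have y: "a < ?y" using add_one_le_iff[of a ?y] by (simp del: add_one_le_iff)
      have s: "finset (fset ?y ?T)" "\<And>x. memf x (fset ?y ?T) \<longleftrightarrow> x < ?y \<and> memf x t"
        by (simp_all add: finset_fset memf_fset)
      have "\<forall>k\<le>a. cnt ?T (?y + 1) + k = a + 1 \<longrightarrow> (col Y q k (fset (?y + 1) ?T) \<longleftrightarrow> c)"
      proof (cases "memf ?y t")
        case False
        then have "fset (?y + 1) ?T = fset ?y ?T"
          by (intro finset_eq) (auto simp: finset_fset memf_fset le_less)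
        then show ?thesis using IH False by (simp add: cnt_Suc[OF T])
      next
        case True
        have ins: "fset (?y + 1) ?T = ins (fset ?y ?T) ?y"
          by (rule finset_eq) (use True in \<open>auto simp: finset_fset finset_ins memf_fset le_less\<close>)
        have cnt: "cnt ?T (?y + 1) = cnt ?T ?y + 1" using True by (simp add: cnt_Suc[OF T])
        show ?thesis
        proof (intro allI impI)
          fix k assume k: "k \<le> a" "cnt ?T (?y + 1) + k = a + 1"
          have "col Y q k (ins (fset ?y ?T) ?y) \<longleftrightarrow> col Y q (k + 1) (fset ?y ?T)"
            using t(2) True s a(2) y k(1) by (intro pre[where a = a]) auto
          moreover have eq: "cnt ?T ?y + (k + 1) = a + 1" using k(2) cnt by (simp add: ac_simps)
          \<comment> \<open>The segment contains \<open>a\<close>, so \<open>k + 1\<close> stays in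
            the range of the induction hypothesis.\<close>
          moreover have "1 \<le> cnt ?T ?y" using cnt_mono[OF T, of "a + 1" ?y] cnt_a by simp
          then have "1 + (k + 1) \<le> cnt ?T ?y + (k + 1)" by (rule add_right_mono)
          then have "k + 1 \<le> a" unfolding eq by (simp add: add.commute[of 1])
          ultimately show "col Y q k (fset (?y + 1) ?T) \<longleftrightarrow> c" using IH unfolding ins by blast
        qed
      qed
      then show "\<forall>k\<le>a. cnt ?T (a + 1 + (w + 1)) + k = a + 1 \<longrightarrow> (col Y q k (fset (a + 1 + (w + 1)) ?T) \<longleftrightarrow> c)"
        by (simp add: add.assoc)
    qed
    have "a + 1 \<le> t" using memf_less[OF a(2)] by simp
    then obtain w where w: "t = a + 1 + w" using le_iff_add by blast
    have "fset t ?T = t" by (rule fset_finset[OF a(1)]) (auto simp: memf_less)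
    then show ?thesis using step[of w] a(4) unfolding w[symmetric] by simp
  qed
  ultimately show ?thesis using c L(3) by (intro bexI[of _ ?L]) auto
qed

end

end

theorem Omega_imp_RT:
  fixes A C :: "'a::rca0 set"
  assumes omega: "\<And>X :: 'a set. X \<in> fam \<Longrightarrow>
      \<exists>Y\<in>fam. \<forall>n. section_of Y n \<in> fam \<and> (\<exists>Z\<in>fam. jump_sequence X n (section_of Y n) Z)"
    and A: "A \<in> fam" and C: "C \<in> fam" and AC: "infinite_set A" "colouring C"
  shows "\<exists>L\<in>fam. infinite_set L \<and> L \<subseteq> A \<and> homogeneous C L"
proof -
  have jump_fam: "jump X \<in> fam" if X: "X \<in> fam" for X :: "'a set"
  proof -
    obtain Y where "\<forall>n. \<exists>Z\<in>fam. jump_sequence X n (section_of Y n) Z" using omega[OF X] by blast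
    \<comment> \<open>One step of a jump sequence already gives the jump of an arbitrary
      set.\<close>
    then obtain Z where "jump_sequence X 1 (section_of Y 1) Z" by blast
    then have "section_of Z 0 = X" "section_of Z (0 + 1) \<in> fam" "jump (section_of Z 0) = section_of Z (0 + 1)"
      unfolding jump_sequence_def by (blast intro: zero_less_one)+
    then show ?thesis by simp
  qed
  \<comment> \<open>The starting set for the limits: tag 0 for the infinite set, tag 1 for the
    exactly large sets of colour 1, which represent the colouring.\<close>
  define X where "X = {p. \<exists>z\<le>p. p = pr 0 z \<and> z \<in> A \<or> p = pr 1 z \<and> pr z 1 \<in> C}"
  have X_fam: "X \<in> fam" unfolding X_def by (rule comprehension[where \<A> = fam]) (intro definable D1_mem A C)
  obtain Y where Y: "Y \<in> fam" "\<And>n. \<exists>Z\<in>fam. jump_sequence X n (section_of Y n) Z" using omega[OF X_fam] by blast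
  have Y0: "section_of Y 0 = X" using Y(2)[of 0] by (auto simp: jump_sequence_def)
  have Y_Suc: "section_of Y (n + 1) = jump (section_of Y n)" for n
  proof -
    obtain Z where Z: "Z \<in> fam" "section_of Z 0 = X" "\<And>i. i < n \<Longrightarrow> jump (section_of Z i) = section_of Z (i + 1)"
      "section_of Z n = section_of Y n" using Y(2)[of n] by (auto simp: jump_sequence_def)
    obtain Z' where Z': "Z' \<in> fam" "section_of Z' 0 = X" "\<And>i. i < n + 1 \<Longrightarrow> jump (section_of Z' i) = section_of Z' (i + 1)"
      "section_of Z' (n + 1) = section_of Y (n + 1)" using Y(2)[of "n + 1"] by (auto simp: jump_sequence_def)
    \<comment> \<open>The witnesses for \<open>n\<close> and \<open>n + 1\<close> are unrelated at
      first. Their sections are identified by an induction that quantifies over all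
      \<open>j\<close>, hence the appeal to \<open>jump_fam\<close>.\<close>
    have "i \<le> n \<longrightarrow> (\<forall>j. pr i j \<in> Z \<longleftrightarrow> pr i j \<in> Z')" for i
    proof (rule D1_induct[where \<A> = fam and x = i])
      show "D1 fam (\<lambda>e. e 0 \<le> n \<longrightarrow> (\<forall>j. pr (e 0) j \<in> Z \<longleftrightarrow> pr (e 0) j \<in> Z'))"
        by (intro definable D1_All[OF jump_fam] D1_mem Z Z')
      show "0 \<le> n \<longrightarrow> (\<forall>j. pr 0 j \<in> Z \<longleftrightarrow> pr 0 j \<in> Z')"
        using Z(2) Z'(2) unfolding section_of_def by blast
      show "i + 1 \<le> n \<longrightarrow> (\<forall>j. pr (i + 1) j \<in> Z \<longleftrightarrow> pr (i + 1) j \<in> Z')"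
        if IH: "i \<le> n \<longrightarrow> (\<forall>j. pr i j \<in> Z \<longleftrightarrow> pr i j \<in> Z')" for i
      proof
        assume "i + 1 \<le> n"
        then have i: "i < n" "i < n + 1" by (simp_all add: less_imp_le)
        then have "section_of Z i = section_of Z' i" using IH by (auto simp: section_of_def)
        then have "section_of Z (i + 1) = section_of Z' (i + 1)" using Z(3)[OF i(1)] Z'(3)[OF i(2)] by simp
        then show "\<forall>j. pr (i + 1) j \<in> Z \<longleftrightarrow> pr (i + 1) j \<in> Z'" unfolding section_of_def by blast
      qed
    qed
    then have "section_of Z n = section_of Z' n" by (auto simp: section_of_def)
    then show ?thesis using Z(4) Z'(3)[of n] Z'(4) by simp
  qed
  have "S1 {section_of Y 0} (\<lambda>e. e 0 \<in> X)" unfolding Y0 by (intro D1_S1 D1_mem F1_var singletonI X_fam)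
  then obtain q0 where q0: "X = W Y q0" using W_of_S1[OF jump_fam Y(1) Y_Suc] by blast
  have X: "pr 0 z \<in> W Y q0 \<longleftrightarrow> z \<in> A" "pr 1 z \<in> W Y q0 \<longleftrightarrow> pr z 1 \<in> C" for z
    unfolding q0[symmetric] X_def by auto
  have unb: "unbounded (W Y q0)" using AC unfolding unbounded_def infinite_set_def X by blast
  obtain q where q: "F1 fam (\<lambda>e. q (e 0))" "q 0 = q0" "\<And>k. limit_of (W Y (q k)) (W Y (q (k + 1)))"
    using limit_sequence[OF jump_fam Y(1) Y_Suc unb] by blast
  obtain L c where L: "L \<in> fam" "infinite_set L" "\<forall>y\<in>L. res Y q 0 y"
    "\<forall>t. xlarge t \<and> (\<forall>x. memf x t \<longrightarrow> x \<in> L) \<longrightarrow> (col Y q 0 t \<longleftrightarrow> c)"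
    using homogeneous_exists[OF jump_fam Y(1) Y_Suc q(1,3)] unb unfolding q(2) by blast
  have "L \<subseteq> A" using L(3) by (auto simp: res_def q X)
  moreover have "homogeneous C L"
  proof -
    have "pr t (if c then 1 else 0) \<in> C" if t: "xlarge t" "\<forall>x. memf x t \<longrightarrow> x \<in> L" for t
    proof -
      have tc: "pr t 1 \<in> C \<longleftrightarrow> c" using L(4) t by (simp add: col_def q X)
      obtain i where i: "pr t i \<in> C" using AC t(1) unfolding colouring_def by blast
      then have "i < 2" using AC unfolding colouring_def by fastforce
      then have "i = 0 \<or> i = 1" using less_add_one_iff[of i 1] by (auto simp: le_less)
      then show ?thesis using tc i by auto
    qed
    then show ?thesis unfolding homogeneous_def by blast
  qed
  ultimately show "\<exists>L\<in>fam. infinite_set L \<and> L \<subseteq> A \<and> homogeneous C L" using L(1,2) by blast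
qed

theorem theorem6:
  fixes M :: "'n l2_structure"
  assumes "sets_of M \<noteq> {}"
    and "\<forall>\<phi>\<in>RCA0. M \<Turnstile> \<phi>"
  shows "M \<Turnstile> (RT_exactly_large \<^bold>\<longleftrightarrow> Omega_jumps_exist)"
proof (rule ccontr)
  assume "\<not> ?thesis"
  then have "counter_model M" using assms by (simp add: counter_model_def rca0_model_def)
  \<comment> \<open>\<open>num_model\<close> was chosen to be a counterexample if \<open>'n\<close>
    has one, while on \<open>'n num\<close> both implications follow from the class
    instance.\<close>
  then have cm: "counter_model (num_model :: 'n num l2_structure)" using num_model(2) by blast
  have "(std :: 'n num l2_structure) \<Turnstile> (RT_exactly_large \<^bold>\<longleftrightarrow> Omega_jumps_exist)"
    unfolding models_def sat.simps sat_RT sat_Omega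
  proof (intro allI impI conjI ballI)
    fix X :: "'n num set"
    assume RT: "\<forall>A\<in>fam :: 'n num set set. \<forall>C\<in>fam. infinite_set A \<and> colouring C \<longrightarrow>
        (\<exists>L\<in>fam. infinite_set L \<and> L \<subseteq> A \<and> homogeneous C L)" and X: "X \<in> fam"
    show "\<exists>Y\<in>fam. \<forall>n. section_of Y n \<in> fam \<and> (\<exists>Z\<in>fam. jump_sequence X n (section_of Y n) Z)"
      by (rule RT_imp_Omega[OF _ X]) (simp add: RT)
  next
    fix A C :: "'n num set"
    assume omega: "\<forall>X\<in>fam :: 'n num set set. \<exists>Y\<in>fam. \<forall>n. section_of Y n \<in> fam \<and>
        (\<exists>Z\<in>fam. jump_sequence X n (section_of Y n) Z)"
      and AC: "A \<in> fam" "C \<in> fam" "infinite_set A \<and> colouring C"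
    show "\<exists>L\<in>fam. infinite_set L \<and> L \<subseteq> A \<and> homogeneous C L"
      by (rule Omega_imp_RT) (use omega AC in auto)
  qed
  then show False using cm unfolding std_num counter_model_def by blast
qed

end
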